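(* Let $G$ be a connected graph other than the $5$-cycle $C_5$. If $\operatorname{mad}(G)<\frac{12}{5}$, then $G$ is proper conflict-free $\kappa_G$-choosable.
   Context: All graphs are finite, simple and undirected, with nonempty vertex set. The maximum average degree is $\operatorname{mad}(G)=\max\{2|E(H)|/|V(H)| : H\subseteq G,\ V(H)\neq\emptyset\}$. The function $\kappa_G:V(G)\to\mathbb{N}$ is defined by $\kappa_G(v)=4$ if $d_G(v)=2$ and $\kappa_G(v)=d_G(v)+1$ if $d_G(v)\neq 2$. A list assignment $L$ assigns to each vertex $v$ a set $L(v)$ of colors; an $L$-coloring is a map $\varphi$ on $V(G)$ with $\varphi(v)\in L(v)$ for every $v$ and $\varphi(u)\neq\varphi(v)$ for every edge $uv$. A (proper) $L$-coloring is proper conflict-free if for every non-isolated vertex $v$ there is a color that appears exactly once in the neighborhood $N_G(v)$ (i.e. on exactly one neighbor of $v$). $G$ is proper conflict-free $\kappa_G$-choosable if every list assignment $L$ with $|L(v)|\ge\kappa_G(v)$ for all $v\in V(G)$ admits a proper conflict-free $L$-coloring of $G$. *)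

theory Defs
  imports Complex_Main "Graph_Theory.Digraph_Component" "Graph_Theory.Digraph_Isomorphism"
begin

text \<open>
  A finite simple undirected graph is a \<^locale>\<open>pair_graph\<close>: a finite vertex set
  together with a finite, symmetric, irreflexive arc relation. An undirected edge
  \<open>uv\<close> is represented by the two arcs \<open>(u, v)\<close> and \<open>(v, u)\<close>. The locale admits the
  null graph; \<^const>\<open>Digraph_Component.connected\<close> excludes it.
\<close>

definition undirected_edges :: "'a pair_pre_digraph \<Rightarrow> 'a set set" where
  "undirected_edges G = (\<lambda>(u, v). {u, v}) ` parcs G"

definition neighborhood :: "'a pair_pre_digraph \<Rightarrow> 'a \<Rightarrow> 'a set" where
  "neighborhood G v = {u. (v, u) \<in> parcs G}"

definition degree :: "'a pair_pre_digraph \<Rightarrow> 'a \<Rightarrow> nat" where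
  "degree G v = card (neighborhood G v)"

text \<open>
  \<^const>\<open>subgraph\<close> alone would also admit asymmetric arc sets, hence the condition
  \<^term>\<open>pair_graph H\<close>.
\<close>

definition nonempty_subgraphs :: "'a pair_pre_digraph \<Rightarrow> 'a pair_pre_digraph set" where
  "nonempty_subgraphs G =
     {H. pair_graph H \<and> subgraph (with_proj H) (with_proj G) \<and> pverts H \<noteq> {}}"

definition mad :: "'a pair_pre_digraph \<Rightarrow> real" where
  "mad G = Max ((\<lambda>H. 2 * real (card (undirected_edges H)) / real (card (pverts H)))
                  ` nonempty_subgraphs G)"

definition cycle_graph :: "nat \<Rightarrow> nat pair_pre_digraph" where
  "cycle_graph n = \<lparr> pverts = {..<n},
     parcs = {(i, j). i < n \<and> j < n \<and> (j = Suc i mod n \<or> i = Suc j mod n)} \<rparr>"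

definition kappa :: "'a pair_pre_digraph \<Rightarrow> 'a \<Rightarrow> nat" where
  "kappa G v = (if degree G v = 2 then 4 else degree G v + 1)"

definition proper_list_coloring ::
  "'a pair_pre_digraph \<Rightarrow> ('a \<Rightarrow> 'c set) \<Rightarrow> ('a \<Rightarrow> 'c) \<Rightarrow> bool" where
  "proper_list_coloring G L \<phi> \<longleftrightarrow>
     (\<forall>v \<in> pverts G. \<phi> v \<in> L v) \<and> (\<forall>(u, v) \<in> parcs G. \<phi> u \<noteq> \<phi> v)"

definition conflict_free :: "'a pair_pre_digraph \<Rightarrow> ('a \<Rightarrow> 'c) \<Rightarrow> bool" where
  "conflict_free G \<phi> \<longleftrightarrow>
     (\<forall>v \<in> pverts G. neighborhood G v \<noteq> {} \<longrightarrow> (\<exists>c. \<exists>!u. u \<in> neighborhood G v \<and> \<phi> u = c))"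

text \<open>
  The type of colors is an explicit parameter, so a statement with a free color type
  covers every color universe. Lists may be infinite; since \<^const>\<open>card\<close> is \<open>0\<close>
  on infinite sets, that case of \<open>\<bar>L(v)\<bar> \<ge> f(v)\<close> is listed separately.
\<close>

definition pcf_choosable :: "'c itself \<Rightarrow> 'a pair_pre_digraph \<Rightarrow> ('a \<Rightarrow> nat) \<Rightarrow> bool" where
  "pcf_choosable C G f \<longleftrightarrow>
     (\<forall>L :: 'a \<Rightarrow> 'c set.
        (\<forall>v \<in> pverts G. infinite (L v) \<or> f v \<le> card (L v)) \<longrightarrow>
        (\<exists>\<phi>. proper_list_coloring G L \<phi> \<and> conflict_free G \<phi>))"

text \<open>The maximum in \<^const>\<open>mad\<close> ranges over a finite nonempty set.\<close>

lemma finite_nonempty_subgraphs: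
  assumes "pair_graph G"
  shows "finite (nonempty_subgraphs G)"
proof -
  interpret pair_graph G by fact
  have "nonempty_subgraphs G \<subseteq>
      (\<lambda>(V, A). \<lparr>pverts = V, parcs = A\<rparr>) ` (Pow (pverts G) \<times> Pow (parcs G))"
  proof
    fix H assume "H \<in> nonempty_subgraphs G"
    then have "pverts H \<subseteq> pverts G" "parcs H \<subseteq> parcs G"
      by (auto simp: nonempty_subgraphs_def subgraph_def)
    then show "H \<in> (\<lambda>(V, A). \<lparr>pverts = V, parcs = A\<rparr>) ` (Pow (pverts G) \<times> Pow (parcs G))"
      by (intro image_eqI[where x = "(pverts H, parcs H)"]) auto
  qed
  then show ?thesis
    using pair_finite_verts pair_finite_arcs by (auto intro: finite_subset)
qed

lemma nonempty_subgraphs_self: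
  assumes "pair_graph G" "pverts G \<noteq> {}"
  shows "G \<in> nonempty_subgraphs G"
proof -
  interpret pair_graph G by fact
  show ?thesis
    using assms by (simp add: nonempty_subgraphs_def subgraph_def compatible_def wf_digraph)
qed

lemma pair_graph_cycle_graph:
  assumes "n \<ge> 3"
  shows "pair_graph (cycle_graph n)"
proof
  show "finite (parcs (cycle_graph n))"
    by (rule finite_subset[where B = "{..<n} \<times> {..<n}"]) (auto simp: cycle_graph_def)
  show "fst e \<noteq> snd e" if "e \<in> parcs (cycle_graph n)" for e
    using that assms by (auto simp: cycle_graph_def mod_Suc split: if_splits)
qed (auto simp: cycle_graph_def symmetric_def sym_def)

end

theory Submission
  imports Defs
begin

text \<open>
  The proof takes a counterexample with fewest vertices and plays local recoloring arguments
  against an average degree count.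

  Delete a set \<open>X\<close> of vertices and color the rest by minimality. Every remaining vertex \<open>y\<close> that
  still has neighbors sees some color exactly once; fix one such protected color for \<open>y\<close>. If each
  \<open>x\<close> in \<open>X\<close> is colored so that, for every neighbor \<open>y\<close> outside \<open>X\<close>, it avoids the color of \<open>y\<close>
  and the protected color of \<open>y\<close>, then \<open>y\<close> stays satisfied (\<open>no_extension_if_attached\<close>). A vertex
  of degree 2 has four colors and is constrained by few, so short paths of vertices of degree 2,
  and leaves at vertices of small degree, can be removed.

  The 5-cycle is the one obstacle to this induction: any two of its vertices are adjacent or have
  a common neighbor, so with five equal lists of four colors it has no coloring, and deleting
  \<open>X\<close> may leave such a cycle as a component. It does become colorable once a single vertex
  is allowed two neighbors of the same color. A vertex of the cycle with a neighbor in \<open>X\<close> may be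
  given this freedom: since its list has only four colors, it has degree 3, and its neighbor
  in \<open>X\<close> has a unique color as soon as it avoids the repeated one. The induction
  statement \<open>sparse_pcf_colorable\<close> therefore speaks of colorings that are relaxed at a set \<open>R\<close> which
  meets every tight 5-cycle (one with five lists of size four), and the repeated color takes over the role of the protected color.

  Large parts around a vertex \<open>w\<close> of degree at least 4 are handled by counting. Let \<open>w\<close> have \<open>l\<close>
  leaves, \<open>k\<close> neighbors of degree at least 3 and otherwise neighbors of degree 2. Delete \<open>w\<close>, the
  leaves and the neighbors of degree 2, and of \<open>m\<close> threads (paths of vertices of degree 2)
  starting at \<open>w\<close> also the further vertices. Then \<open>w\<close> keeps at least \<open>l + 1 - k + m\<close> colors, and
  each deleted neighbor keeps two options as long as \<open>w\<close> is not colored. A color of \<open>w\<close> can fail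
  only if together with it at least four neighbors are forced, where the \<open>k\<close> old neighbors count
  as forced (\<open>star_choice\<close>). A leaf or a thread is forced by at most two colors of \<open>w\<close>, a completely
  deleted thread of three vertices by at most one. If \<open>w\<close> has too many long threads, these numbers do not fit
  (\<open>star_impossible\<close>).

  Finally, remove all leaves. In the remaining graph each vertex of degree \<open>d\<close> gets the charge
  \<open>5 d - 12\<close>, and the sum of all charges is negative by the density hypothesis. A vertex of degree 2
  has charge \<open>-2\<close> and asks the two ends of its thread for one unit each, so that an end of a thread
  with \<open>i\<close> vertices pays \<open>i\<close> units for it. The counting around \<open>w\<close> shows that everybody can pay
  (\<open>demand_bound\<close>), which is a contradiction.
\<close>

section \<open>Choosing colors from lists\<close>

definition has_unique :: "'i set \<Rightarrow> ('i \<Rightarrow> 'c) \<Rightarrow> bool" where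
  "has_unique I f \<longleftrightarrow> (\<exists>i\<in>I. \<forall>j\<in>I. f j = f i \<longrightarrow> j = i)"

lemma has_unique_cong: "(\<And>i. i \<in> I \<Longrightarrow> f i = g i) \<Longrightarrow> has_unique I f = has_unique I g"
  by (auto simp: has_unique_def)

lemma has_unique_pair: "a \<in> I \<Longrightarrow> I \<subseteq> {a, b} \<Longrightarrow> f a \<noteq> f b \<Longrightarrow> has_unique I f"
  unfolding has_unique_def by (rule bexI[of _ a]) auto

lemma has_unique_triple:
  assumes "I = {a, b, c}" "a \<noteq> b" "a \<noteq> c" "b \<noteq> c" "f a \<noteq> f b \<or> f a \<noteq> f c \<or> f b \<noteq> f c"
  shows "has_unique I f"
  using assms unfolding has_unique_def by (cases "f a = f b"; cases "f a = f c") auto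

lemma has_unique_doubleD:
  assumes "has_unique {a, b} f" "a \<noteq> b"
  shows "f a \<noteq> f b"
  using assms by (auto simp: has_unique_def)

lemma has_unique_singleton: "has_unique {a} f"
  by (simp add: has_unique_def)

lemma card_diff_set_ge:
  assumes "finite A" "n + length xs \<le> card A"
  shows "n \<le> card (A - set xs)"
proof -
  have "card A - card (set xs) \<le> card (A - set xs)"
    by (rule diff_card_le_card_Diff) simp
  moreover have "card (set xs) \<le> length xs" by (rule card_length)
  ultimately show ?thesis using assms(2) by linarith
qed

text \<open>
  The forbidden colors are a list, so that its length bounds their number without any
  knowledge about coincidences.
\<close>

lemma ex_avoiding:
  assumes "finite A" "length xs < card A"
  shows "\<exists>a\<in>A. a \<notin> set xs"
proof -
  have "1 \<le> card (A - set xs)" using card_diff_set_ge[of A 1 xs] assms by simp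
  then have "A - set xs \<noteq> {}" by (metis card.empty not_one_le_zero)
  then show ?thesis by blast
qed

text \<open>
  Give \<open>y\<close> the color \<open>a\<close> and let all others avoid it: only an index whose sole option
  is \<open>a\<close> could object.
\<close>

lemma unique_choice:
  assumes ne: "\<And>i. i \<in> I \<Longrightarrow> Q i \<noteq> {}"
    and y: "y \<in> I" "a \<in> Q y" and only: "\<And>i. i \<in> I \<Longrightarrow> Q i = {a} \<Longrightarrow> i = y"
  shows "\<exists>g. (\<forall>i\<in>I. g i \<in> Q i) \<and> has_unique I g"
proof -
  define g where "g = (\<lambda>i. if i = y then a else SOME b. b \<in> Q i \<and> b \<noteq> a)"
  have other: "g i \<in> Q i \<and> g i \<noteq> a" if "i \<in> I" "i \<noteq> y" for i
  proof -
    have "\<exists>b. b \<in> Q i \<and> b \<noteq> a" using ne[OF that(1)] only[OF that(1)] that(2) by blast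
    from someI_ex[OF this] show ?thesis using that(2) by (simp add: g_def)
  qed
  have "\<forall>i\<in>I. g i \<in> Q i" using other y(2) by (metis g_def)
  moreover have "has_unique I g"
    unfolding has_unique_def using y(1) other by (intro bexI[of _ y]) (auto simp: g_def)
  ultimately show ?thesis by blast
qed

text \<open>
  Two options \<open>e\<close>, \<open>f\<close> of the same index cannot both be forced twice elsewhere if at
  most three indices are forced at all, so one of them can be made unique.
\<close>

lemma unique_choice_if_few_forced:
  assumes fin: "finite I" and ne: "\<And>i. i \<in> I \<Longrightarrow> Q i \<noteq> {}"
    and x: "x \<in> I" "e \<in> Q x" "f \<in> Q x" "e \<noteq> f"
    and few: "card {i \<in> I. is_singleton (Q i)} \<le> 3"
  shows "\<exists>g. (\<forall>i\<in>I. g i \<in> Q i) \<and> has_unique I g"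
proof -
  note main = unique_choice[of I Q, OF ne]
  let ?S = "\<lambda>a. {i \<in> I. Q i = {a}}"
  have "?S e \<union> ?S f \<subseteq> {i \<in> I. is_singleton (Q i)}" by (auto simp: is_singleton_def)
  then have "card (?S e \<union> ?S f) \<le> 3"
    using few fin card_mono[of "{i \<in> I. is_singleton (Q i)}" "?S e \<union> ?S f"] by simp
  moreover have "card (?S e \<union> ?S f) = card (?S e) + card (?S f)"
    using fin x(4) by (intro card_Un_disjoint) auto
  ultimately have "card (?S e) \<le> 1 \<or> card (?S f) \<le> 1" by linarith
  then obtain a where a: "a \<in> Q x" "card (?S a) \<le> 1" using x by blast
  show ?thesis
  proof (cases "?S a = {}")
    case True
    then show ?thesis using main[OF _ x(1) a(1)] by blast
  next
    case False
    then have "card (?S a) = 1" using a(2) fin by (simp add: card_gt_0_iff le_antisym Suc_leI)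
    then obtain y where "?S a = {y}" by (metis card_1_singletonE)
    then show ?thesis using main[of y a] a \<open>?S a = {y}\<close> by blast
  qed
qed

text \<open>
  The counting argument around a center: \<open>F\<close> are its uncolored neighbors, \<open>K\<close> the colored
  ones, \<open>W\<close> the colors available for the center, and \<open>s x\<close> bounds the number of colors \<open>c\<close> that
  leave \<open>x\<close> a single option. If every \<open>c\<close> forced at least \<open>4 - card K\<close> elements of \<open>F\<close>, double
  counting would contradict the last hypothesis; any other \<open>c\<close> leaves at most three forced
  neighbors, the elements of \<open>K\<close> included.
\<close>

lemma star_choice:
  fixes Q :: "'i \<Rightarrow> 'c \<Rightarrow> 'd set"
  assumes finF: "finite F" and finK: "finite K" and disj: "F \<inter> K = {}" and finW: "finite W"
    and ne: "\<And>x c. x \<in> F \<Longrightarrow> c \<in> W \<Longrightarrow> Q x c \<noteq> {}"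
    and sing: "\<And>x. x \<in> F \<Longrightarrow> card {c \<in> W. is_singleton (Q x c)} \<le> s x"
    and big: "4 \<le> card F + card K"
    and count: "sum s F < (4 - card K) * card W"
  shows "\<exists>c\<in>W. \<exists>g. (\<forall>x\<in>F. g x \<in> Q x c) \<and> (\<forall>y\<in>K. g y = b y) \<and> has_unique (F \<union> K) g"
proof -
  let ?n = "\<lambda>c. card {x \<in> F. is_singleton (Q x c)}"
  have "(\<Sum>c\<in>W. ?n c) = (\<Sum>c\<in>W. \<Sum>x\<in>F. if is_singleton (Q x c) then 1 else 0)"
    using finF by (simp add: sum.If_cases Int_def)
  also have "\<dots> = (\<Sum>x\<in>F. \<Sum>c\<in>W. if is_singleton (Q x c) then 1 else 0)"
    by (rule sum.swap)
  also have "\<dots> = (\<Sum>x\<in>F. card {c \<in> W. is_singleton (Q x c)})"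
    using finW by (simp add: sum.If_cases Int_def)
  also have "\<dots> \<le> sum s F" by (rule sum_mono) (rule sing)
  finally have "(\<Sum>c\<in>W. ?n c) < (4 - card K) * card W" using count by simp
  moreover have "(4 - card K) * card W \<le> (\<Sum>c\<in>W. ?n c)" if "\<And>c. c \<in> W \<Longrightarrow> 4 - card K \<le> ?n c"
    using sum_bounded_below[of W "4 - card K" ?n, OF that] by (simp add: mult.commute)
  ultimately obtain c where c: "c \<in> W" "?n c < 4 - card K"
    by (meson linorder_not_less)
  let ?P = "\<lambda>i. if i \<in> F then Q i c else {b i}"
  have sub: "{i \<in> F \<union> K. is_singleton (?P i)} \<subseteq> {x \<in> F. is_singleton (Q x c)} \<union> K" by auto
  have "card {i \<in> F \<union> K. is_singleton (?P i)} \<le> card ({x \<in> F. is_singleton (Q x c)} \<union> K)"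
    using sub finF finK by (intro card_mono) auto
  also have "\<dots> \<le> ?n c + card K" by (rule card_Un_le)
  finally have few: "card {i \<in> F \<union> K. is_singleton (?P i)} \<le> 3" using c(2) by linarith
  have "\<exists>x\<in>F. \<not> is_singleton (Q x c)"
  proof (rule ccontr)
    assume "\<not> ?thesis"
    then have "{x \<in> F. is_singleton (Q x c)} = F" by blast
    then show False using c(2) big by simp
  qed
  then obtain x where x: "x \<in> F" "\<not> is_singleton (Q x c)" by blast
  then obtain e f where ef: "e \<in> Q x c" "f \<in> Q x c" "e \<noteq> f"
    using ne[OF x(1) c(1)] by (metis ex_in_conv is_singletonI')
  have "\<exists>g. (\<forall>i\<in>F \<union> K. g i \<in> ?P i) \<and> has_unique (F \<union> K) g"
  proof (rule unique_choice_if_few_forced[OF _ _ _ _ _ ef(3) few])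
    show "finite (F \<union> K)" using finF finK by simp
    show "?P i \<noteq> {}" if "i \<in> F \<union> K" for i using ne[OF _ c(1)] that by auto
  qed (use x ef in auto)
  then obtain g where g: "\<forall>i\<in>F \<union> K. g i \<in> ?P i" "has_unique (F \<union> K) g" by blast
  have "\<forall>y\<in>K. g y = b y" using g(1) disj by (metis UnI2 disjoint_iff singletonD)
  moreover have "\<forall>x\<in>F. g x \<in> Q x c" using g(1) by (metis UnI1)
  ultimately show ?thesis using c(1) g(2) by blast
qed

text \<open>
  List coloring of the square of a path with four vertices. A common color of the two
  nonadjacent ends is used twice; if there is none, either some end has a color outside
  \<open>A2\<close>, or \<open>A2\<close> contains both end lists and has at least four elements.
\<close>

lemma list_color_K4_minus_edge:
  assumes fin: "finite A1" "finite A2" "finite A3" "finite A4"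
    and card: "2 \<le> card A1" "3 \<le> card A2" "3 \<le> card A3" "2 \<le> card A4"
  shows "\<exists>a1\<in>A1. \<exists>a2\<in>A2. \<exists>a3\<in>A3. \<exists>a4\<in>A4.
    a1 \<noteq> a2 \<and> a1 \<noteq> a3 \<and> a2 \<noteq> a3 \<and> a2 \<noteq> a4 \<and> a3 \<noteq> a4"
proof -
  have fin_choice: ?thesis if a: "a1 \<in> A1" "a4 \<in> A4" "2 \<le> card (A2 - {a1, a4})" for a1 a4
  proof -
    obtain a3 where a3: "a3 \<in> A3" "a3 \<noteq> a1" "a3 \<noteq> a4"
      using ex_avoiding[of A3 "[a1, a4]"] fin card by auto
    obtain a2 where "a2 \<in> A2 - {a1, a4}" "a2 \<noteq> a3"
      using ex_avoiding[of "A2 - {a1, a4}" "[a3]"] fin a(3) by auto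
    then show ?thesis using a(1,2) a3
      by (intro bexI[of _ a1] bexI[of _ a2] bexI[of _ a3] bexI[of _ a4]) auto
  qed
  show ?thesis
  proof (cases "A1 \<inter> A4 = {}")
    case False
    then obtain a where a: "a \<in> A1" "a \<in> A4" by blast
    have "2 \<le> card (A2 - set [a])" by (rule card_diff_set_ge) (use fin card in auto)
    then show ?thesis using fin_choice[OF a] by simp
  next
    case True
    show ?thesis
    proof (cases "A1 \<union> A4 \<subseteq> A2")
      case sub: True
      have "card (A1 \<union> A4) = card A1 + card A4" using fin True by (simp add: card_Un_disjoint)
      then have c2: "4 \<le> card A2" using card_mono[OF fin(2) sub] card by linarith
      obtain a1 a4 where a: "a1 \<in> A1" "a4 \<in> A4" using card by (metis card.empty ex_in_conv not_numeral_le_zero)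
      have "2 \<le> card (A2 - set [a1, a4])" by (rule card_diff_set_ge) (use fin c2 in auto)
      then show ?thesis using fin_choice[OF a] by simp
    next
      case False
      then obtain a where a: "a \<in> A1 \<union> A4" "a \<notin> A2" by blast
      obtain a1 a4 where b: "a1 \<in> A1" "a4 \<in> A4" "a1 \<notin> A2 \<or> a4 \<notin> A2"
        using a card by (metis Un_iff card.empty ex_in_conv not_numeral_le_zero)
      then have "A2 - {a1, a4} = A2 - {a1} \<or> A2 - {a1, a4} = A2 - {a4}" by blast
      moreover have "2 \<le> card (A2 - {b})" for b
        using card_diff_set_ge[of A2 2 "[b]"] fin card by simp
      ultimately show ?thesis using fin_choice[OF b(1,2)] by metis
    qed
  qed
qed

text \<open>
  Two leaves at a center that has two further neighbors colored \<open>b1 \<noteq> b2\<close>. The center color \<open>c\<close>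
  is bad only if the leaf lists are \<open>{c, b1}\<close> and \<open>{c, b2}\<close>; then \<open>c\<close> is the only common color of
  the two lists. So a single color \<open>c0\<close>, chosen from the lists alone, has to be avoided.
\<close>

lemma two_leaf_choice:
  assumes fin: "finite B1" "finite B2" and card: "2 \<le> card B1" "2 \<le> card B2"
  shows "\<exists>c0. \<forall>c b1 b2. c \<noteq> c0 \<longrightarrow> b1 \<noteq> b2 \<longrightarrow>
    (\<exists>e1\<in>B1 - {c}. \<exists>e2\<in>B2 - {c}. b1 \<notin> {e1, e2} \<or> b2 \<notin> {e1, e2})"
proof -
  \<comment> \<open>Any value will do if the lists do not have exactly one common color.\<close>
  define c0 where "c0 = (SOME c. B1 \<inter> B2 = {c})"
  have pair: "B = {c, b}" if "finite B" "2 \<le> card B" "\<not> (\<exists>e\<in>B - {c}. e \<noteq> b)" for B and c b :: 'a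
  proof (rule card_seteq)
    show "B \<subseteq> {c, b}" using that(3) by blast
    show "card {c, b} \<le> card B" using that(2) by (simp add: card_insert_if)
  qed simp
  have "\<exists>e1\<in>B1 - {c}. \<exists>e2\<in>B2 - {c}. b1 \<notin> {e1, e2} \<or> b2 \<notin> {e1, e2}"
    if c: "c \<noteq> c0" and b: "b1 \<noteq> b2" for c b1 b2
  proof (rule ccontr)
    assume fail: "\<not> ?thesis"
    have "B1 = {c, b} \<or> B2 = {c, b}" if "b \<in> {b1, b2}" for b
    proof (rule ccontr)
      assume "\<not> ?thesis"
      then obtain e1 e2 where "e1 \<in> B1 - {c}" "e1 \<noteq> b" "e2 \<in> B2 - {c}" "e2 \<noteq> b"
        using pair[OF fin(1) card(1), of c b] pair[OF fin(2) card(2), of c b] by blast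
      then show False using fail that by auto
    qed
    then have or1: "B1 = {c, b1} \<or> B2 = {c, b1}" and or2: "B1 = {c, b2} \<or> B2 = {c, b2}" by blast+
    have "{c, b1} \<noteq> {c, b2}" using b by (metis doubleton_eq_iff)
    then have alt: "B1 = {c, b1} \<and> B2 = {c, b2} \<or> B1 = {c, b2} \<and> B2 = {c, b1}"
      using or1 or2 by metis
    have "2 \<le> card {c, b1}" "2 \<le> card {c, b2}" using or1 or2 card by metis+
    then have "c \<noteq> b1" "c \<noteq> b2" by (cases "c = b1"; cases "c = b2"; simp)+
    then have "{c, b1} \<inter> {c, b2} = {c}" using b by blast
    then have "B1 \<inter> B2 = {c}" using alt by (metis inf_commute)
    then have "B1 \<inter> B2 = {c0}" unfolding c0_def by (rule someI)
    then show False using \<open>B1 \<inter> B2 = {c}\<close> c by simp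
  qed
  then show ?thesis by blast
qed

text \<open>
  The case of a center with exactly two other neighbors \<open>p\<close>, \<open>q\<close>, where the count in \<open>star_choice\<close>
  is too weak. A failing center color \<open>c\<close> needs leaves with the lists \<open>{c, b1}\<close> and \<open>{c, b2}\<close> if
  \<open>b1 \<noteq> b2\<close>, and these are different for different \<open>c\<close>. If \<open>b1 = b2\<close>, it needs two leaves whose
  two-element list contains \<open>c\<close>; as there are at least as many colors as leaves, both counts
  are tight. The leaves then come in pairs with equal lists, and a leaf outside the pair that
  contains \<open>c\<close> has a color that no other neighbor is forced to use.
\<close>

lemma many_leaves_choice:
  fixes A :: "'i \<Rightarrow> 'c set"
  assumes fin: "finite \<Lambda>" and l: "3 \<le> card \<Lambda>" and pq: "p \<notin> \<Lambda>" "q \<notin> \<Lambda>" "p \<noteq> q"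
    and A: "\<And>v. v \<in> \<Lambda> \<Longrightarrow> finite (A v) \<and> 2 \<le> card (A v)"
    and W: "finite W" "b1 \<notin> W" "b2 \<notin> W" "card \<Lambda> \<le> card W + 1" "b1 = b2 \<longrightarrow> card \<Lambda> \<le> card W"
  shows "\<exists>c\<in>W. \<exists>g. (\<forall>v\<in>\<Lambda>. g v \<in> A v - {c}) \<and> g p = b1 \<and> g q = b2 \<and> has_unique (\<Lambda> \<union> {p, q}) g"
proof (rule ccontr)
  assume none: "\<not> ?thesis"
  define Q where "Q = (\<lambda>c v. if v = p then {b1} else if v = q then {b2} else A v - {c})"
  have Qv: "Q c v = A v - {c}" if "v \<in> \<Lambda>" for c v using that pq by (auto simp: Q_def)
  have Qpq: "Q c p = {b1}" "Q c q = {b2}" for c using pq by (auto simp: Q_def)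
  have ne: "Q c v \<noteq> {}" if "v \<in> \<Lambda> \<union> {p, q}" for c v
  proof (cases "v \<in> \<Lambda>")
    case True
    then show ?thesis using ex_avoiding[of "A v" "[c]"] A[OF True] Qv by auto
  next
    case False
    then show ?thesis using that Qpq by auto
  qed
  have fail: "\<exists>i\<in>\<Lambda> \<union> {p, q}. i \<noteq> y \<and> Q c i = {a}" if y: "c \<in> W" "y \<in> \<Lambda> \<union> {p, q}" "a \<in> Q c y" for c y a
  proof (rule ccontr)
    assume "\<not> ?thesis"
    then have only: "i = y" if "i \<in> \<Lambda> \<union> {p, q}" "Q c i = {a}" for i using that by blast
    obtain g where g: "\<forall>i\<in>\<Lambda> \<union> {p, q}. g i \<in> Q c i" "has_unique (\<Lambda> \<union> {p, q}) g"
      using unique_choice[of "\<Lambda> \<union> {p, q}" "Q c", OF ne y(2,3) only] by blast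
    have "\<forall>v\<in>\<Lambda>. g v \<in> A v - {c}" using g(1) Qv by blast
    moreover have "g p = b1" "g q = b2" using g(1) Qpq by auto
    ultimately show False using none y(1) g(2) by blast
  qed
  have pair: "A v = {c, a}" if "v \<in> \<Lambda>" "Q c v = {a}" for c v a
  proof (rule card_seteq)
    show "A v \<subseteq> {c, a}" using that Qv by blast
    show "card {c, a} \<le> card (A v)" using A[OF that(1)] by (simp add: card_insert_if)
  qed simp
  show False
  proof (cases "b1 = b2")
    case False
    have "\<exists>v\<in>\<Lambda>. A v = {c, b1}" "\<exists>v\<in>\<Lambda>. A v = {c, b2}" if c: "c \<in> W" for c
    proof -
      obtain i where i: "i \<in> \<Lambda> \<union> {p, q}" "i \<noteq> p" "Q c i = {b1}" using fail[OF c, of p b1] Qpq by blast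
      then have "i \<in> \<Lambda>" using Qpq False by auto
      then show "\<exists>v\<in>\<Lambda>. A v = {c, b1}" using pair i by blast
      obtain j where j: "j \<in> \<Lambda> \<union> {p, q}" "j \<noteq> q" "Q c j = {b2}" using fail[OF c, of q b2] Qpq by blast
      then have "j \<in> \<Lambda>" using Qpq False by auto
      then show "\<exists>v\<in>\<Lambda>. A v = {c, b2}" using pair j by blast
    qed
    then obtain f1 f2 where f1: "\<And>c. c \<in> W \<Longrightarrow> f1 c \<in> \<Lambda> \<and> A (f1 c) = {c, b1}"
      and f2: "\<And>c. c \<in> W \<Longrightarrow> f2 c \<in> \<Lambda> \<and> A (f2 c) = {c, b2}" by metis
    have inj: "inj_on f1 W" "inj_on f2 W"
      using f1 f2 W(2,3) by (auto simp: inj_on_def doubleton_eq_iff) (metis doubleton_eq_iff)+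
    have "f1 c \<noteq> f2 d" if "c \<in> W" "d \<in> W" for c d
      using f1[OF that(1)] f2[OF that(2)] W(2,3) that False by (metis doubleton_eq_iff)
    then have "f1 ` W \<inter> f2 ` W = {}" by blast
    then have "card (f1 ` W \<union> f2 ` W) = card W + card W"
      using W(1) inj by (simp add: card_Un_disjoint card_image)
    moreover have "card (f1 ` W \<union> f2 ` W) \<le> card \<Lambda>"
      using f1 f2 by (intro card_mono[OF fin]) blast
    ultimately show False using W(4) l by linarith
  next
    case True
    define M where "M = (\<lambda>c. {v \<in> \<Lambda>. c \<in> A v \<and> card (A v) = 2})"
    have finM: "finite (M c)" for c using fin by (simp add: M_def)
    have pairM: "v \<in> M c" if "v \<in> \<Lambda>" "Q c v = {a}" for v c a
    proof -
      have eq: "A v = {c, a}" by (rule pair[OF that])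
      then have "card (A v) \<le> 2" by (simp add: card_insert_if)
      then show ?thesis using eq A[OF that(1)] that(1) unfolding M_def by simp
    qed
    have in_L: "i \<in> \<Lambda>" if "i \<in> \<Lambda> \<union> {p, q}" "Q c i = {a}" "a \<noteq> b1" for i c a
      using that Qpq True by auto
    have M2: "2 \<le> card (M c)" if c: "c \<in> W" for c
    proof -
      have "\<exists>i j. i \<noteq> j \<and> {i, j} \<subseteq> M c"
      proof (cases "\<exists>v\<in>\<Lambda>. \<exists>a\<in>Q c v. a \<noteq> b1")
        case True
        then obtain v a where v: "v \<in> \<Lambda>" "a \<in> Q c v" "a \<noteq> b1" by blast
        obtain i where i: "i \<in> \<Lambda> \<union> {p, q}" "Q c i = {a}" using fail[OF c, of v a] v by blast
        obtain j where j: "j \<in> \<Lambda> \<union> {p, q}" "j \<noteq> i" "Q c j = {a}" using fail[OF c, of i a] i by blast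
        show ?thesis using pairM in_L i j v(3) by blast
      next
        case False
        have "Q c v = {b1}" if v: "v \<in> \<Lambda>" for v
        proof -
          have "Q c v \<subseteq> {b1}" using False v by blast
          moreover have "Q c v \<noteq> {}" by (rule ne) (use v in blast)
          ultimately show ?thesis by (meson subset_singletonD)
        qed
        then have "\<Lambda> \<subseteq> M c" using pairM by blast
        moreover obtain i where "i \<in> \<Lambda>" using ex_avoiding[OF fin, of "[]"] l by auto
        moreover obtain j where "j \<in> \<Lambda>" "j \<noteq> i" using ex_avoiding[OF fin, of "[i]"] l by auto
        ultimately show ?thesis by blast
      qed
      then obtain i j where ij: "i \<noteq> j" "{i, j} \<subseteq> M c" by blast
      then show ?thesis using card_mono[OF finM ij(2)] by simp
    qed
    let ?m = "\<lambda>v. card {c \<in> W. v \<in> M c}"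
    have m2: "?m v \<le> 2" if v: "v \<in> \<Lambda>" for v
    proof (cases "card (A v) = 2")
      case True
      have "?m v \<le> card (A v)" using A[OF v] by (intro card_mono) (auto simp: M_def)
      then show ?thesis using True by simp
    next
      case False
      then show ?thesis by (simp add: M_def)
    qed
    have swap: "(\<Sum>c\<in>W. card (M c)) = (\<Sum>v\<in>\<Lambda>. ?m v)"
    proof -
      have "(\<Sum>c\<in>W. card (M c)) = (\<Sum>c\<in>W. \<Sum>v\<in>\<Lambda>. if v \<in> M c then 1 else 0)"
        using fin by (intro sum.cong refl) (auto simp: sum.If_cases M_def Int_def intro!: arg_cong[of _ _ card])
      also have "\<dots> = (\<Sum>v\<in>\<Lambda>. \<Sum>c\<in>W. if v \<in> M c then 1 else 0)" by (rule sum.swap)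
      also have "\<dots> = (\<Sum>v\<in>\<Lambda>. ?m v)" using W(1) by (simp add: sum.If_cases Int_def)
      finally show ?thesis .
    qed
    have lo: "2 * card W \<le> (\<Sum>c\<in>W. card (M c))"
      using sum_bounded_below[of W 2 "\<lambda>c. card (M c)"] M2 by (simp add: mult.commute)
    have hi: "(\<Sum>v\<in>\<Lambda>. ?m v) \<le> 2 * card \<Lambda>"
      using sum_bounded_above[of \<Lambda> ?m 2] m2 by (simp add: mult.commute)
    have eqs: "(\<Sum>c\<in>W. 2) = (\<Sum>c\<in>W. card (M c))" "(\<Sum>v\<in>\<Lambda>. ?m v) = (\<Sum>v\<in>\<Lambda>. 2)"
      using swap lo hi W(5) True by simp_all
    have Mc: "card (M c) = 2" if "c \<in> W" for c
      using sum_mono_inv[OF eqs(1) M2 that W(1)] by simp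
    have mv: "?m v = 2" if "v \<in> \<Lambda>" for v
      using sum_mono_inv[OF eqs(2) m2 that fin] by simp
    have AW: "A v \<subseteq> W" if v: "v \<in> \<Lambda>" for v
    proof -
      have "{c \<in> W. v \<in> M c} \<noteq> {}" using mv[OF v] by (metis card.empty zero_neq_numeral)
      then have "card (A v) = 2" by (auto simp: M_def)
      then have "{c \<in> W. v \<in> M c} = A v"
        using A[OF v] mv[OF v] by (intro card_seteq) (auto simp: M_def)
      then show ?thesis by blast
    qed
    then have b1A: "b1 \<notin> A v" if "v \<in> \<Lambda>" for v using W(2) that by blast
    have "W \<noteq> {}" using W(5) True l by auto
    then obtain c where c: "c \<in> W" by blast
    obtain v i where vi: "M c = {v, i}" "v \<noteq> i" using Mc[OF c] by (auto simp: card_2_iff)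
    have v: "v \<in> \<Lambda>" "c \<in> A v" "card (A v) = 2" using vi by (auto simp: M_def)
    obtain x y where xy: "A v = {x, y}" "x \<noteq> y" using v(3) by (auto simp: card_2_iff)
    then have "c = x \<or> c = y" using v(2) by simp
    then obtain a where a: "A v = {c, a}" "a \<noteq> c" using xy by (metis insert_commute)
    have aQ: "a \<in> Q c v" using a Qv[OF v(1)] by auto
    have ab: "a \<noteq> b1" using b1A[OF v(1)] a by auto
    obtain i' where i': "i' \<in> \<Lambda> \<union> {p, q}" "i' \<noteq> v" "Q c i' = {a}" using fail[OF c _ aQ] v(1) by blast
    have i'L: "i' \<in> \<Lambda>" using in_L[OF i'(1,3) ab] .
    then have "i' = i" using pairM[OF i'L i'(3)] vi i'(2) by auto
    then have Ai: "A i = {c, a}" using pair[OF i'L i'(3)] by simp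
    have aW: "a \<in> W" using AW[OF v(1)] a by auto
    have "{v, i} \<subseteq> M a" using v a Ai i'L \<open>i' = i\<close> by (auto simp: M_def)
    then have Ma: "M a = {v, i}" using Mc[OF aW] vi(2) finM by (metis card_2_iff card_seteq order_refl)
    obtain u where u: "u \<in> \<Lambda>" "u \<noteq> v" "u \<noteq> i"
      using ex_avoiding[OF fin, of "[v, i]"] l by auto
    have "card (A u) = 2"
    proof -
      have "{c \<in> W. u \<in> M c} \<noteq> {}" using mv[OF u(1)] by (metis card.empty zero_neq_numeral)
      then show ?thesis by (auto simp: M_def)
    qed
    then have uca: "c \<notin> A u" "a \<notin> A u" using u vi Ma by (auto simp: M_def)
    obtain d where d: "d \<in> Q c u" using ne[of u c] u(1) by blast
    have dA: "d \<in> A u" using d Qv[OF u(1)] by blast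
    obtain j where j: "j \<in> \<Lambda> \<union> {p, q}" "Q c j = {d}" using fail[OF c _ d] u(1) by blast
    have "d \<noteq> b1" using b1A[OF u(1)] dA by auto
    then have jL: "j \<in> \<Lambda>" using in_L[OF j] by blast
    then have "j \<in> {v, i}" using pairM[OF jL j(2)] vi by simp
    then have "A j = {c, a}" using a Ai by auto
    then have "{c, a} = {c, d}" using pair[OF jL j(2)] by simp
    then show False using uca dA by (auto simp: doubleton_eq_iff)
  qed
qed

subsection \<open>Options of the first vertex of a thread\<close>

text \<open>
  A set with at least two elements loses all but one only if it has exactly two elements and
  \<open>c\<close> is one of them.
\<close>

lemma leaf_choices:
  assumes "finite A" "2 \<le> card A"
  shows "A - {c} \<noteq> {}" "card {c \<in> W. is_singleton (A - {c})} \<le> 2"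
proof -
  show "A - {c} \<noteq> {}"
    using ex_avoiding[of A "[c]"] assms by auto
  show "card {c \<in> W. is_singleton (A - {c})} \<le> 2"
  proof (cases "\<exists>c. is_singleton (A - {c})")
    case True
    then obtain c a where c: "A - {c} = {a}" by (auto simp: is_singleton_def)
    then have A: "A \<subseteq> {a, c}" by blast
    have sub: "{c \<in> W. is_singleton (A - {c})} \<subseteq> {a, c}"
    proof
      fix d assume "d \<in> {c \<in> W. is_singleton (A - {c})}"
      then have "card (A - {d}) = 1" by (simp add: is_singleton_altdef)
      then have "card (A - {d}) \<noteq> card A" using assms(2) by linarith
      then have "d \<in> A" by (metis Diff_empty Diff_insert0)
      then show "d \<in> {a, c}" using A by blast
    qed
    have "card {c \<in> W. is_singleton (A - {c})} \<le> card {a, c}" by (rule card_mono[OF _ sub]) simp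
    also have "\<dots> \<le> 2" by (simp add: card_insert_if)
    finally show ?thesis .
  next
    case False
    then show ?thesis by simp
  qed
qed

text \<open>
  The options of the first vertex of a thread with two vertices when its center is colored \<open>c\<close>:
  \<open>A\<close> and \<open>A'\<close> are the lists of the two vertices after removal of the colors forbidden by the far
  end. The second vertex must differ from the center too, because the two are the neighbors of
  the first vertex.
\<close>

definition options2 :: "'c set \<Rightarrow> 'c set \<Rightarrow> 'c \<Rightarrow> 'c set" where
  "options2 A A' c = {e \<in> A - {c}. \<exists>e' \<in> A' - {c}. e' \<noteq> e}"

text \<open>
  If \<open>A' - {c}\<close> still has two elements, it never blocks an element of \<open>A - {c}\<close>. Hence \<open>c\<close> can force
  the first vertex only if \<open>c\<close> belongs to \<open>A'\<close> and \<open>A'\<close> has two elements.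
\<close>

lemma options2:
  assumes fin: "finite A" "finite A'" and card: "3 \<le> card A" "2 \<le> card A'"
  shows "options2 A A' c \<noteq> {}" "card {c \<in> W. is_singleton (options2 A A' c)} \<le> 2"
proof -
  have A2: "2 \<le> card (A - {c})" for c using card_diff_set_ge[of A 2 "[c]"] fin card by simp
  show "options2 A A' c \<noteq> {}"
  proof -
    obtain e' where e': "e' \<in> A'" "e' \<noteq> c"
      using ex_avoiding[of A' "[c]"] fin card by auto
    obtain e where e: "e \<in> A" "e \<noteq> c" "e \<noteq> e'"
      using ex_avoiding[of A "[c, e']"] fin card by auto
    then show ?thesis using e' by (auto simp: options2_def)
  qed
  have all: "options2 A A' c = A - {c}" if "2 \<le> card (A' - {c})" for c
  proof -
    have "\<exists>e' \<in> A' - {c}. e' \<noteq> e" for e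
      using ex_avoiding[of "A' - {c}" "[e]"] fin that by auto
    then show ?thesis by (auto simp: options2_def)
  qed
  have sing: "is_singleton (A' - {c})" if "is_singleton (options2 A A' c)" for c
  proof -
    have "card (options2 A A' c) = 1" using that by (simp only: is_singleton_altdef)
    then have "\<not> 2 \<le> card (A' - {c})" using all[of c] A2[of c] by fastforce
    moreover have "1 \<le> card (A' - {c})" using card_diff_set_ge[of A' 1 "[c]"] fin card by simp
    ultimately show ?thesis by (simp add: is_singleton_altdef)
  qed
  have "finite {c \<in> W. is_singleton (A' - {c})}"
  proof (rule finite_subset)
    have "c \<in> A'" if "is_singleton (A' - {c})" for c
      using that card by (cases "c \<in> A'") (auto simp: is_singleton_altdef)
    then show "{c \<in> W. is_singleton (A' - {c})} \<subseteq> A'" by blast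
  qed (use fin in auto)
  then have "card {c \<in> W. is_singleton (options2 A A' c)} \<le> card {c \<in> W. is_singleton (A' - {c})}"
    using sing by (intro card_mono) auto
  also have "\<dots> \<le> 2" by (rule leaf_choices) (use fin card in auto)
  finally show "card {c \<in> W. is_singleton (options2 A A' c)} \<le> 2" .
qed

text \<open>
  The analogue for a thread with three vertices. Only the first two of them are within distance
  two of the center, so \<open>c\<close> is not removed from the last list.
\<close>

definition options3 :: "'c set \<Rightarrow> 'c set \<Rightarrow> 'c set \<Rightarrow> 'c \<Rightarrow> 'c set" where
  "options3 A A' A'' c =
     {e \<in> A - {c}. \<exists>e' \<in> A' - {c}. \<exists>e'' \<in> A''. e' \<noteq> e \<and> e'' \<noteq> e \<and> e'' \<noteq> e'}"

text \<open>
  An element \<open>e\<close> of \<open>A\<close> is blocked only if \<open>A''\<close> is a pair containing \<open>e\<close> and \<open>A'\<close> is contained in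
  \<open>insert c A''\<close>. Since \<open>A'\<close> has three elements, this determines \<open>c\<close> as the element of \<open>A' - A''\<close>.
\<close>

lemma options3:
  assumes fin: "finite A" "finite A'" "finite A''"
    and card: "4 \<le> card A" "3 \<le> card A'" "2 \<le> card A''"
  shows "options3 A A' A'' c \<noteq> {}" "card {c \<in> W. is_singleton (options3 A A' A'' c)} \<le> 1"
proof -
  have bad: "A'' = {e, e'} \<and> e \<in> A'' \<and> e \<noteq> e' \<and> A' \<subseteq> insert c A''"
    if "e \<notin> options3 A A' A'' c" "e \<in> A - {c}" "e' \<in> A' - {c}" "e' \<noteq> e" for e e' c
  proof -
    have sub: "A'' \<subseteq> {e, d}" if "d \<in> A' - {c}" "d \<noteq> e" for d
      using \<open>e \<notin> _\<close> \<open>e \<in> A - {c}\<close> that by (auto simp: options3_def)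
    have eq: "A'' = {e, d}" if "d \<in> A' - {c}" "d \<noteq> e" for d
      by (rule card_seteq) (use sub[OF that] card that in auto)
    have "A'' = {e, e'}" using eq that by blast
    moreover have "A' \<subseteq> insert c A''" using eq that by blast
    ultimately show ?thesis using that by blast
  qed
  have ex: "\<exists>e'. e' \<in> A' - {c} \<and> e' \<noteq> e" for e c
    using ex_avoiding[of A' "[c, e]"] fin card by auto
  have bad': "card A'' = 2 \<and> e \<in> A'' \<and> A' \<subseteq> insert c A''"
    if "e \<notin> options3 A A' A'' c" "e \<in> A - {c}" for e c
    using bad[OF that] ex[of c e] by (auto simp: card_2_iff)
  have A3: "3 \<le> card (A - {c})" for c using card_diff_set_ge[of A 3 "[c]"] fin card by simp
  show "options3 A A' A'' c \<noteq> {}"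
  proof
    assume "options3 A A' A'' c = {}"
    then have *: "card A'' = 2 \<and> e \<in> A'' \<and> A' \<subseteq> insert c A''" if "e \<in> A - {c}" for e using bad' that by blast
    then have "A - {c} \<subseteq> A''" by blast
    then have "card (A - {c}) \<le> card A''" using fin by (intro card_mono)
    moreover have "A - {c} \<noteq> {}" using A3[of c] by (metis card.empty not_numeral_le_zero)
    ultimately show False using * A3[of c] by force
  qed
  have sing: "c \<in> A' - A'' \<and> card A'' = 2 \<and> A' \<subseteq> insert c A''"
    if single: "is_singleton (options3 A A' A'' c)" for c
  proof -
    obtain a where a: "options3 A A' A'' c = {a}" using single by (auto simp: is_singleton_def)
    obtain e where "e \<in> A - {c}" "e \<noteq> a"
      using ex_avoiding[of "A - {c}" "[a]"] fin A3[of c] by auto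
    then have *: "card A'' = 2" "A' \<subseteq> insert c A''" using bad'[of e c] a by auto
    moreover have "\<not> A' \<subseteq> A''" using card_mono[of A'' A'] fin card * by auto
    ultimately show ?thesis by blast
  qed
  have "c = d" if "is_singleton (options3 A A' A'' c)" "is_singleton (options3 A A' A'' d)" for c d
    using sing[OF that(1)] sing[OF that(2)] by blast
  then have "\<exists>a. {c \<in> W. is_singleton (options3 A A' A'' c)} \<subseteq> {a}" by blast
  then obtain a where "{c \<in> W. is_singleton (options3 A A' A'' c)} \<subseteq> {a}" by blast
  then have "card {c \<in> W. is_singleton (options3 A A' A'' c)} \<le> card {a}" by (intro card_mono) auto
  then show "card {c \<in> W. is_singleton (options3 A A' A'' c)} \<le> 1" by simp
qed

section \<open>Induced subgraphs and isolated pentagons\<close>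

text \<open>
  All graphs that occur are induced subgraphs of one graph. So the adjacency relation is fixed,
  and a subgraph is given by its set of vertices.
\<close>

locale adjacency =
  fixes E :: "'a \<Rightarrow> 'a \<Rightarrow> bool"
  assumes E_sym: "E u v \<Longrightarrow> E v u"
    and E_irrefl: "\<not> E v v"
begin

definition nb :: "'a set \<Rightarrow> 'a \<Rightarrow> 'a set" where
  "nb V v = {u \<in> V. E v u}"

definition deg :: "'a set \<Rightarrow> 'a \<Rightarrow> nat" where
  "deg V v = card (nb V v)"

definition kap :: "'a set \<Rightarrow> 'a \<Rightarrow> nat" where
  "kap V v = (if deg V v = 2 then 4 else deg V v + 1)"

text \<open>
  The sum counts every edge twice, so this says that all induced subgraphs have average degree
  less than \<open>12 / 5\<close>, without a maximum and in natural numbers.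
\<close>

definition sparse :: "'a set \<Rightarrow> bool" where
  "sparse V \<longleftrightarrow> (\<forall>S\<subseteq>V. S \<noteq> {} \<longrightarrow> 5 * (\<Sum>v\<in>S. deg S v) < 12 * card S)"

definition proper_on :: "'a set \<Rightarrow> ('a \<Rightarrow> 'c set) \<Rightarrow> ('a \<Rightarrow> 'c) \<Rightarrow> bool" where
  "proper_on V L \<phi> \<longleftrightarrow> (\<forall>v\<in>V. \<phi> v \<in> L v) \<and> (\<forall>v\<in>V. \<forall>u\<in>nb V v. \<phi> u \<noteq> \<phi> v)"

text \<open>
  The neighborhoods are taken in \<open>V\<close>, so the 5-cycle is a connected component of the graph.
\<close>

definition pentagon :: "'a set \<Rightarrow> 'a \<Rightarrow> 'a \<Rightarrow> 'a \<Rightarrow> 'a \<Rightarrow> 'a \<Rightarrow> bool" where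
  "pentagon V a b c d e \<longleftrightarrow> {a, b, c, d, e} \<subseteq> V \<and> distinct [a, b, c, d, e] \<and>
     nb V a = {b, e} \<and> nb V b = {a, c} \<and> nb V c = {b, d} \<and> nb V d = {c, e} \<and> nb V e = {d, a}"

text \<open>
  Only 5-cycles with all lists of size four can fail to have a coloring.
\<close>

definition tight :: "'a set \<Rightarrow> ('a \<Rightarrow> 'c set) \<Rightarrow> 'a \<Rightarrow> bool" where
  "tight V L a \<longleftrightarrow>
     (\<exists>b c d e. pentagon V a b c d e \<and> (\<forall>v\<in>{a, b, c, d, e}. card (L v) = 4))"

text \<open>
  A vertex of \<open>R\<close> is exempt from the conflict-free condition, but only on a tight pentagon.
\<close>

definition pcf_coloring :: "'a set \<Rightarrow> ('a \<Rightarrow> 'c set) \<Rightarrow> 'a set \<Rightarrow> ('a \<Rightarrow> 'c) \<Rightarrow> bool" where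
  "pcf_coloring V L R \<phi> \<longleftrightarrow> proper_on V L \<phi> \<and>
     (\<forall>v\<in>V. nb V v \<noteq> {} \<longrightarrow> has_unique (nb V v) \<phi> \<or> v \<in> R \<and> tight V L v)"

definition large_lists :: "'a set \<Rightarrow> ('a \<Rightarrow> 'c set) \<Rightarrow> bool" where
  "large_lists V L \<longleftrightarrow> (\<forall>v\<in>V. finite (L v) \<and> kap V v \<le> card (L v))"

definition anchored :: "'a set \<Rightarrow> ('a \<Rightarrow> 'c set) \<Rightarrow> 'a set \<Rightarrow> bool" where
  "anchored V L R \<longleftrightarrow> (\<forall>a b c d e. pentagon V a b c d e \<longrightarrow>
     (\<forall>v\<in>{a, b, c, d, e}. card (L v) = 4) \<longrightarrow> R \<inter> {a, b, c, d, e} \<noteq> {})"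

lemma E_commute: "E u v \<longleftrightarrow> E v u"
  using E_sym by blast

lemma nb_subset: "nb V v \<subseteq> V"
  by (auto simp: nb_def)

lemma not_in_nb_self: "v \<notin> nb V v"
  by (simp add: nb_def E_irrefl)

lemma nb_swap: "u \<in> nb V v \<Longrightarrow> v \<in> V \<Longrightarrow> v \<in> nb V u"
  using E_sym by (auto simp: nb_def)

lemma nb_mono: "V' \<subseteq> V \<Longrightarrow> nb V' v \<subseteq> nb V v"
  by (auto simp: nb_def)

lemma nb_Diff: "nb (V - X) v = nb V v - X"
  by (auto simp: nb_def)

lemma nb_split: "X \<subseteq> V \<Longrightarrow> nb V v = nb (V - X) v \<union> nb X v"
  by (auto simp: nb_def)

lemma finite_nb: "finite V \<Longrightarrow> finite (nb V v)"
  by (simp add: nb_def)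

lemma deg_mono: "finite V \<Longrightarrow> V' \<subseteq> V \<Longrightarrow> deg V' v \<le> deg V v"
  unfolding deg_def by (intro card_mono finite_nb nb_mono)

lemma kap_mono:
  assumes "finite V" "V' \<subseteq> V"
  shows "kap V' v \<le> kap V v"
proof -
  have "deg V' v \<le> deg V v" by (rule deg_mono) fact+
  then show ?thesis by (auto simp: kap_def)
qed

lemma sparse_mono: "sparse V \<Longrightarrow> V' \<subseteq> V \<Longrightarrow> sparse V'"
  by (auto simp: sparse_def)

lemma pentagon_rotate: "pentagon V a b c d e \<Longrightarrow> pentagon V b c d e a"
  by (auto simp: pentagon_def insert_commute)

lemma pentagon_deg:
  assumes "pentagon V a b c d e" "v \<in> {a, b, c, d, e}"
  shows "deg V v = 2"
  using assms by (auto simp: pentagon_def deg_def)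

lemma deg2_obtain:
  assumes "deg V v = 2"
  obtains p q where "nb V v = {p, q}" "p \<noteq> q"
  using assms by (auto simp: deg_def card_2_iff)

lemma pentagon_at:
  assumes "pentagon V a b c d e" "z \<in> {a, b, c, d, e}"
  obtains p q r s where "pentagon V z p q r s" "{a, b, c, d, e} = {z, p, q, r, s}"
proof -
  note p1 = assms(1)
  note p2 = pentagon_rotate[OF p1]
  note p3 = pentagon_rotate[OF p2]
  note p4 = pentagon_rotate[OF p3]
  note p5 = pentagon_rotate[OF p4]
  consider "z = a" | "z = b" | "z = c" | "z = d" | "z = e" using assms(2) by blast
  then show thesis
  proof cases
    case 1 then show ?thesis using that p1 by blast
  next
    case 2 then show ?thesis using that[of c d e a] p2 by blast
  next
    case 3 then show ?thesis using that[of d e a b] p3 by blast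
  next
    case 4 then show ?thesis using that[of e a b c] p4 by blast
  next
    case 5 then show ?thesis using that[of a b c d] p5 by blast
  qed
qed

lemma pentagon_tight:
  assumes "pentagon V a b c d e" "\<forall>v\<in>{a, b, c, d, e}. card (L v) = 4" "v \<in> {a, b, c, d, e}"
  shows "tight V L v"
  using pentagon_at[OF assms(1,3)] assms(2) unfolding tight_def by metis

lemma nb_component:
  assumes "X \<subseteq> V" "\<forall>v\<in>X. nb V v \<subseteq> X"
    and v: "v \<in> V - X"
  shows "nb (V - X) v = nb V v"
proof -
  have "u \<notin> X" if "u \<in> nb V v" for u
    using assms(2) nb_swap[OF that] v by auto
  then show ?thesis by (auto simp: nb_Diff)
qed

text \<open>
  Greedy coloring of all five vertices with different colors, where only \<open>b\<close> and \<open>e\<close>, the two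
  neighbors of \<open>a\<close>, may have to share a color; a fifth color in the list of \<open>e\<close> avoids even that.
\<close>

lemma pentagon_relaxed_coloring:
  assumes p: "pentagon V a b c d e" and fin: "\<And>v. v \<in> {a, b, c, d, e} \<Longrightarrow> finite (L v) \<and> 4 \<le> card (L v)"
  obtains \<phi> where "\<forall>v\<in>{a, b, c, d, e}. \<phi> v \<in> L v"
    "\<phi> a \<notin> {\<phi> b, \<phi> c, \<phi> d, \<phi> e}" "\<phi> c \<notin> {\<phi> b, \<phi> d, \<phi> e}" "\<phi> d \<notin> {\<phi> b, \<phi> e}"
    "\<phi> b = \<phi> e \<longrightarrow> card (L e) = 4"
proof -
  obtain x1 where x1: "x1 \<in> L a" using ex_avoiding[of "L a" "[]"] fin[of a] by auto
  obtain x3 where x3: "x3 \<in> L c" "x3 \<noteq> x1" using ex_avoiding[of "L c" "[x1]"] fin[of c] by auto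
  obtain x4 where x4: "x4 \<in> L d" "x4 \<noteq> x1" "x4 \<noteq> x3" using ex_avoiding[of "L d" "[x1, x3]"] fin[of d] by auto
  obtain x2 where x2: "x2 \<in> L b" "x2 \<noteq> x1" "x2 \<noteq> x3" "x2 \<noteq> x4"
    using ex_avoiding[of "L b" "[x1, x3, x4]"] fin[of b] by auto
  obtain x5 where x5: "x5 \<in> L e" "x5 \<noteq> x1" "x5 \<noteq> x3" "x5 \<noteq> x4" "x2 = x5 \<longrightarrow> card (L e) = 4"
  proof (cases "card (L e) = 4")
    case True
    then show thesis using ex_avoiding[of "L e" "[x1, x3, x4]"] fin[of e] that by auto
  next
    case False
    then show thesis using ex_avoiding[of "L e" "[x1, x3, x4, x2]"] fin[of e] that by auto
  qed
  define \<phi> where "\<phi> = (\<lambda>v. if v = a then x1 else if v = b then x2 else if v = c then x3 else if v = d then x4 else x5)"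
  have "\<phi> a = x1" "\<phi> b = x2" "\<phi> c = x3" "\<phi> d = x4" "\<phi> e = x5"
    using p by (auto simp: \<phi>_def pentagon_def)
  then show thesis using that[of \<phi>] x1 x2 x3 x4 x5 by auto
qed

text \<open>
  A pentagon is colored on its own: relaxed at a vertex of \<open>R\<close> if it is tight, and with five
  different colors otherwise.
\<close>

lemma split_off_pentagon:
  fixes L :: "'a \<Rightarrow> 'c set"
  assumes large: "large_lists V L" and anch: "anchored V L R" and p: "pentagon V a b c d e"
    and rest: "\<And>(L :: 'a \<Rightarrow> 'c set) R. large_lists (V - {a, b, c, d, e}) L \<Longrightarrow> anchored (V - {a, b, c, d, e}) L R \<Longrightarrow>
      \<exists>\<phi>. pcf_coloring (V - {a, b, c, d, e}) L R \<phi>"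
  shows "\<exists>\<phi>. pcf_coloring V L R \<phi>"
proof -
  have core: "\<exists>\<phi>. pcf_coloring V L R \<phi>"
    if p: "pentagon V a b c d e" and ok: "a \<in> R \<and> (\<forall>v\<in>{a, b, c, d, e}. card (L v) = 4) \<or> card (L e) \<noteq> 4"
      and rest: "\<exists>\<phi>. pcf_coloring (V - {a, b, c, d, e}) L R \<phi>" for a b c d e
  proof -
    let ?X = "{a, b, c, d, e}"
    have XV: "?X \<subseteq> V"
      and nbs: "nb V a = {b, e}" "nb V b = {a, c}" "nb V c = {b, d}" "nb V d = {c, e}" "nb V e = {d, a}"
      using p by (auto simp: pentagon_def)
    have closed: "\<forall>v\<in>?X. nb V v \<subseteq> ?X" using nbs by auto
    note comp = nb_component[OF XV closed]
    have "finite (L v) \<and> 4 \<le> card (L v)" if "v \<in> ?X" for v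
    proof -
      have "v \<in> V" using that XV by blast
      then show ?thesis using large pentagon_deg[OF p that] by (auto simp: large_lists_def kap_def)
    qed
    from pentagon_relaxed_coloring[OF p, of L, OF this] obtain \<psi> where \<psi>: "\<forall>v\<in>?X. \<psi> v \<in> L v"
      "\<psi> a \<notin> {\<psi> b, \<psi> c, \<psi> d, \<psi> e}" "\<psi> c \<notin> {\<psi> b, \<psi> d, \<psi> e}" "\<psi> d \<notin> {\<psi> b, \<psi> e}"
      "\<psi> b = \<psi> e \<longrightarrow> card (L e) = 4" by metis
    obtain \<phi> where \<phi>: "pcf_coloring (V - ?X) L R \<phi>" using rest by blast
    define \<chi> where "\<chi> = (\<lambda>v. if v \<in> ?X then \<psi> v else \<phi> v)"
    have \<chi>X: "\<chi> v = \<psi> v" if "v \<in> ?X" for v using that by (simp add: \<chi>_def)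
    have \<chi>V: "\<chi> v = \<phi> v" if "v \<in> V - ?X" for v using that by (simp add: \<chi>_def)
    have "pcf_coloring V L R \<chi>"
      unfolding pcf_coloring_def proper_on_def
    proof (intro conjI ballI impI)
      fix v assume v: "v \<in> V"
      show "\<chi> v \<in> L v"
        using v \<psi>(1) \<phi> by (cases "v \<in> ?X") (auto simp: \<chi>_def pcf_coloring_def proper_on_def)
      show "\<chi> u \<noteq> \<chi> v" if u: "u \<in> nb V v" for u
      proof (cases "v \<in> ?X")
        case True
        then have "u \<in> ?X" using closed u by blast
        then have "\<chi> u = \<psi> u" "\<chi> v = \<psi> v" using True \<chi>X by blast+
        moreover have "\<psi> u \<noteq> \<psi> v" using True u \<psi>(2-4) by (auto simp: nbs)
        ultimately show ?thesis by simp
      next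
        case False
        then have "v \<in> V - ?X" "u \<in> nb (V - ?X) v" using v u comp by auto
        moreover have "u \<in> V - ?X" using calculation nb_subset by blast
        ultimately show ?thesis using \<phi> \<chi>V by (simp add: pcf_coloring_def proper_on_def)
      qed
      assume ne: "nb V v \<noteq> {}"
      show "has_unique (nb V v) \<chi> \<or> v \<in> R \<and> tight V L v"
      proof (cases "v \<in> ?X")
        case True
        have two: "has_unique {p, q} \<chi>" if "p \<in> ?X" "q \<in> ?X" "\<psi> p \<noteq> \<psi> q" for p q
          using that by (intro has_unique_pair[of p _ q]) (simp_all only: \<chi>X, auto)
        have "v \<noteq> a \<Longrightarrow> has_unique (nb V v) \<chi>"
          using True \<psi>(2-4) by (elim insertE) (simp_all only: nbs, (intro two, auto)+)
        moreover have "has_unique (nb V a) \<chi> \<or> a \<in> R \<and> tight V L a"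
        proof (cases "\<psi> b = \<psi> e")
          case True
          then have "a \<in> R" "\<forall>v\<in>?X. card (L v) = 4" using \<psi>(5) ok by auto
          then show ?thesis using pentagon_tight[OF p, of L a] by simp
        next
          case False
          then show ?thesis using two[of b e] nbs by simp
        qed
        ultimately show ?thesis by blast
      next
        case False
        then have v': "v \<in> V - ?X" using v by blast
        have "nb (V - ?X) v \<noteq> {}" unfolding comp[OF v'] by (rule ne)
        then have "has_unique (nb (V - ?X) v) \<phi> \<or> v \<in> R \<and> tight (V - ?X) L v"
          using \<phi> v' unfolding pcf_coloring_def by blast
        moreover have "has_unique (nb V v) \<chi>" if "has_unique (nb (V - ?X) v) \<phi>"
        proof -
          have "\<chi> u = \<phi> u" if "u \<in> nb V v" for u
            using that \<chi>V nb_subset comp[OF v'] by blast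
          then show ?thesis using that has_unique_cong[of "nb V v" \<chi> \<phi>] comp[OF v'] by simp
        qed
        moreover have "tight V L v" if t: "tight (V - ?X) L v"
        proof -
          obtain b' c' d' e' where q: "pentagon (V - ?X) v b' c' d' e'" "\<forall>v\<in>{v, b', c', d', e'}. card (L v) = 4"
            using t by (auto simp: tight_def)
          then have "{v, b', c', d', e'} \<subseteq> V - ?X" by (simp add: pentagon_def)
          then have "nb (V - ?X) z = nb V z" if "z \<in> {v, b', c', d', e'}" for z using comp that by blast
          then have "pentagon V v b' c' d' e'" using q(1) unfolding pentagon_def by auto
          then show ?thesis using q(2) unfolding tight_def by blast
        qed
        ultimately show ?thesis by blast
      qed
    qed
    then show ?thesis by blast
  qed
  let ?X = "{a, b, c, d, e}"
  have XV: "?X \<subseteq> V" and closed: "\<forall>v\<in>?X. nb V v \<subseteq> ?X" using p by (auto simp: pentagon_def)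
  note comp = nb_component[OF XV closed]
  have "large_lists (V - ?X) L"
    unfolding large_lists_def
  proof
    fix v assume v: "v \<in> V - ?X"
    then have "kap (V - ?X) v = kap V v" using comp by (simp add: kap_def deg_def)
    then show "finite (L v) \<and> kap (V - ?X) v \<le> card (L v)" using large v by (simp add: large_lists_def)
  qed
  moreover have "anchored (V - ?X) L R"
    unfolding anchored_def
  proof (intro allI impI)
    fix a' b' c' d' e'
    assume q: "pentagon (V - ?X) a' b' c' d' e'" "\<forall>v\<in>{a', b', c', d', e'}. card (L v) = 4"
    then have "{a', b', c', d', e'} \<subseteq> V - ?X" by (simp add: pentagon_def)
    then have "nb (V - ?X) z = nb V z" if "z \<in> {a', b', c', d', e'}" for z using comp that by blast
    then have "pentagon V a' b' c' d' e'" using q(1) unfolding pentagon_def by auto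
    then show "R \<inter> {a', b', c', d', e'} \<noteq> {}" using anch q(2) unfolding anchored_def by blast
  qed
  ultimately have rest': "\<exists>\<phi>. pcf_coloring (V - ?X) L R \<phi>" by (rule rest)
  show ?thesis
  proof (cases "\<forall>v\<in>?X. card (L v) = 4")
    case True
    then have "R \<inter> ?X \<noteq> {}" using anch p unfolding anchored_def by blast
    then obtain z where z: "z \<in> ?X" "z \<in> R" by blast
    obtain b' c' d' e' where q: "pentagon V z b' c' d' e'" "?X = {z, b', c', d', e'}"
      using pentagon_at[OF p z(1)] by blast
    have "\<forall>v\<in>{z, b', c', d', e'}. card (L v) = 4" unfolding q(2)[symmetric] by (rule True)
    moreover have "\<exists>\<phi>. pcf_coloring (V - {z, b', c', d', e'}) L R \<phi>"
      unfolding q(2)[symmetric] by (rule rest')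
    ultimately show ?thesis using core[OF q(1)] z(2) by blast
  next
    case False
    then obtain z where z: "z \<in> ?X" "card (L z) \<noteq> 4" by blast
    obtain b' c' d' e' where q: "pentagon V z b' c' d' e'" "?X = {z, b', c', d', e'}"
      using pentagon_at[OF p z(1)] by blast
    have "?X = {b', c', d', e', z}" using q(2) by blast
    then have "\<exists>\<phi>. pcf_coloring (V - {b', c', d', e', z}) L R \<phi>" using rest' by simp
    then show ?thesis using core[OF pentagon_rotate[OF q(1)]] z(2) by blast
  qed
qed

end

section \<open>Extending colorings in a minimal counterexample\<close>

text \<open>
  Pentagons are excluded by \<open>split_off_pentagon\<close>. Hence nothing is relaxed in the coloring
  whose existence is denied, while the induction hypothesis keeps an arbitrary \<open>R\<close>.
\<close>

locale counterexample = adjacency E for E :: "'a \<Rightarrow> 'a \<Rightarrow> bool" +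
  fixes V :: "'a set" and L :: "'a \<Rightarrow> 'c set"
  assumes finite_V: "finite V"
    and sparse_V: "sparse V"
    and large: "large_lists V L"
    and no_pentagon: "\<not> pentagon V a b c d e"
    and smaller: "\<And>V' (L' :: 'a \<Rightarrow> 'c set) R. V' \<subset> V \<Longrightarrow> large_lists V' L' \<Longrightarrow> anchored V' L' R \<Longrightarrow>
      \<exists>\<phi>. pcf_coloring V' L' R \<phi>"
    and uncolorable: "\<not> pcf_coloring V L {} \<phi>"
begin

lemma finite_L: "v \<in> V \<Longrightarrow> finite (L v)"
  using large by (simp add: large_lists_def)

lemma card_L: "v \<in> V \<Longrightarrow> kap V v \<le> card (L v)"
  using large by (simp add: large_lists_def)

lemma card_L2: "v \<in> V \<Longrightarrow> deg V v = 2 \<Longrightarrow> 4 \<le> card (L v)"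
  using card_L[of v] by (simp add: kap_def)

lemma card_L_deg: "v \<in> V \<Longrightarrow> deg V v + 1 \<le> card (L v)"
  using card_L[of v] by (simp add: kap_def split: if_splits)

lemma finite_sub: "X \<subseteq> V \<Longrightarrow> finite X"
  using finite_V finite_subset by blast

text \<open>
  The coloring \<open>g\<close> extends \<open>\<phi>\<close> to \<open>X\<close> and avoids the protected colors \<open>cc\<close>. The outer vertices in \<open>U\<close>
  are not protected; for them, and for those that lost all their neighbors, the conflict-free
  condition is demanded directly.
\<close>

definition completes :: "'a set \<Rightarrow> 'a set \<Rightarrow> ('a \<Rightarrow> 'c) \<Rightarrow> ('a \<Rightarrow> 'c) \<Rightarrow> ('a \<Rightarrow> 'c) \<Rightarrow> bool" where
  "completes U X \<phi> cc g \<longleftrightarrow> (\<forall>v\<in>V - X. g v = \<phi> v) \<and>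
     (\<forall>x\<in>X. g x \<in> L x \<and> (\<forall>y\<in>nb V x. g y \<noteq> g x)) \<and>
     (\<forall>x\<in>X. \<forall>y\<in>nb (V - X) x - U. g x \<noteq> cc y) \<and>
     (\<forall>x\<in>X. nb V x \<noteq> {} \<longrightarrow> has_unique (nb V x) g) \<and>
     (\<forall>y\<in>V - X. nb (V - X) y = {} \<or> y \<in> U \<longrightarrow> nb V y \<noteq> {} \<longrightarrow> has_unique (nb V y) g)"

text \<open>
  The relaxed set consists of the outer vertices with a neighbor in \<open>X\<close>, other than \<open>u\<close>. A pentagon
  of the smaller graph meets it since the pentagon is not a component of the whole graph; for a
  pentagon through \<open>u\<close> this is the hypothesis \<open>pent\<close>. So \<open>u\<close> itself
  is never relaxed: it really sees a unique color, which matters for vertices of degree 3. The list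
  of \<open>u\<close> may be shortened from \<open>L u\<close> to \<open>L' u\<close>, to keep a color away from \<open>u\<close>.
\<close>

lemma no_extension_if_attached:
  assumes X: "X \<subseteq> V" "X \<noteq> {}"
    and L': "\<And>v. v \<noteq> u \<Longrightarrow> L' v = L v" "L' u \<subseteq> L u" "u \<in> V - X \<Longrightarrow> kap (V - X) u \<le> card (L' u)"
    and pent: "\<And>b c d e. pentagon (V - X) u b c d e \<Longrightarrow> \<exists>z\<in>{b, c, d, e}. nb X z \<noteq> {}"
    and complete: "\<And>\<phi> cc. proper_on (V - X) L' \<phi> \<Longrightarrow>
      (u \<in> V - X \<Longrightarrow> nb (V - X) u \<noteq> {} \<Longrightarrow> has_unique (nb (V - X) u) \<phi>) \<Longrightarrow>
      \<exists>g. completes {u} X \<phi> cc g"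
  shows False
proof -
  define R where "R = {z \<in> V - X. nb X z \<noteq> {}} - {u}"
  have sub: "V - X \<subset> V" using X by blast
  have "large_lists (V - X) L'"
    unfolding large_lists_def
  proof
    fix v assume v: "v \<in> V - X"
    have fin: "finite (L' v)" using L'(1)[of v] L'(2) finite_L[of v] v finite_subset by (cases "v = u") auto
    show "finite (L' v) \<and> kap (V - X) v \<le> card (L' v)"
    proof (cases "v = u")
      case True
      then show ?thesis using L'(3) v fin by simp
    next
      case False
      have "kap (V - X) v \<le> kap V v" by (rule kap_mono) (use finite_V in auto)
      then show ?thesis using card_L[of v] v fin L'(1)[OF False] by simp
    qed
  qed
  moreover have "anchored (V - X) L' R"
    unfolding anchored_def
  proof (intro allI impI)
    fix a b c d e assume p: "pentagon (V - X) a b c d e"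
    let ?P = "{a, b, c, d, e}"
    have PV: "?P \<subseteq> V - X" using p by (simp add: pentagon_def)
    have "\<exists>z\<in>?P. nb X z \<noteq> {}"
    proof (rule ccontr)
      assume "\<not> ?thesis"
      then have "nb V z = nb (V - X) z" if "z \<in> ?P" for z using nb_split[OF X(1), of z] that by blast
      then have "pentagon V a b c d e" using p unfolding pentagon_def by auto
      then show False using no_pentagon by blast
    qed
    then obtain z where z: "z \<in> ?P" "nb X z \<noteq> {}" by blast
    have "\<exists>z\<in>?P. z \<noteq> u \<and> nb X z \<noteq> {}"
    proof (cases "z = u")
      case True
      obtain p' q r s where pq: "pentagon (V - X) u p' q r s" "?P = {u, p', q, r, s}"
        using pentagon_at[OF p z(1)] True by blast
      obtain z' where z': "z' \<in> {p', q, r, s}" "nb X z' \<noteq> {}" using pent[OF pq(1)] by blast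
      have "u \<notin> {p', q, r, s}" using pq(1) unfolding pentagon_def by auto
      then have "z' \<noteq> u" using z'(1) by blast
      moreover have "z' \<in> ?P" using z'(1) unfolding pq(2) by blast
      ultimately show ?thesis using z'(2) by blast
    next
      case False
      then show ?thesis using z by blast
    qed
    then show "R \<inter> ?P \<noteq> {}" using PV by (auto simp: R_def)
  qed
  ultimately obtain \<phi> where \<phi>: "pcf_coloring (V - X) L' R \<phi>" using smaller[OF sub] by blast
  have proper: "proper_on (V - X) L' \<phi>" using \<phi> by (simp add: pcf_coloring_def)
  have uniq: "has_unique (nb (V - X) v) \<phi> \<or> v \<in> R \<and> tight (V - X) L' v" if "v \<in> V - X" "nb (V - X) v \<noteq> {}" for v
    using \<phi> that unfolding pcf_coloring_def by blast
  define w where "w = (\<lambda>y. if has_unique (nb (V - X) y) \<phi>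
    then SOME i. i \<in> nb (V - X) y \<and> (\<forall>j\<in>nb (V - X) y. \<phi> j = \<phi> i \<longrightarrow> j = i) else SOME i. i \<in> nb (V - X) y)"
  have w1: "w y \<in> nb (V - X) y \<and> (\<forall>j\<in>nb (V - X) y. \<phi> j = \<phi> (w y) \<longrightarrow> j = w y)"
    if "has_unique (nb (V - X) y) \<phi>" for y
    using that someI_ex[of "\<lambda>i. i \<in> nb (V - X) y \<and> (\<forall>j\<in>nb (V - X) y. \<phi> j = \<phi> i \<longrightarrow> j = i)"]
    by (simp add: w_def has_unique_def Bex_def)
  have w2: "w y \<in> nb (V - X) y" if "nb (V - X) y \<noteq> {}" for y
  proof (cases "has_unique (nb (V - X) y) \<phi>")
    case True
    then show ?thesis using w1 by blast
  next
    case False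
    have "(SOME i. i \<in> nb (V - X) y) \<in> nb (V - X) y" unfolding some_in_eq by (rule that)
    then show ?thesis using False by (simp add: w_def)
  qed
  have "u \<in> V - X \<Longrightarrow> nb (V - X) u \<noteq> {} \<Longrightarrow> has_unique (nb (V - X) u) \<phi>"
    using uniq by (auto simp: R_def)
  from complete[OF proper this, of "\<lambda>y. \<phi> (w y)"]
  obtain g where g: "completes {u} X \<phi> (\<lambda>y. \<phi> (w y)) g" by blast
  note g = g[unfolded completes_def]
  have g1: "\<forall>v\<in>V - X. g v = \<phi> v" using g by (elim conjE)
  have g2: "\<forall>x\<in>X. g x \<in> L x \<and> (\<forall>y\<in>nb V x. g y \<noteq> g x)" using g by (elim conjE)
  have g3: "\<forall>x\<in>X. \<forall>y\<in>nb (V - X) x - {u}. g x \<noteq> \<phi> (w y)" using g by (elim conjE)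
  have g4: "\<forall>x\<in>X. nb V x \<noteq> {} \<longrightarrow> has_unique (nb V x) g" using g by (elim conjE)
  have g5: "\<forall>y\<in>V - X. nb (V - X) y = {} \<or> y \<in> {u} \<longrightarrow> nb V y \<noteq> {} \<longrightarrow> has_unique (nb V y) g"
    using g by (elim conjE)
  have protect: "has_unique (nb V y) g" if y: "y \<in> V - X" "y \<noteq> u" "nb (V - X) y \<noteq> {}" for y
  proof -
    have new: "g x \<noteq> \<phi> (w y)" if "x \<in> nb X y" for x
    proof -
      have "x \<in> X" "y \<in> nb (V - X) x" using that y(1) by (auto simp: nb_def E_commute)
      then show ?thesis using g3 y(2) by blast
    qed
    have old: "g x = \<phi> x" if "x \<in> nb (V - X) y" for x
      using g1 that nb_subset by blast
    show ?thesis
    proof (cases "has_unique (nb (V - X) y) \<phi>")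
      case True
      have "j = w y" if j: "j \<in> nb V y" "g j = g (w y)" for j
      proof -
        have wy: "g (w y) = \<phi> (w y)" using old w2[OF y(3)] by blast
        then have "j \<notin> nb X y" using new j(2) by auto
        then have "j \<in> nb (V - X) y" using j(1) nb_split[OF X(1), of y] by blast
        then show ?thesis using old[of j] wy j(2) w1[OF True] by simp
      qed
      moreover have "w y \<in> nb V y" using w2[OF y(3)] nb_split[OF X(1), of y] by blast
      ultimately show ?thesis unfolding has_unique_def by blast
    next
      case False
      \<comment> \<open>The protected color of a relaxed vertex is the common color of its two neighbors on the
        pentagon; the vertex has degree 3, so its only neighbor in \<open>X\<close> gets a unique color.\<close>
      then have R: "y \<in> R" "tight (V - X) L' y" using uniq y by blast+
      obtain b c d e where p: "pentagon (V - X) y b c d e" "\<forall>v\<in>{y, b, c, d, e}. card (L' v) = 4"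
        using R(2) by (auto simp: tight_def)
      have nby: "nb (V - X) y = {b, e}" "b \<noteq> e" using p(1) by (auto simp: pentagon_def)
      have same: "\<phi> b = \<phi> e" using False nby has_unique_pair[of b "{b, e}" e \<phi>] by auto
      have wy: "\<phi> (w y) = \<phi> b" using w2[OF y(3)] nby same by auto
      have "card (L y) = 4" using p(2) L'(1)[OF y(2)] by simp
      then have "deg V y \<le> 3" using card_L_deg[of y] y(1) by simp
      moreover have "deg V y = card (nb (V - X) y) + card (nb X y)"
        unfolding deg_def nb_split[OF X(1), of y]
        using finite_nb[OF finite_sub[OF X(1)]] finite_nb[of "V - X"] finite_V
        by (intro card_Un_disjoint) (auto simp: nb_def)
      ultimately have "card (nb X y) \<le> 1" using nby by simp
      moreover have "nb X y \<noteq> {}" "finite (nb X y)" using R(1) finite_sub[OF X(1)] finite_nb by (auto simp: R_def)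
      ultimately have "card (nb X y) = 1" by (simp add: Suc_leI card_gt_0_iff le_antisym)
      then obtain x where x: "nb X y = {x}" by (metis card_1_singletonE)
      have nbV: "nb V y = {x, b, e}" using nb_split[OF X(1), of y] x nby by blast
      have "g x \<noteq> g b" "g x \<noteq> g e" using new[of x] x wy same old[of b] old[of e] nby by auto
      then show ?thesis unfolding has_unique_def nbV by auto
    qed
  qed
  have "pcf_coloring V L {} g"
    unfolding pcf_coloring_def proper_on_def
  proof (intro conjI ballI impI)
    fix v assume v: "v \<in> V"
    show "g v \<in> L v"
    proof (cases "v \<in> X")
      case True
      then show ?thesis using g2 by blast
    next
      case False
      then have "g v \<in> L' v" using g1 proper v by (simp add: proper_on_def)
      then show ?thesis using L'(1)[of v] L'(2) by (cases "v = u") auto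
    qed
    show "g u' \<noteq> g v" if u': "u' \<in> nb V v" for u'
    proof (cases "v \<in> X \<or> u' \<in> X")
      case True
      then show ?thesis using g2 u' nb_swap[OF u' v] by metis
    next
      case False
      then have "u' \<in> nb (V - X) v" "v \<in> V - X" "u' \<in> V - X" using u' v by (auto simp: nb_def)
      then show ?thesis using proper g1 by (simp add: proper_on_def)
    qed
    show "has_unique (nb V v) g \<or> v \<in> {} \<and> tight V L v" if ne: "nb V v \<noteq> {}"
    proof (cases "v \<in> X \<or> v = u \<or> nb (V - X) v = {}")
      case True
      then show ?thesis using g4 g5 v ne by blast
    next
      case False
      then show ?thesis using protect[of v] v by blast
    qed
  qed
  then show False using uncolorable by blast
qed

text \<open>
  With a distinguished vertex inside \<open>X\<close>, all outer vertices are protected.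
\<close>

lemma no_generic_extension:
  assumes X: "X \<subseteq> V" "X \<noteq> {}"
    and complete: "\<And>\<phi> cc. proper_on (V - X) L \<phi> \<Longrightarrow> \<exists>g. completes {} X \<phi> cc g"
  shows False
proof -
  obtain u where u: "u \<in> X" using X by blast
  show False
  proof (rule no_extension_if_attached[OF X, of u L])
    show "\<exists>z\<in>{b, c, d, e}. nb X z \<noteq> {}" if "pentagon (V - X) u b c d e" for b c d e
      using that u by (simp add: pentagon_def)
    fix \<phi> cc
    assume "proper_on (V - X) L \<phi>"
    then obtain g where g: "completes {} X \<phi> cc g" using complete by blast
    have "completes {u} X \<phi> cc g" using g u unfolding completes_def by blast
    then show "\<exists>g. completes {u} X \<phi> cc g" by blast
  qed (use u in auto)
qed

end

section \<open>Excluded leaves, short cycles and paths\<close>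

context counterexample
begin

lemma completesI:
  assumes "\<And>v. v \<in> V - X \<Longrightarrow> g v = \<phi> v"
    and "\<And>x. x \<in> X \<Longrightarrow> g x \<in> L x"
    and "\<And>x y. x \<in> X \<Longrightarrow> y \<in> nb V x \<Longrightarrow> g y \<noteq> g x"
    and "\<And>x y. x \<in> X \<Longrightarrow> y \<in> nb V x \<Longrightarrow> y \<notin> X \<Longrightarrow> y \<notin> U \<Longrightarrow> g x \<noteq> cc y"
    and "\<And>x. x \<in> X \<Longrightarrow> has_unique (nb V x) g"
    and "\<And>y. y \<in> V - X \<Longrightarrow> nb V y \<subseteq> X \<Longrightarrow> nb V y \<noteq> {} \<Longrightarrow> y \<notin> U \<Longrightarrow> has_unique (nb V y) g"
    and "\<And>y. y \<in> V - X \<Longrightarrow> y \<in> U \<Longrightarrow> has_unique (nb V y) g"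
  shows "completes U X \<phi> cc g"
  unfolding completes_def nb_Diff using assms by blast

lemma nb_sym: "u \<in> V \<Longrightarrow> v \<in> V \<Longrightarrow> u \<in> nb V v \<longleftrightarrow> v \<in> nb V u"
  by (auto simp: nb_def E_commute)

lemma nb_in_V: "u \<in> nb V v \<Longrightarrow> u \<in> V"
  by (simp add: nb_def)

lemma deg_nb2: "nb V v = {p, q} \<Longrightarrow> p \<noteq> q \<Longrightarrow> deg V v = 2"
  by (simp add: deg_def)

lemma no_isolated:
  assumes v: "v \<in> V"
  shows "nb V v \<noteq> {}"
proof
  assume nbv: "nb V v = {}"
  show False
  proof (rule no_generic_extension[of "{v}"])
    fix \<phi> cc :: "'a \<Rightarrow> 'c"
    obtain a where "a \<in> L v" using card_L_deg[OF v] by fastforce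
    then have "\<forall>x\<in>{v}. (\<phi>(v := a)) x \<in> L x" by simp
    moreover have "nb V y \<subseteq> {v} \<Longrightarrow> nb V y = {}" if "y \<in> V" for y
      using nb_sym[OF that v] nbv by blast
    ultimately have "completes {} {v} \<phi> cc (\<phi>(v := a))"
      unfolding completes_def nb_Diff using nbv by auto
    then show "\<exists>g. completes {} {v} \<phi> cc g" by blast
  qed (use v in auto)
qed

lemma no_triangle:
  assumes V: "w \<in> V" "x \<in> V" "x' \<in> V" and nbs: "nb V x = {w, x'}" "nb V x' = {w, x}" and ne: "w \<noteq> x" "w \<noteq> x'" "x \<noteq> x'"
  shows False
proof (rule no_generic_extension[of "{x, x'}"])
  fix \<phi> cc :: "'a \<Rightarrow> 'c"
  have c: "4 \<le> card (L x)" "4 \<le> card (L x')" using nbs ne V by (auto intro!: card_L2 deg_nb2)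
  obtain a where a: "a \<in> L x" "a \<noteq> \<phi> w" "a \<noteq> cc w"
    using ex_avoiding[of "L x" "[\<phi> w, cc w]"] c finite_L V by auto
  obtain a' where a': "a' \<in> L x'" "a' \<noteq> \<phi> w" "a' \<noteq> cc w" "a' \<noteq> a"
    using ex_avoiding[of "L x'" "[\<phi> w, cc w, a]"] c finite_L V by auto
  define g where "g = \<phi>(x := a, x' := a')"
  have g: "g x = a" "g x' = a'" "g w = \<phi> w" "\<And>v. v \<notin> {x, x'} \<Longrightarrow> g v = \<phi> v"
    using ne by (auto simp: g_def)
  have two: "has_unique {p, q} g" if "g p \<noteq> g q" for p q using that by (intro has_unique_pair[of p _ q]) auto
  have "completes {} {x, x'} \<phi> cc g"
  proof (rule completesI)
    fix y assume y: "y \<in> V - {x, x'}" "nb V y \<subseteq> {x, x'}" "nb V y \<noteq> {}"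
    then have "y = w" using nb_sym[of y x] nb_sym[of y x'] V nbs by auto
    then have "nb V y = {x, x'}" using y(2) nb_sym[of w x] nb_sym[of w x'] V nbs by auto
    then show "has_unique (nb V y) g" using two[of x x'] g a' by simp
  next
    show "has_unique (nb V v) g" if "v \<in> {x, x'}" for v
      using that two[of w x'] two[of w x] nbs g a a' by auto
  qed (use g a a' nbs ne in auto)
  then show "\<exists>g. completes {} {x, x'} \<phi> cc g" by blast
qed (use V in auto)

lemma no_square:
  assumes V: "{w, x, y, z} \<subseteq> V" and nbs: "nb V x = {w, y}" "nb V y = {x, z}" "nb V z = {y, w}"
    and ne: "distinct [w, x, y, z]"
  shows False
proof (rule no_generic_extension[of "{x, y, z}"])
  fix \<phi> cc :: "'a \<Rightarrow> 'c"
  have c: "4 \<le> card (L x)" "4 \<le> card (L y)" "4 \<le> card (L z)" using nbs ne V by (auto intro!: card_L2 deg_nb2)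
  obtain a where a: "a \<in> L x" "a \<noteq> \<phi> w" "a \<noteq> cc w"
    using ex_avoiding[of "L x" "[\<phi> w, cc w]"] c finite_L V by auto
  obtain a' where a': "a' \<in> L z" "a' \<noteq> \<phi> w" "a' \<noteq> cc w" "a' \<noteq> a"
    using ex_avoiding[of "L z" "[\<phi> w, cc w, a]"] c finite_L V by auto
  obtain b where b: "b \<in> L y" "b \<noteq> \<phi> w" "b \<noteq> a" "b \<noteq> a'"
    using ex_avoiding[of "L y" "[\<phi> w, a, a']"] c finite_L V by auto
  define g where "g = \<phi>(x := a, z := a', y := b)"
  have g: "g x = a" "g z = a'" "g y = b" "g w = \<phi> w" "\<And>v. v \<notin> {x, y, z} \<Longrightarrow> g v = \<phi> v"
    using ne by (auto simp: g_def)
  have two: "has_unique {p, q} g" if "g p \<noteq> g q" for p q using that by (intro has_unique_pair[of p _ q]) auto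
  have "completes {} {x, y, z} \<phi> cc g"
  proof (rule completesI)
    fix v assume v: "v \<in> V - {x, y, z}" "nb V v \<subseteq> {x, y, z}" "nb V v \<noteq> {}"
    then have "v = w" using nb_sym[of v x] nb_sym[of v y] nb_sym[of v z] V nbs by auto
    then have "nb V v = {x, z}" using v(2) nb_sym[of w x] nb_sym[of w y] nb_sym[of w z] V nbs ne by auto
    then show "has_unique (nb V v) g" using two[of x z] g a' by simp
  next
    show "has_unique (nb V v) g" if "v \<in> {x, y, z}" for v
      using that two[of w y] two[of x z] two[of y w] nbs g a a' b by auto
  qed (use g a a' b nbs ne in auto)
  then show "\<exists>g. completes {} {x, y, z} \<phi> cc g" by blast
qed (use V in auto)

text \<open>
  Delete the four vertices of degree 2. The lists that remain have the sizes 2, 3, 3, 2 and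
  all pairs except the two ends of the path have to differ. The two outer neighbors \<open>u\<close> and \<open>w\<close> may
  coincide; a vertex that has both ends of the path as its only neighbors would close
  a pentagon.
\<close>

lemma no_path4:
  assumes V: "{a, b, c, d, u, w} \<subseteq> V"
    and nbs: "nb V a = {u, b}" "nb V b = {a, c}" "nb V c = {b, d}" "nb V d = {c, w}"
    and ne: "distinct [a, b, c, d]" "u \<noteq> b" "w \<noteq> c"
  shows False
proof -
  have u: "u \<notin> {a, b, c, d}"
  proof -
    have "u \<noteq> a" using nbs not_in_nb_self[of a V] by auto
    moreover have "u \<noteq> c" using nb_sym[of a c] V nbs ne by auto
    moreover have "u \<noteq> d"
    proof
      assume "u = d"
      then have "w = a" using nb_sym[of a d] V nbs ne by auto
      then show False using no_square[of d a b c] \<open>u = d\<close> V nbs ne by auto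
    qed
    ultimately show ?thesis using ne by blast
  qed
  have w: "w \<notin> {a, b, c, d}"
  proof -
    have "w \<noteq> d" using nbs not_in_nb_self[of d V] by auto
    moreover have "w \<noteq> b" using nb_sym[of b d] V nbs ne by auto
    moreover have "w \<noteq> a" using nb_sym[of a d] V nbs ne u by auto
    ultimately show ?thesis using ne by blast
  qed
  let ?X = "{a, b, c, d}"
  show False
  proof (rule no_generic_extension[of ?X])
    fix \<phi> cc :: "'a \<Rightarrow> 'c"
    have cards: "4 \<le> card (L a)" "4 \<le> card (L b)" "4 \<le> card (L c)" "4 \<le> card (L d)"
      using card_L2[OF _ deg_nb2[OF nbs(1)]] card_L2[OF _ deg_nb2[OF nbs(2)]]
        card_L2[OF _ deg_nb2[OF nbs(3)]] card_L2[OF _ deg_nb2[OF nbs(4)]] ne u w V by auto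
    have fin: "finite (L a)" "finite (L b)" "finite (L c)" "finite (L d)" using V finite_L by auto
    let ?A1 = "L a - set [\<phi> u, cc u]" and ?A2 = "L b - set [\<phi> u]"
      and ?A3 = "L c - set [\<phi> w]" and ?A4 = "L d - set [\<phi> w, cc w]"
    have "\<exists>a1\<in>?A1. \<exists>a2\<in>?A2. \<exists>a3\<in>?A3. \<exists>a4\<in>?A4.
        a1 \<noteq> a2 \<and> a1 \<noteq> a3 \<and> a2 \<noteq> a3 \<and> a2 \<noteq> a4 \<and> a3 \<noteq> a4"
    proof (rule list_color_K4_minus_edge)
      show "2 \<le> card ?A1" "3 \<le> card ?A2" "3 \<le> card ?A3" "2 \<le> card ?A4"
        by (rule card_diff_set_ge; use fin cards in simp)+
    qed (use fin in auto)
    then obtain a1 a2 a3 a4 where A: "a1 \<in> ?A1" "a2 \<in> ?A2" "a3 \<in> ?A3" "a4 \<in> ?A4"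
      "a1 \<noteq> a2" "a1 \<noteq> a3" "a2 \<noteq> a3" "a2 \<noteq> a4" "a3 \<noteq> a4" by blast
    define g where "g = \<phi>(a := a1, b := a2, c := a3, d := a4)"
    have g: "g a = a1" "g b = a2" "g c = a3" "g d = a4" "g u = \<phi> u" "g w = \<phi> w" "\<And>v. v \<notin> ?X \<Longrightarrow> g v = \<phi> v"
      using ne u w by (auto simp: g_def)
    have two: "has_unique {p, q} g" if "g p \<noteq> g q" for p q using that by (intro has_unique_pair[of p _ q]) auto
    have nb_out: "nb V v \<inter> ?X \<subseteq> (if v = u then {a} else {}) \<union> (if v = w then {d} else {})" if "v \<in> V - ?X" for v
      using nb_sym[of v a] nb_sym[of v b] nb_sym[of v c] nb_sym[of v d] that V nbs by auto
    have "completes {} ?X \<phi> cc g"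
    proof (rule completesI)
      fix v assume v: "v \<in> V - ?X" "nb V v \<subseteq> ?X" "nb V v \<noteq> {}"
      have "\<not> (a \<in> nb V v \<and> d \<in> nb V v)"
      proof
        assume ad: "a \<in> nb V v \<and> d \<in> nb V v"
        then have vw: "v = u" "v = w" using nb_out[OF v(1)] ne by (auto split: if_splits)
        then have "nb V v = {d, a}" using ad nb_out[OF v(1)] v(2) by auto
        then have "pentagon V a b c d v" using V nbs ne u vw by (auto simp: pentagon_def)
        then show False using no_pentagon by blast
      qed
      then have "nb V v = {a} \<or> nb V v = {d}" using nb_out[OF v(1)] v(2,3) by (auto split: if_splits)
      then show "has_unique (nb V v) g" using has_unique_singleton by metis
  next
      show "has_unique (nb V v) g" if "v \<in> ?X" for v
        using that two[of u b] two[of a c] two[of b d] two[of c w] nbs g A by auto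
    qed (use g A nbs ne u w in auto)
    then show "\<exists>g. completes {} ?X \<phi> cc g" by blast
  qed (use V in auto)
qed

text \<open>
  If \<open>u\<close> were the only vertex of the pentagon with a neighbor in \<open>X\<close>, the other four would form a
  path of four vertices of degree 2.
\<close>

lemma pentagon_attached_elsewhere:
  assumes X: "X \<subseteq> V" and p: "pentagon (V - X) u b c d e"
  shows "\<exists>z\<in>{b, c, d, e}. nb X z \<noteq> {}"
proof (rule ccontr)
  assume "\<not> ?thesis"
  then have "nb V z = nb (V - X) z" if "z \<in> {b, c, d, e}" for z using nb_split[OF X, of z] that by blast
  then have "nb V b = {u, c}" "nb V c = {b, d}" "nb V d = {c, e}" "nb V e = {d, u}"
    using p by (auto simp: pentagon_def)
  then show False
    by (rule no_path4[rotated]) (use p in \<open>auto simp: pentagon_def\<close>)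
qed

lemma no_extension:
  assumes X: "X \<subseteq> V" "X \<noteq> {}"
    and L': "\<And>v. v \<noteq> u \<Longrightarrow> L' v = L v" "L' u \<subseteq> L u" "u \<in> V - X \<Longrightarrow> kap (V - X) u \<le> card (L' u)"
    and complete: "\<And>\<phi> cc. proper_on (V - X) L' \<phi> \<Longrightarrow>
      (u \<in> V - X \<Longrightarrow> nb (V - X) u \<noteq> {} \<Longrightarrow> has_unique (nb (V - X) u) \<phi>) \<Longrightarrow>
      \<exists>g. completes {u} X \<phi> cc g"
  shows False
  by (rule no_extension_if_attached[OF X, of u L']) (fact L' complete pentagon_attached_elsewhere[OF X(1)])+

lemma deg2_other:
  assumes "deg V w = 2" "v \<in> nb V w"
  obtains u where "nb V w = {v, u}" "u \<noteq> v"
proof -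
  obtain p q where pq: "nb V w = {p, q}" "p \<noteq> q" using deg2_obtain[OF assms(1)] .
  then have "v = p \<or> v = q" using assms(2) by simp
  then show thesis using that[of q] that[of p] pq by (auto simp: insert_commute)
qed

lemma deg3_obtain:
  assumes "deg V u = 3" "v \<in> nb V u"
  obtains p q where "nb V u = {p, q, v}" "distinct [p, q, v]"
proof -
  have "card (nb V u - {v}) = 2" using assms finite_nb[OF finite_V] by (simp add: deg_def)
  then obtain p q where "nb V u - {v} = {p, q}" "p \<noteq> q" by (auto simp: card_2_iff)
  then show thesis using that[of p q] assms(2) by auto
qed

text \<open>
  Delete \<open>v1\<close> and \<open>v2\<close>. The two remaining neighbors of \<open>u\<close> have different colors, so \<open>u\<close> is
  satisfied whatever \<open>v1\<close> gets. As no color has to be protected at \<open>u\<close>, three colors are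
  forbidden for each of \<open>v1\<close> and \<open>v2\<close>.
\<close>

lemma no_thread_at_deg3:
  assumes V: "{u, v1, v2, w} \<subseteq> V" and u: "deg V u = 3" and nbs: "nb V v1 = {u, v2}" "nb V v2 = {v1, w}"
    and ne: "u \<noteq> v2" "w \<noteq> v1" "v1 \<noteq> v2"
  shows False
proof -
  have uw: "u \<noteq> w" using no_triangle[of u v1 v2] V nbs ne not_in_nb_self[of v1 V] by auto
  have uv: "u \<noteq> v1" "w \<noteq> v2" using nbs not_in_nb_self[of v1 V] not_in_nb_self[of v2 V] by auto
  have "v1 \<in> nb V u" using nb_sym[of u v1] V nbs by auto
  then obtain p q where nbu: "nb V u = {p, q, v1}" and pq: "distinct [p, q, v1]" using deg3_obtain[OF u] by blast
  have pqV: "p \<in> V" "q \<in> V" using nbu nb_in_V by blast+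
  have "v2 \<notin> nb V u" using nb_sym[of u v2] V nbs uw uv ne by auto
  then have pq2: "p \<noteq> v2" "q \<noteq> v2" using nbu by auto
  let ?X = "{v1, v2}"
  show False
  proof (rule no_extension[of ?X u L])
    show "kap (V - ?X) u \<le> card (L u)" using kap_mono[OF finite_V, of "V - ?X" u] card_L[of u] V by auto
    fix \<phi> cc :: "'a \<Rightarrow> 'c"
    assume "u \<in> V - ?X \<Longrightarrow> nb (V - ?X) u \<noteq> {} \<Longrightarrow> has_unique (nb (V - ?X) u) \<phi>"
    moreover have "nb (V - ?X) u = {p, q}" using nbu pq pq2 by (auto simp: nb_Diff)
    ultimately have "has_unique {p, q} \<phi>" using V uv ne by auto
    then have pq\<phi>: "\<phi> p \<noteq> \<phi> q" using has_unique_doubleD[of p q \<phi>] pq by simp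
    have cards: "4 \<le> card (L v1)" "4 \<le> card (L v2)"
      using card_L2[OF _ deg_nb2[OF nbs(1)]] card_L2[OF _ deg_nb2[OF nbs(2)]] ne V by auto
    obtain a2 where a2: "a2 \<in> L v2" "a2 \<noteq> \<phi> w" "a2 \<noteq> cc w" "a2 \<noteq> \<phi> u"
      using ex_avoiding[of "L v2" "[\<phi> w, cc w, \<phi> u]"] cards finite_L V by auto
    obtain a1 where a1: "a1 \<in> L v1" "a1 \<noteq> \<phi> w" "a1 \<noteq> a2" "a1 \<noteq> \<phi> u"
      using ex_avoiding[of "L v1" "[\<phi> w, a2, \<phi> u]"] cards finite_L V by auto
    define g where "g = \<phi>(v1 := a1, v2 := a2)"
    have g: "g v1 = a1" "g v2 = a2" "g u = \<phi> u" "g w = \<phi> w" "\<And>v. v \<notin> ?X \<Longrightarrow> g v = \<phi> v"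
      using ne uv by (auto simp: g_def)
    have two: "has_unique {p, q} g" if "g p \<noteq> g q" for p q using that by (intro has_unique_pair[of p _ q]) auto
    have CFu: "has_unique (nb V u) g"
      by (rule has_unique_triple[OF nbu]) (use pq pq\<phi> g(5)[of p] g(5)[of q] pq2 in auto)
    have CFv: "has_unique (nb V v) g" if v: "v \<in> V - ?X" "nb V v \<subseteq> ?X" "nb V v \<noteq> {}" "v \<noteq> u" for v
    proof -
      have "v1 \<notin> nb V v" using nb_sym[of v v1] V v nbs by auto
      then have "nb V v = {v2}" using v by auto
      then show ?thesis using has_unique_singleton by metis
    qed
    have "completes {u} ?X \<phi> cc g"
    proof (rule completesI)
      show "has_unique (nb V x) g" if "x \<in> ?X" for x
        using that two[of u v2] two[of v1 w] nbs g a1 a2 by auto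
      show "has_unique (nb V y) g" if "y \<in> V - ?X" "nb V y \<subseteq> ?X" "nb V y \<noteq> {}" "y \<notin> {u}" for y
        using CFv that by blast
      show "has_unique (nb V y) g" if "y \<in> V - ?X" "y \<in> {u}" for y
        using CFu that by blast
    qed (use g a1 a2 nbs ne uv uw in auto)
    then show "\<exists>g. completes {u} ?X \<phi> cc g" by blast
  qed (use V in auto)
qed

text \<open>
  If the neighbor \<open>w\<close> has degree at most 2, it is deleted with the leaf and has enough colors
  to be colored after the leaf. If it has degree 3, its other two neighbors have different
  colors and the leaf only has to avoid the color of \<open>w\<close>.
\<close>

lemma leaf_nb_deg:
  assumes v: "v \<in> V" "nb V v = {w}"
  shows "4 \<le> deg V w"
proof (rule ccontr)
  assume small: "\<not> 4 \<le> deg V w"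
  have w: "w \<in> V" using v(2) nb_in_V by blast
  have vw: "v \<in> nb V w" "v \<noteq> w" using nb_sym[of v w] v w not_in_nb_self[of v V] by auto
  have "deg V w \<noteq> 0" using vw finite_nb[OF finite_V] by (auto simp: deg_def)
  have cv: "2 \<le> card (L v)" using card_L_deg[of v] v by (simp add: deg_def)
  note fin = finite_L[OF v(1)] finite_L[OF w]
  from small \<open>deg V w \<noteq> 0\<close> consider "deg V w = 1" | "deg V w = 2" | "deg V w = 3" by linarith
  then show False
  proof cases
    case 1
    then have nbw: "nb V w = {v}" using vw by (auto simp: deg_def card_1_singleton_iff)
    have cw: "2 \<le> card (L w)" using card_L_deg[OF w] 1 by simp
    show False
    proof (rule no_generic_extension[of "{v, w}"])
      fix \<phi> cc :: "'a \<Rightarrow> 'c"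
      obtain a where a: "a \<in> L v" using ex_avoiding[of "L v" "[]"] cv fin by auto
      obtain b where b: "b \<in> L w" "b \<noteq> a" using ex_avoiding[of "L w" "[a]"] cw fin by auto
      define g where "g = \<phi>(v := a, w := b)"
      have g: "g v = a" "g w = b" "\<And>z. z \<notin> {v, w} \<Longrightarrow> g z = \<phi> z" using vw by (auto simp: g_def)
      have "completes {} {v, w} \<phi> cc g"
      proof (rule completesI)
        fix y assume y: "y \<in> V - {v, w}" "nb V y \<subseteq> {v, w}" "nb V y \<noteq> {}"
        then show "has_unique (nb V y) g" using nb_sym[of y v] nb_sym[of y w] v w nbw by auto
      qed (use g a b v nbw vw in \<open>auto intro!: has_unique_singleton\<close>)
      then show "\<exists>g. completes {} {v, w} \<phi> cc g" by blast
    qed (use v w in auto)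
  next
    case 2
    then obtain u where nbw: "nb V w = {v, u}" "u \<noteq> v" using deg2_other vw(1) by blast
    have u: "u \<in> V" "u \<noteq> w" using nbw nb_in_V not_in_nb_self[of w V] by auto
    have cw: "4 \<le> card (L w)" using card_L2[OF w 2] .
    show False
    proof (rule no_generic_extension[of "{v, w}"])
      fix \<phi> cc :: "'a \<Rightarrow> 'c"
      obtain a where a: "a \<in> L v" "a \<noteq> \<phi> u" using ex_avoiding[of "L v" "[\<phi> u]"] cv fin by auto
      obtain b where b: "b \<in> L w" "b \<noteq> a" "b \<noteq> \<phi> u" "b \<noteq> cc u"
        using ex_avoiding[of "L w" "[a, \<phi> u, cc u]"] cw fin by auto
      define g where "g = \<phi>(v := a, w := b)"
      have g: "g v = a" "g w = b" "g u = \<phi> u" "\<And>z. z \<notin> {v, w} \<Longrightarrow> g z = \<phi> z" using vw nbw u by (auto simp: g_def)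
      have two: "has_unique {p, q} g" if "g p \<noteq> g q" for p q using that by (intro has_unique_pair[of p _ q]) auto
      have "completes {} {v, w} \<phi> cc g"
      proof (rule completesI)
        fix y assume y: "y \<in> V - {v, w}" "nb V y \<subseteq> {v, w}" "nb V y \<noteq> {}"
        then have "nb V y = {w}" using nb_sym[of y v] v by auto
        then show "has_unique (nb V y) g" using has_unique_singleton by metis
      qed (use g a b v nbw vw u in \<open>auto intro!: has_unique_singleton two\<close>)
      then show "\<exists>g. completes {} {v, w} \<phi> cc g" by blast
    qed (use v w in auto)
  next
    case 3
    then obtain p q where nbw: "nb V w = {p, q, v}" and pq: "distinct [p, q, v]" using deg3_obtain vw by blast
    show False
    proof (rule no_extension[of "{v}" w L])
      show "kap (V - {v}) w \<le> card (L w)" using kap_mono[OF finite_V, of "V - {v}" w] card_L[of w] w by auto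
      fix \<phi> cc :: "'a \<Rightarrow> 'c"
      assume "w \<in> V - {v} \<Longrightarrow> nb (V - {v}) w \<noteq> {} \<Longrightarrow> has_unique (nb (V - {v}) w) \<phi>"
      moreover have "nb (V - {v}) w = {p, q}" using nbw pq by (auto simp: nb_Diff)
      ultimately have "has_unique {p, q} \<phi>" using w vw by auto
      then have pq\<phi>: "\<phi> p \<noteq> \<phi> q" using has_unique_doubleD[of p q \<phi>] pq by simp
      obtain a where a: "a \<in> L v" "a \<noteq> \<phi> w" using ex_avoiding[of "L v" "[\<phi> w]"] cv fin by auto
      define g where "g = \<phi>(v := a)"
      have g: "g v = a" "g w = \<phi> w" "\<And>z. z \<noteq> v \<Longrightarrow> g z = \<phi> z" using vw by (auto simp: g_def)
      have "has_unique (nb V w) g"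
        by (rule has_unique_triple[OF nbw]) (use pq pq\<phi> g in auto)
      moreover have "has_unique (nb V y) g" if "y \<in> V - {v}" "nb V y \<subseteq> {v}" "nb V y \<noteq> {}" "y \<noteq> w" for y
        using that nb_sym[of y v] v by auto
      ultimately have "completes {w} {v} \<phi> cc g"
        by (intro completesI) (use g a v in \<open>auto intro!: has_unique_singleton\<close>)
      then show "\<exists>g. completes {w} {v} \<phi> cc g" by blast
    qed (use v in auto)
  qed
qed

end

section \<open>Deleting a vertex together with the threads around it\<close>

text \<open>
  The successor of \<open>x\<close> on a thread that reaches \<open>x\<close> from \<open>u\<close>.
\<close>

definition (in counterexample) other :: "'a \<Rightarrow> 'a \<Rightarrow> 'a" where
  "other u x = (SOME z. nb V x = {u, z} \<and> z \<noteq> u)"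

lemma (in counterexample) other:
  assumes "x \<in> V" "deg V x = 2" "u \<in> nb V x"
  shows "nb V x = {u, other u x}" "other u x \<noteq> u" "other u x \<in> V" "other u x \<noteq> x"
proof -
  have "\<exists>z. nb V x = {u, z} \<and> z \<noteq> u" using deg2_other[OF assms(2,3)] by metis
  from someI_ex[OF this] show *: "nb V x = {u, other u x}" "other u x \<noteq> u" by (simp_all add: other_def)
  show "other u x \<in> V" using * nb_in_V by blast
  have "other u x \<in> nb V x" unfolding *(1) by blast
  then show "other u x \<noteq> x" using not_in_nb_self[of x V] by metis
qed

lemma pair_eqI: "S = {x, v} \<Longrightarrow> w \<in> S \<Longrightarrow> w \<noteq> x \<Longrightarrow> S = {x, w}"
  by auto

text \<open>
  The neighbors of \<open>w\<close>, sorted by what is deleted with \<open>w\<close>: leaves \<open>F0\<close>, vertices of degree 2 that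
  are deleted alone (\<open>F1\<close>, possibly the start of a longer thread), with the second vertex of a thread
  that has exactly two vertices (\<open>F2\<close>), or with two more vertices (\<open>F3\<close>). The neighbors in \<open>K\<close>
  stay.
\<close>

locale star = counterexample E V L
  for E :: "'a \<Rightarrow> 'a \<Rightarrow> bool" and V and L :: "'a \<Rightarrow> 'c set" +
  fixes w :: 'a and F0 F1 F2 F3 K :: "'a set"
  assumes w: "w \<in> V"
    and deg_w: "4 \<le> deg V w"
    and nb_w: "nb V w = F0 \<union> F1 \<union> F2 \<union> F3 \<union> K"
    and disjoint: "F1 \<inter> F2 = {}" "F1 \<inter> F3 = {}" "F2 \<inter> F3 = {}"
    and deg_F0: "x \<in> F0 \<Longrightarrow> deg V x = 1"
    and deg_F: "x \<in> F1 \<union> F2 \<union> F3 \<Longrightarrow> deg V x = 2"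
    and deg_F2: "x \<in> F2 \<Longrightarrow> deg V (other w x) = 2 \<and> deg V (other x (other w x)) \<noteq> 2"
    and deg_F3: "x \<in> F3 \<Longrightarrow> deg V (other w x) = 2 \<and> deg V (other x (other w x)) = 2"
    and deg_K: "y \<in> K \<Longrightarrow> 3 \<le> deg V y"
    and few_long: "card (F2 \<union> F3) \<le> 2"
begin

abbreviation "o1 x \<equiv> other w x"
abbreviation "o2 x \<equiv> other x (o1 x)"
abbreviation "o3 x \<equiv> other (o1 x) (o2 x)"
abbreviation "F \<equiv> F0 \<union> F1 \<union> F2 \<union> F3"
abbreviation "T \<equiv> F1 \<union> F2 \<union> F3"

definition X :: "'a set" where
  "X = {w} \<union> F \<union> o1 ` (F2 \<union> F3) \<union> o2 ` F3"

lemma in_V: "x \<in> F \<union> K \<Longrightarrow> x \<in> V" and in_nb: "x \<in> F \<union> K \<Longrightarrow> w \<in> nb V x"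
proof -
  assume "x \<in> F \<union> K"
  then have x: "x \<in> nb V w" using nb_w by blast
  then show "x \<in> V" by (rule nb_in_V)
  then show "w \<in> nb V x" using nb_sym[of x w] w x by blast
qed

lemma w_notin: "w \<notin> F" "w \<notin> K"
  using not_in_nb_self[of w V] nb_w by blast+

lemma nb_F0:
  assumes "x \<in> F0" shows "nb V x = {w}"
proof -
  have "card (nb V x) = 1" using deg_F0[OF assms] by (simp add: deg_def)
  then show ?thesis using in_nb[of x] assms by (auto simp: card_1_singleton_iff)
qed

lemma T1:
  assumes "x \<in> T"
  shows "nb V x = {w, o1 x}" "o1 x \<noteq> w" "o1 x \<in> V" "o1 x \<noteq> x" "x \<in> V" "x \<noteq> w"
  using other[of x w] in_V[of x] in_nb[of x] deg_F[of x] assms w_notin by blast+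

lemma in_nb_o1: "x \<in> T \<Longrightarrow> x \<in> nb V (o1 x)"
  using T1[of x] nb_sym[of x "o1 x"] by blast

lemma T2:
  assumes "x \<in> F2 \<union> F3"
  shows "nb V (o1 x) = {x, o2 x}" "o2 x \<noteq> x" "o2 x \<in> V" "o2 x \<noteq> o1 x" "deg V (o1 x) = 2"
proof -
  have x: "x \<in> T" using assms by blast
  show d: "deg V (o1 x) = 2" using assms deg_F2 deg_F3 by blast
  show "nb V (o1 x) = {x, o2 x}" "o2 x \<noteq> x" "o2 x \<in> V" "o2 x \<noteq> o1 x"
    using other[OF T1(3)[OF x] d in_nb_o1[OF x]] by blast+
qed

lemma in_nb_o2: "x \<in> F2 \<union> F3 \<Longrightarrow> o1 x \<in> nb V (o2 x)"
  using T1[of x] T2[of x] nb_sym[of "o1 x" "o2 x"] by blast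

lemma T3:
  assumes "x \<in> F3"
  shows "nb V (o2 x) = {o1 x, o3 x}" "o3 x \<noteq> o1 x" "o3 x \<in> V" "o3 x \<noteq> o2 x" "deg V (o2 x) = 2"
proof -
  have x: "x \<in> F2 \<union> F3" using assms by blast
  show d: "deg V (o2 x) = 2" using assms deg_F3 by blast
  show "nb V (o2 x) = {o1 x, o3 x}" "o3 x \<noteq> o1 x" "o3 x \<in> V" "o3 x \<noteq> o2 x"
    using other[OF T2(3)[OF x] d in_nb_o2[OF x]] by blast+
qed

lemma in_nb_o3: "x \<in> F3 \<Longrightarrow> o2 x \<in> nb V (o3 x)"
  using T2[of x] T3[of x] nb_sym[of "o2 x" "o3 x"] by blast

text \<open>
  By \<open>no_triangle\<close>. This and the next lemmas show, from the absence of short cycles and long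
  paths of vertices of degree 2, that the deleted threads are disjoint, do not return to \<open>w\<close>, and
  end outside \<open>X\<close>.
\<close>

lemma o1_notin_nb:
  assumes x: "x \<in> T" and d: "deg V (o1 x) = 2"
  shows "o1 x \<notin> nb V w"
proof
  assume "o1 x \<in> nb V w"
  then have "w \<in> nb V (o1 x)" using nb_sym T1(3)[OF x] w by blast
  moreover obtain v where v: "nb V (o1 x) = {x, v}" using deg2_other[OF d in_nb_o1[OF x]] by blast
  ultimately have "nb V (o1 x) = {w, x}" using pair_eqI[OF v, of w] T1(6)[OF x] by (metis insert_commute)
  from no_triangle[OF w T1(5,3)[OF x] T1(1)[OF x] this] show False using T1(2,4,6)[OF x] by metis
qed

lemma o2_ne_w: "x \<in> F2 \<union> F3 \<Longrightarrow> o2 x \<noteq> w"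
proof
  assume x: "x \<in> F2 \<union> F3" and eq: "o2 x = w"
  then have xT: "x \<in> T" by blast
  have "w \<in> nb V (o1 x)" using T2(1)[OF x] eq by simp
  then have "o1 x \<in> nb V w" using nb_sym[OF w T1(3)[OF xT]] by blast
  then show False using o1_notin_nb[OF xT T2(5)[OF x]] by blast
qed

lemma o2_notin_nb:
  assumes x: "x \<in> F3"
  shows "o2 x \<notin> nb V w"
proof
  assume "o2 x \<in> nb V w"
  then have "w \<in> nb V (o2 x)" using nb_sym T2(3)[of x] x w by blast
  moreover have xT: "x \<in> T" "x \<in> F2 \<union> F3" using x by blast+
  ultimately have "o3 x = w" using T3(1)[OF x] T1(2)[OF xT(1)] by (metis insertE singletonD)
  then have "nb V (o2 x) = {o1 x, w}" using T3(1)[OF x] by metis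
  then show False
    using no_square[of w x "o1 x" "o2 x", OF _ T1(1)[OF xT(1)] T2(1)[OF xT(2)]]
      T1(2-)[OF xT(1)] T2(2-4)[OF xT(2)] w o2_ne_w[OF xT(2)] by (simp add: not_sym)
qed

lemma o1_eqD:
  assumes "x \<in> F2 \<union> F3" "x' \<in> T" "o1 x = o1 x'"
  shows "x = x'"
proof (rule ccontr)
  assume ne: "x \<noteq> x'"
  have x: "x \<in> T" using assms(1) by blast
  have "nb V (o1 x) = {x, x'}"
    using pair_eqI[OF T2(1)[OF assms(1)], of x'] in_nb_o1[OF assms(2)] assms(3) ne by simp
  moreover have "nb V x' = {o1 x, w}" using T1(1)[OF assms(2)] assms(3) by (metis insert_commute)
  ultimately show False
    using no_square[of w x "o1 x" x', OF _ T1(1)[OF x]] T1(2-)[OF x] T1(2-)[OF assms(2)] ne w assms(3)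
    by (simp add: not_sym)
qed

lemma o2_ne_o1:
  assumes "x \<in> F3" "x' \<in> T"
  shows "o2 x \<noteq> o1 x'"
proof
  assume eq: "o2 x = o1 x'"
  have x: "x \<in> T" "x \<in> F2 \<union> F3" using assms by auto
  have ne: "x \<noteq> x'" using T2(4)[OF x(2)] eq by metis
  have ne1: "x' \<noteq> o1 x" using o1_notin_nb[OF x(1) T2(5)[OF x(2)]] assms(2) nb_w by blast
  have nb2: "nb V (o2 x) = {o1 x, x'}"
    using pair_eqI[OF T3(1)[OF assms(1)], of x'] in_nb_o1[OF assms(2)] eq ne1 by simp
  have nb3: "nb V x' = {o2 x, w}" using T1(1)[OF assms(2)] eq by (metis insert_commute)
  have ne2: "o2 x \<noteq> x'" using T1(4)[OF assms(2)] eq by metis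
  show False
    using no_path4[of x "o1 x" "o2 x" x' w w, OF _ T1(1)[OF x(1)] T2(1)[OF x(2)] nb2 nb3]
      T1(2-)[OF x(1)] T2(2-4)[OF x(2)] T1(2-)[OF assms(2)] w ne ne1 ne2 o2_ne_w[OF x(2)]
    by (simp add: not_sym)
qed

lemma o2_eqD:
  assumes "x \<in> F3" "x' \<in> F2 \<union> F3" "o2 x = o2 x'"
  shows "x = x'"
proof (rule ccontr)
  assume ne: "x \<noteq> x'"
  have x: "x \<in> T" "x \<in> F2 \<union> F3" "x' \<in> T" using assms by auto
  have ne1: "o1 x \<noteq> o1 x'" using o1_eqD[OF x(2,3)] ne by blast
  have nb2: "nb V (o2 x) = {o1 x, o1 x'}"
    using pair_eqI[OF T3(1)[OF assms(1)], of "o1 x'"] in_nb_o2[OF assms(2)] assms(3) ne1 by (simp add: not_sym)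
  have nb3: "nb V (o1 x') = {o2 x, x'}" using T2(1)[OF assms(2)] assms(3) by (metis insert_commute)
  have ne2: "o1 x' \<noteq> x" using o1_notin_nb[OF x(3) T2(5)[OF assms(2)]] x(1) nb_w by blast
  have ne3: "o2 x \<noteq> o1 x'" "o2 x \<noteq> x'" using T2(2,4)[OF assms(2)] assms(3) by metis+
  show False
    using no_path4[of x "o1 x" "o2 x" "o1 x'" w x', OF _ T1(1)[OF x(1)] T2(1)[OF x(2)] nb2 nb3]
      T1(2-)[OF x(1)] T2(2-4)[OF x(2)] T1(2-)[OF x(3)] w ne1 ne2 ne3 o2_ne_w[OF x(2)]
    by (simp add: not_sym)
qed

lemma X_deg: "v \<in> X \<Longrightarrow> v = w \<or> v \<in> F0 \<or> deg V v = 2"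
  unfolding X_def using deg_F T2(5) T3(5) by blast

lemma X_subset: "X \<subseteq> V"
  unfolding X_def using w in_V T1(3) T2(3) by blast

lemma end1_notin:
  assumes x: "x \<in> F1"
  shows "o1 x \<notin> X"
proof
  have xT: "x \<in> T" using x by blast
  assume y: "o1 x \<in> X"
  have "o1 x \<notin> F0" using nb_F0[of "o1 x"] in_nb_o1[OF xT] T1(6)[OF xT] by blast
  then have "deg V (o1 x) = 2" using X_deg[OF y] T1[OF xT] by blast
  then have nin: "o1 x \<notin> nb V w" using o1_notin_nb[OF xT] by blast
  then consider x' where "x' \<in> F2 \<union> F3" "o1 x = o1 x'" | x' where "x' \<in> F3" "o1 x = o2 x'"
    using y T1[OF xT] nb_w unfolding X_def by blast
  then show False
  proof cases
    case 1
    then have "x' = x" using o1_eqD[of x' x] xT by metis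
    then show ?thesis using 1 x disjoint by blast
  next
    case 2
    then show ?thesis using o2_ne_o1[of x' x] xT by metis
  qed
qed

lemma end2_notin:
  assumes x: "x \<in> F2"
  shows "o2 x \<notin> X"
proof
  have xT: "x \<in> T" "x \<in> F2 \<union> F3" using x by blast+
  assume y: "o2 x \<in> X"
  have "o2 x \<notin> F0" using nb_F0[of "o2 x"] in_nb_o2[OF xT(2)] T1(2)[OF xT(1)] by blast
  then show False using X_deg[OF y] o2_ne_w[OF xT(2)] deg_F2[OF x] by blast
qed

lemma end3:
  assumes x: "x \<in> F3"
  shows "deg V (o3 x) \<noteq> 2" "o3 x \<notin> X"
proof -
  have xT: "x \<in> T" "x \<in> F2 \<union> F3" using x by blast+
  have ne: "o3 x \<noteq> x"
    using in_nb_o3[OF x] T1(1)[OF xT(1)] T2(4)[OF xT(2)] o2_ne_w[OF xT(2)] by (metis insertE singletonD)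
  show d: "deg V (o3 x) \<noteq> 2"
  proof
    assume "deg V (o3 x) = 2"
    then obtain v where v: "nb V (o3 x) = {o2 x, v}" "v \<noteq> o2 x" using deg2_other in_nb_o3[OF x] by blast
    then have vV: "v \<in> V" using nb_in_V by blast
    show False
      using no_path4[of x "o1 x" "o2 x" "o3 x" w v, OF _ T1(1)[OF xT(1)] T2(1)[OF xT(2)] T3(1)[OF x] v(1)]
        v(2) vV w T1(2-)[OF xT(1)] T2(2-4)[OF xT(2)] T3(2-4)[OF x] ne o2_ne_w[OF xT(2)]
      by (simp add: not_sym)
  qed
  have "o3 x \<noteq> w" using in_nb_o3[OF x] o2_notin_nb[OF x] by metis
  moreover have "o3 x \<notin> F0" using nb_F0[of "o3 x"] in_nb_o3[OF x] o2_ne_w[OF xT(2)] by blast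
  ultimately show "o3 x \<notin> X" using X_deg d by blast
qed

lemma K_notin: "y \<in> K \<Longrightarrow> y \<notin> X"
  using X_deg[of y] deg_K[of y] deg_F0[of y] w_notin by fastforce

lemma finite_F: "finite F" "finite K"
  using finite_nb[OF finite_V, of w] nb_w by (auto intro: finite_subset)


lemma nb_outer:
  assumes y: "y \<in> V - X" and z: "z \<in> nb V y" "z \<in> X"
  shows "z = w \<and> y \<in> K \<or> z \<in> F1 \<and> o1 z = y \<or> (\<exists>x\<in>F2. z = o1 x \<and> o2 x = y) \<or> (\<exists>x\<in>F3. z = o2 x \<and> o3 x = y)"
proof -
  have yz: "y \<in> nb V z" using nb_sym[of z y] z y X_subset by blast
  have FX: "F \<subseteq> X" "o1 ` (F2 \<union> F3) \<subseteq> X" "o2 ` F3 \<subseteq> X" "w \<in> X" by (auto simp: X_def)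
  consider "z = w" | "z \<in> F0" | "z \<in> F1" | "z \<in> F2 \<union> F3" | x where "x \<in> F2" "z = o1 x"
    | x where "x \<in> F3" "z = o1 x" | x where "x \<in> F3" "z = o2 x"
    using z(2) unfolding X_def by blast
  then show ?thesis
  proof cases
    case 1
    then have "y \<in> F \<union> K" using yz nb_w by simp
    then show ?thesis using 1 y FX(1) by blast
  next
    case 2
    then have "y = w" using yz nb_F0 by simp
    then show ?thesis using y FX(4) by blast
  next
    case 3
    then have "y \<in> {w, o1 z}" using T1(1)[of z] yz by simp
    then show ?thesis using 3 y FX(4) by (elim insertE) simp_all
  next
    case 4
    then have "y \<in> {w, o1 z}" using T1(1)[of z] yz by auto
    moreover have "o1 z \<in> X" using 4 FX(2) by blast
    ultimately show ?thesis using y FX(4) by (elim insertE) simp_all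
  next
    case 5
    then have "y \<in> {x, o2 x}" using T2(1)[of x] yz by simp
    moreover have "x \<in> X" using 5 FX(1) by blast
    ultimately have "y = o2 x" using y by (elim insertE) simp_all
    then show ?thesis using 5 by metis
  next
    case 6
    then have "y \<in> {x, o2 x}" using T2(1)[of x] yz by simp
    moreover have "x \<in> X" "o2 x \<in> X" using 6 FX(1,3) by blast+
    ultimately show ?thesis using y by (elim insertE) simp_all
  next
    case 7
    then have "y \<in> {o1 x, o3 x}" using T3(1)[of x] yz by simp
    moreover have "o1 x \<in> X" using 7 FX(2) by blast
    ultimately have "y = o3 x" using y by (elim insertE) simp_all
    then show ?thesis using 7 by metis
  qed
qed

text \<open>
  An outer vertex \<open>y\<close> whose neighbors are all deleted has no protected color. If it has one neighbor
  only, nothing needs protection. Otherwise its neighbors are last vertices of deleted threads, and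
  possibly \<open>w\<close>; so \<open>w\<close>, \<open>y\<close> and the threads between them form a subgraph with several parallel
  paths, and this is too dense. A thread with \<open>i\<close> vertices contributes \<open>i\<close> vertices and \<open>i + 1\<close> edges,
  so long threads dilute this subgraph; at most two of them do not suffice to make it sparse.
\<close>

lemma outer_isolated:
  assumes y: "y \<in> V - X" and sub: "nb V y \<subseteq> X" and ne: "nb V y \<noteq> {}"
  shows "\<exists>z. nb V y = {z}"
proof (rule ccontr)
  assume not1: "\<not> ?thesis"
  define Y1 where "Y1 = {x \<in> F1. o1 x = y}"
  define Y2 where "Y2 = {x \<in> F2. o2 x = y}"
  define Y3 where "Y3 = {x \<in> F3. o3 x = y}"
  define k where "k = (if y \<in> K then 1 else 0 :: nat)"
  note finy = finite_nb[OF finite_V, of y]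
  have Ysub: "Y1 \<subseteq> F1" "Y2 \<subseteq> F2" "Y3 \<subseteq> F3" by (auto simp: Y1_def Y2_def Y3_def)
  have fin: "finite Y1" "finite Y2" "finite Y3" using Ysub finite_F(1) by (meson finite_Un finite_subset)+
  have nby: "nb V y \<subseteq> (if y \<in> K then {w} else {}) \<union> Y1 \<union> o1 ` Y2 \<union> o2 ` Y3"
  proof
    fix z assume z: "z \<in> nb V y"
    show "z \<in> (if y \<in> K then {w} else {}) \<union> Y1 \<union> o1 ` Y2 \<union> o2 ` Y3"
      using nb_outer[OF y z] z sub unfolding Y1_def Y2_def Y3_def by auto
  qed
  have m_pos: "2 \<le> deg V y"
  proof -
    have "deg V y \<noteq> 0" using ne finy by (simp add: deg_def)
    moreover have "deg V y \<noteq> 1" using not1 by (auto simp: deg_def card_1_singleton_iff)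
    ultimately show ?thesis by linarith
  qed
  have m_le: "deg V y \<le> k + card Y1 + card Y2 + card Y3"
  proof -
    have "deg V y \<le> card ((if y \<in> K then {w} else {}) \<union> Y1 \<union> o1 ` Y2 \<union> o2 ` Y3)"
      unfolding deg_def by (rule card_mono[OF _ nby]) (use fin in simp)
    also have "\<dots> \<le> card (if y \<in> K then {w} else {}) + card Y1 + card (o1 ` Y2) + card (o2 ` Y3)"
      by (meson add_mono card_Un_le order_refl order_trans)
    also have "\<dots> \<le> k + card Y1 + card Y2 + card Y3"
      using card_image_le[OF fin(2), of o1] card_image_le[OF fin(3), of o2] by (simp add: k_def)
    finally show ?thesis .
  qed
  show False
  proof (cases "deg V y = 2")
    case True
    have "y \<notin> K" using deg_K[of y] True by auto
    moreover have "Y2 = {}" using deg_F2 True unfolding Y2_def by blast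
    moreover have "Y3 = {}" using end3(1) True unfolding Y3_def by blast
    ultimately have "nb V y \<subseteq> Y1" using nby by simp
    moreover obtain p q where pq: "nb V y = {p, q}" "p \<noteq> q" using deg2_obtain[OF True] .
    ultimately have p: "p \<in> F1" "o1 p = y" and q: "q \<in> F1" "o1 q = y" unfolding Y1_def by blast+
    have "p \<in> T" "q \<in> T" using p q by blast+
    note P = T1[OF this(1)] and Q = T1[OF this(2)]
    have "nb V q = {y, w}" using Q(1) q(2) by (metis insert_commute)
    moreover have "nb V p = {w, y}" using P(1) p(2) by metis
    ultimately show False
      using no_square[of w p y q, OF _ _ pq(1)] P(2-) Q(2-) p(2) q(2) pq(2) w by (simp add: not_sym)
  next
    case False
    then have m3: "3 \<le> deg V y" using m_pos by linarith
    define B where "B = Y1 \<union> Y2 \<union> Y3 \<union> o1 ` (Y2 \<union> Y3) \<union> o2 ` Y3"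
    define S where "S = insert w (insert y B)"
    have BX: "B \<subseteq> X" using Ysub unfolding B_def X_def by blast
    have yB: "y \<notin> B" "y \<noteq> w" using y BX unfolding X_def by blast+
    have wB: "w \<notin> B"
    proof -
      have "w \<notin> Y1 \<union> Y2 \<union> Y3" using Ysub w_notin by blast
      moreover have "w \<notin> o1 ` (Y2 \<union> Y3)" using T1(2) Ysub by fastforce
      moreover have "w \<notin> o2 ` Y3" using o2_ne_w Ysub by fastforce
      ultimately show ?thesis unfolding B_def by blast
    qed
    have finB: "finite B" using fin unfolding B_def by simp
    have cardS: "card S = card B + 2" unfolding S_def using finB yB wB by simp
    have degB: "deg S v = 2" if v: "v \<in> B" for v
    proof -
      have nbS: "nb V v \<subseteq> S"
      proof -
        consider "v \<in> Y1" | "v \<in> Y2 \<union> Y3" | x where "x \<in> Y2" "v = o1 x" | x where "x \<in> Y3" "v = o1 x"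
          | x where "x \<in> Y3" "v = o2 x" using v unfolding B_def by blast
        then show ?thesis
        proof cases
          case 1
          then have "nb V v = {w, y}" using T1(1)[of v] unfolding Y1_def by auto
          then show ?thesis unfolding S_def by simp
        next
          case 2
          then have "nb V v = {w, o1 v}" using T1(1)[of v] Ysub by blast
          then show ?thesis using 2 unfolding S_def B_def by simp
        next
          case 3
          then have "nb V v = {x, y}" using T2(1)[of x] unfolding Y2_def by auto
          then show ?thesis using 3 unfolding S_def B_def by simp
        next
          case 4
          then have "nb V v = {x, o2 x}" using T2(1)[of x] Ysub by blast
          then show ?thesis using 4 unfolding S_def B_def by simp
        next
          case 5
          then have "nb V v = {o1 x, y}" using T3(1)[of x] unfolding Y3_def by auto
          then show ?thesis using 5 unfolding S_def B_def by simp
        qed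
      qed
      have "S \<subseteq> V" using BX X_subset w y unfolding S_def by blast
      then have "nb S v = nb V v" using nbS by (auto simp: nb_def)
      moreover have "v \<in> T \<union> o1 ` (F2 \<union> F3) \<union> o2 ` F3" using v Ysub unfolding B_def by blast
      then have "deg V v = 2" using deg_F T2(5) T3(5) by blast
      ultimately show ?thesis by (simp add: deg_def)
    qed
    have SV: "S \<subseteq> V" using BX X_subset w y unfolding S_def by blast
    have last_in_B: "Y1 \<union> o1 ` Y2 \<union> o2 ` Y3 \<subseteq> B" unfolding B_def by blast
    have "(if y \<in> K then {w} else {}) \<subseteq> S" unfolding S_def by simp
    then have "nb V y \<subseteq> S" using nby last_in_B unfolding S_def by blast
    then have "nb S y = nb V y" using SV by (auto simp: nb_def)
    then have degy: "deg S y = deg V y" by (simp add: deg_def)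
    have degw: "k + card Y1 + card Y2 + card Y3 \<le> deg S w"
    proof -
      let ?N = "(if y \<in> K then {y} else {}) \<union> (Y1 \<union> Y2 \<union> Y3)"
      have "Y1 \<union> Y2 \<union> Y3 \<subseteq> B" unfolding B_def by blast
      then have disj: "y \<notin> Y1 \<union> Y2 \<union> Y3" "Y1 \<union> Y2 \<union> Y3 \<subseteq> S" using yB unfolding S_def by blast+
      have "card (Y1 \<union> Y2 \<union> Y3) = card (Y1 \<union> Y2) + card Y3"
        by (rule card_Un_disjoint) (use fin Ysub disjoint in auto)
      also have "card (Y1 \<union> Y2) = card Y1 + card Y2"
        by (rule card_Un_disjoint) (use fin Ysub disjoint in auto)
      finally have c: "card (Y1 \<union> Y2 \<union> Y3) = card Y1 + card Y2 + card Y3" .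
      have "card ?N = k + card (Y1 \<union> Y2 \<union> Y3)"
        using disj(1) fin unfolding k_def by simp
      moreover have "?N \<subseteq> nb S w"
      proof
        fix z assume z: "z \<in> ?N"
        then have "z \<in> nb V w" using Ysub nb_w by (auto split: if_splits)
        moreover have "z \<in> S" using z disj(2) unfolding S_def by (auto split: if_splits)
        ultimately show "z \<in> nb S w" by (simp add: nb_def)
      qed
      then have "card ?N \<le> deg S w"
        unfolding deg_def using finite_nb[of S w] finB by (intro card_mono) (auto simp: S_def)
      ultimately show ?thesis using c by simp
    qed
    have "(\<Sum>v\<in>S. deg S v) = deg S w + (deg S y + (\<Sum>v\<in>B. deg S v))"
      unfolding S_def using finB yB wB by simp
    also have "(\<Sum>v\<in>B. deg S v) = 2 * card B" using degB by simp
    finally have "5 * (deg S w + (deg V y + 2 * card B)) < 12 * (card B + 2)"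
      using sparse_V SV cardS degy unfolding sparse_def S_def by (metis insert_not_empty)
    then have ineq: "5 * (k + card Y1 + card Y2 + card Y3) + 5 * deg V y < 2 * card B + 24"
    proof -
      have "5 * d + 5 * b < 2 * c + 24" if "5 * (a + (b + 2 * c)) < 12 * (c + 2)" "d \<le> a" for a b c d :: nat
        using that by simp
      from this[OF _ degw] show ?thesis
        using \<open>5 * (deg S w + (deg V y + 2 * card B)) < 12 * (card B + 2)\<close> by blast
    qed
    have cardB: "card B \<le> card Y1 + 2 * card Y2 + 3 * card Y3"
    proof -
      have "card B \<le> card Y1 + card Y2 + card Y3 + card (o1 ` (Y2 \<union> Y3)) + card (o2 ` Y3)"
        unfolding B_def by (meson add_mono card_Un_le order_refl order_trans)
      also have "\<dots> \<le> card Y1 + card Y2 + card Y3 + card (Y2 \<union> Y3) + card Y3"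
        using card_image_le[of "Y2 \<union> Y3" o1] card_image_le[OF fin(3), of o2] fin by simp
      also have "\<dots> \<le> card Y1 + card Y2 + card Y3 + (card Y2 + card Y3) + card Y3"
        using card_Un_le[of Y2 Y3] by simp
      finally show ?thesis by simp
    qed
    have k1: "k \<le> 1" by (simp add: k_def)
    have long: "card Y2 + card Y3 \<le> 2"
    proof -
      have "card Y2 + card Y3 = card (Y2 \<union> Y3)"
        by (rule card_Un_disjoint[symmetric]) (use fin Ysub disjoint in auto)
      also have "\<dots> \<le> card (F2 \<union> F3)" using Ysub finite_F(1) by (intro card_mono) auto
      finally show ?thesis using few_long by linarith
    qed
    show False
    proof (cases "deg V y = 3")
      case True
      have "Y2 = {}"
      proof (rule ccontr)
        assume "Y2 \<noteq> {}"
        then obtain x where x: "x \<in> F2" "o2 x = y" unfolding Y2_def by blast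
        have xT: "x \<in> T" "x \<in> F2 \<union> F3" using x by blast+
        have "nb V (o1 x) = {y, x}" using T2(1)[OF xT(2)] x(2) by (metis insert_commute)
        moreover have "nb V x = {o1 x, w}" using T1(1)[OF xT(1)] by (metis insert_commute)
        moreover have "{y, o1 x, x, w} \<subseteq> V" using T1(3,5)[OF xT(1)] y w by blast
        moreover have "y \<noteq> x" using T2(2)[OF xT(2)] x(2) by metis
        ultimately show False
          using no_thread_at_deg3[of y "o1 x" x w] True not_sym[OF T1(2)[OF xT(1)]] T1(4)[OF xT(1)] by blast
      qed
      moreover have "Y3 = {}"
      proof (rule ccontr)
        assume "Y3 \<noteq> {}"
        then obtain x where x: "x \<in> F3" "o3 x = y" unfolding Y3_def by blast
        have xT: "x \<in> T" "x \<in> F2 \<union> F3" using x by blast+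
        have "nb V (o2 x) = {y, o1 x}" using T3(1)[OF x(1)] x(2) by (metis insert_commute)
        moreover have "nb V (o1 x) = {o2 x, x}" using T2(1)[OF xT(2)] by (metis insert_commute)
        moreover have "{y, o2 x, o1 x, x} \<subseteq> V" using T1(3,5)[OF xT(1)] T2(3)[OF xT(2)] y by blast
        moreover have "y \<noteq> o1 x" using T3(2)[OF x(1)] x(2) by metis
        ultimately show False
          using no_thread_at_deg3[of y "o2 x" "o1 x" x] True not_sym[OF T2(2)[OF xT(2)]] T2(4)[OF xT(2)] by blast
      qed
      ultimately show False using ineq cardB m_le k1 True by simp
    next
      case False
      then have "4 \<le> deg V y" using m3 by simp
      moreover have "card Y3 \<le> 2" using long by simp
      moreover have "2 * card B \<le> 2 * (card Y1 + card Y2 + card Y3) + 2 * (card Y2 + card Y3) + 2 * card Y3"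
        using cardB by simp
      ultimately have "5 * (k + card Y1 + card Y2 + card Y3) + 20 < 2 * (card Y1 + card Y2 + card Y3) + 32"
        using ineq long by simp
      moreover have "4 \<le> k + card Y1 + card Y2 + card Y3" using m_le \<open>4 \<le> deg V y\<close> by simp
      ultimately show False by simp
    qed
  qed
qed


lemma F0_T_disjoint: "x \<in> F0 \<Longrightarrow> x \<notin> T"
  using deg_F0[of x] deg_F[of x] by auto

lemma X_cases:
  assumes "v \<in> X"
  obtains "v = w" | "v \<in> F0" | "v \<in> F1" | "v \<in> F2 \<union> F3"
    | x where "x \<in> F2" "v = o1 x" | x where "x \<in> F3" "v = o1 x" | x where "x \<in> F3" "v = o2 x"
  using assms unfolding X_def by blast

definition options :: "('a \<Rightarrow> 'c) \<Rightarrow> ('a \<Rightarrow> 'c) \<Rightarrow> 'a \<Rightarrow> 'c \<Rightarrow> 'c set" where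
  "options \<phi> cc x c = (if x \<in> F0 then L x - {c}
     else if x \<in> F1 then L x - set [\<phi> (o1 x), cc (o1 x)] - {c}
     else if x \<in> F2 then options2 (L x - set [\<phi> (o2 x)]) (L (o1 x) - set [\<phi> (o2 x), cc (o2 x)]) c
     else options3 (L x) (L (o1 x) - set [\<phi> (o3 x)]) (L (o2 x) - set [\<phi> (o3 x), cc (o3 x)]) c)"

text \<open>
  The lists are large enough for \<open>leaf_choices\<close>, \<open>options2\<close> and \<open>options3\<close>: four colors at a vertex of
  degree 2, of which the far end of the thread takes away its own color within distance two and its
  protected color next to it.
\<close>

lemma options_count:
  assumes x: "x \<in> F"
  shows "options \<phi> cc x c \<noteq> {}"
    "card {c \<in> W. is_singleton (options \<phi> cc x c)} \<le> (if x \<in> F3 then 1 else 2)"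
proof -
  have Lx: "finite (L x)" using finite_L in_V x by blast
  have both: "options \<phi> cc x c \<noteq> {} \<and>
    card {c \<in> W. is_singleton (options \<phi> cc x c)} \<le> (if x \<in> F3 then 1 else 2)" for c
  proof -
    consider "x \<in> F0" | "x \<in> F1" "x \<notin> F0" | "x \<in> F2" "x \<notin> F0" "x \<notin> F1" | "x \<in> F3" "x \<notin> F0" "x \<notin> F1" "x \<notin> F2"
      using x by blast
    then show ?thesis
    proof cases
      case 1
      then have "2 \<le> card (L x)" using card_L_deg[of x] in_V[of x] deg_F0 by auto
      moreover have "options \<phi> cc x = (\<lambda>c. L x - {c})" using 1 by (simp add: options_def fun_eq_iff)
      moreover have "x \<notin> F3" using F0_T_disjoint 1 by blast
      ultimately show ?thesis using leaf_choices[of "L x"] Lx by simp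
    next
      case 2
      then have "4 \<le> card (L x)" using card_L2[of x] in_V[of x] deg_F by auto
      then have "2 \<le> card (L x - set [\<phi> (o1 x), cc (o1 x)])" using Lx by (intro card_diff_set_ge) auto
      moreover have "options \<phi> cc x = (\<lambda>c. L x - set [\<phi> (o1 x), cc (o1 x)] - {c})"
        using 2 by (simp add: options_def fun_eq_iff)
      moreover have "x \<notin> F3" using disjoint 2 by blast
      ultimately show ?thesis using leaf_choices[of "L x - set [\<phi> (o1 x), cc (o1 x)]"] Lx
        by (simp only: finite_Diff if_False) auto
    next
      case 3
      have xT: "x \<in> T" "x \<in> F2 \<union> F3" using 3 by blast+
      have "4 \<le> card (L x)" using card_L2[OF T1(5)[OF xT(1)]] deg_F[OF xT(1)] by simp
      then have a: "3 \<le> card (L x - set [\<phi> (o2 x)])" using Lx by (intro card_diff_set_ge) auto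
      have "4 \<le> card (L (o1 x))" using card_L2[OF T1(3)[OF xT(1)] T2(5)[OF xT(2)]] .
      then have b: "2 \<le> card (L (o1 x) - set [\<phi> (o2 x), cc (o2 x)])"
        using finite_L[OF T1(3)[OF xT(1)]] by (intro card_diff_set_ge) auto
      have "options \<phi> cc x = options2 (L x - set [\<phi> (o2 x)]) (L (o1 x) - set [\<phi> (o2 x), cc (o2 x)])"
        using 3 by (simp add: options_def fun_eq_iff)
      moreover have "x \<notin> F3" using disjoint 3 by blast
      moreover note options2[OF _ _ a b] Lx finite_L[OF T1(3)[OF xT(1)]]
      ultimately show ?thesis by (simp only: finite_Diff if_False) auto
    next
      case 4
      have xT: "x \<in> T" "x \<in> F2 \<union> F3" using 4 by blast+
      have a: "4 \<le> card (L x)" using card_L2[OF T1(5)[OF xT(1)]] deg_F[OF xT(1)] by simp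
      have "4 \<le> card (L (o1 x))" using card_L2[OF T1(3)[OF xT(1)] T2(5)[OF xT(2)]] .
      then have b: "3 \<le> card (L (o1 x) - set [\<phi> (o3 x)])"
        using finite_L[OF T1(3)[OF xT(1)]] by (intro card_diff_set_ge) auto
      have "4 \<le> card (L (o2 x))" using card_L2[OF T2(3)[OF xT(2)] T3(5)[OF 4(1)]] .
      then have c: "2 \<le> card (L (o2 x) - set [\<phi> (o3 x), cc (o3 x)])"
        using finite_L[OF T2(3)[OF xT(2)]] by (intro card_diff_set_ge) auto
      have "options \<phi> cc x = options3 (L x) (L (o1 x) - set [\<phi> (o3 x)]) (L (o2 x) - set [\<phi> (o3 x), cc (o3 x)])"
        using 4 by (simp add: options_def fun_eq_iff)
      moreover note options3[OF _ _ _ a b c] Lx finite_L[OF T1(3)[OF xT(1)]] finite_L[OF T2(3)[OF xT(2)]] 4(1)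
      ultimately show ?thesis by (simp only: finite_Diff if_True) auto
    qed
  qed
  show "options \<phi> cc x c \<noteq> {}"
    "card {c \<in> W. is_singleton (options \<phi> cc x c)} \<le> (if x \<in> F3 then 1 else 2)"
    using both by blast+
qed

lemma extend_choices:
  assumes gg: "\<And>x. x \<in> F \<Longrightarrow> gg x \<in> options \<phi> cc x c"
  obtains h1 h2 where
    "\<And>x. x \<in> F \<Longrightarrow> gg x \<in> L x \<and> gg x \<noteq> c"
    "\<And>x. x \<in> F1 \<Longrightarrow> gg x \<noteq> \<phi> (o1 x) \<and> gg x \<noteq> cc (o1 x)"
    "\<And>x. x \<in> F2 \<union> F3 \<Longrightarrow> h1 x \<in> L (o1 x) \<and> h1 x \<noteq> c \<and> h1 x \<noteq> gg x"
    "\<And>x. x \<in> F2 \<Longrightarrow> h1 x \<noteq> \<phi> (o2 x) \<and> h1 x \<noteq> cc (o2 x) \<and> gg x \<noteq> \<phi> (o2 x)"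
    "\<And>x. x \<in> F3 \<Longrightarrow> h1 x \<noteq> \<phi> (o3 x) \<and> h2 x \<in> L (o2 x) \<and> h2 x \<noteq> \<phi> (o3 x) \<and> h2 x \<noteq> cc (o3 x) \<and>
       h2 x \<noteq> gg x \<and> h2 x \<noteq> h1 x"
proof -
  have opt0: "options \<phi> cc x c = L x - {c}" if "x \<in> F0" for x using that by (simp add: options_def)
  have opt1: "options \<phi> cc x c = L x - set [\<phi> (o1 x), cc (o1 x)] - {c}" if "x \<in> F1" for x
    using that F0_T_disjoint[of x] by (auto simp: options_def)
  have opt2: "options \<phi> cc x c = options2 (L x - set [\<phi> (o2 x)]) (L (o1 x) - set [\<phi> (o2 x), cc (o2 x)]) c" if "x \<in> F2" for x
    using that F0_T_disjoint[of x] disjoint by (auto simp: options_def)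
  have opt3: "options \<phi> cc x c = options3 (L x) (L (o1 x) - set [\<phi> (o3 x)]) (L (o2 x) - set [\<phi> (o3 x), cc (o3 x)]) c" if "x \<in> F3" for x
    using that F0_T_disjoint[of x] disjoint by (auto simp: options_def)
  let ?P1 = "\<lambda>x e'. e' \<in> L (o1 x) \<and> e' \<noteq> c \<and> e' \<noteq> gg x"
  let ?P2 = "\<lambda>x e'. e' \<noteq> \<phi> (o2 x) \<and> e' \<noteq> cc (o2 x) \<and> gg x \<noteq> \<phi> (o2 x)"
  let ?P3 = "\<lambda>x e' e''. e' \<noteq> \<phi> (o3 x) \<and> e'' \<in> L (o2 x) \<and> e'' \<noteq> \<phi> (o3 x) \<and> e'' \<noteq> cc (o3 x) \<and> e'' \<noteq> gg x \<and> e'' \<noteq> e'"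
  have ex2: "\<exists>e'. ?P1 x e' \<and> ?P2 x e'" if "x \<in> F2" for x
    using gg[of x] that opt2[OF that] by (auto simp: options2_def)
  have ex3: "\<exists>e' e''. ?P1 x e' \<and> ?P3 x e' e''" if "x \<in> F3" for x
    using gg[of x] that opt3[OF that] by (simp add: options3_def) blast
  obtain a where a: "\<And>x. x \<in> F2 \<Longrightarrow> ?P1 x (a x) \<and> ?P2 x (a x)" using ex2 by metis
  obtain b1 b2 where b: "\<And>x. x \<in> F3 \<Longrightarrow> ?P1 x (b1 x) \<and> ?P3 x (b1 x) (b2 x)" using ex3 by metis
  define h1 where "h1 = (\<lambda>x. if x \<in> F2 then a x else b1 x)"
  have h: "h1 x = a x" if "x \<in> F2" for x using that by (simp add: h1_def)
  have h': "h1 x = b1 x" if "x \<in> F3" for x using that disjoint by (auto simp: h1_def)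
  show thesis
  proof (rule that[of h1 b2])
    fix x
    show "gg x \<in> L x \<and> gg x \<noteq> c" if xF: "x \<in> F"
    proof -
      consider "x \<in> F0" | "x \<in> F1" | "x \<in> F2" | "x \<in> F3" using xF by blast
      then show ?thesis
        using gg[OF xF] by cases (auto simp: opt0 opt1 opt2 opt3 options2_def options3_def)
    qed
    show "gg x \<noteq> \<phi> (o1 x) \<and> gg x \<noteq> cc (o1 x)" if "x \<in> F1"
      using gg[of x] that by (auto simp: opt1)
    show "h1 x \<in> L (o1 x) \<and> h1 x \<noteq> c \<and> h1 x \<noteq> gg x" if "x \<in> F2 \<union> F3"
    proof (cases "x \<in> F2")
      case True
      show ?thesis unfolding h[OF True] using a[OF True] by blast
    next
      case False
      then have "x \<in> F3" using that by blast
      then show ?thesis using b[of x] h'[of x] by simp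
    qed
    show "h1 x \<noteq> \<phi> (o2 x) \<and> h1 x \<noteq> cc (o2 x) \<and> gg x \<noteq> \<phi> (o2 x)" if "x \<in> F2"
      unfolding h[OF that] using a[OF that] by blast
    show "h1 x \<noteq> \<phi> (o3 x) \<and> b2 x \<in> L (o2 x) \<and> b2 x \<noteq> \<phi> (o3 x) \<and> b2 x \<noteq> cc (o3 x) \<and>
       b2 x \<noteq> gg x \<and> b2 x \<noteq> h1 x" if "x \<in> F3"
      unfolding h'[OF that] using b[OF that] by blast
  qed
qed

text \<open>
  Each of the neighbors in \<open>K\<close> forbids two colors at \<open>w\<close>, each neighbor in \<open>F1\<close> forbids the color
  of its other neighbor, and leaves and deleted threads forbid none. This gives the number of colors
  left for \<open>w\<close> in \<open>count\<close>.
\<close>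

lemma star_impossible:
  assumes count: "2 * (card F0 + card F1 + card F2) + card F3 <
    (4 - card K) * (deg V w + 1 - 2 * card K - card F1)"
  shows False
proof (rule no_generic_extension[of X])
  fix \<phi> cc :: "'a \<Rightarrow> 'c"
  define W where "W = L w - (\<phi> ` K \<union> cc ` K \<union> (\<lambda>x. \<phi> (o1 x)) ` F1)"
  have finF1: "finite F1" using finite_F by simp
  have cardW: "deg V w + 1 - 2 * card K - card F1 \<le> card W"
  proof -
    have fin: "finite (\<phi> ` K \<union> cc ` K \<union> (\<lambda>x. \<phi> (o1 x)) ` F1)" using finite_F finF1 by simp
    have "card (\<phi> ` K \<union> cc ` K \<union> (\<lambda>x. \<phi> (o1 x)) ` F1) \<le> card (\<phi> ` K) + card (cc ` K) + card ((\<lambda>x. \<phi> (o1 x)) ` F1)"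
      by (meson add_mono card_Un_le order_refl order_trans)
    also have "\<dots> \<le> card K + card K + card F1"
      by (intro add_mono card_image_le finite_F finF1)
    finally have "card (\<phi> ` K \<union> cc ` K \<union> (\<lambda>x. \<phi> (o1 x)) ` F1) \<le> 2 * card K + card F1" by simp
    moreover have "card (L w) - card (\<phi> ` K \<union> cc ` K \<union> (\<lambda>x. \<phi> (o1 x)) ` F1) \<le> card W"
      unfolding W_def by (rule diff_card_le_card_Diff[OF fin])
    ultimately show ?thesis using card_L_deg[OF w] by linarith
  qed
  define s where "s = (\<lambda>x. if x \<in> F3 then 1 else 2 :: nat)"
  have "\<exists>c\<in>W. \<exists>gg. (\<forall>x\<in>F. gg x \<in> options \<phi> cc x c) \<and> (\<forall>y\<in>K. gg y = \<phi> y) \<and> has_unique (F \<union> K) gg"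
  proof (rule star_choice)
    show "finite F" "finite K" by (fact finite_F)+
    show "F \<inter> K = {}" using deg_F0 deg_F deg_K by fastforce
    show "finite W" unfolding W_def using finite_L[OF w] by simp
    show "options \<phi> cc x c \<noteq> {}" if "x \<in> F" for x c by (rule options_count(1)[OF that])
    show "card {c \<in> W. is_singleton (options \<phi> cc x c)} \<le> s x" if "x \<in> F" for x
      unfolding s_def by (rule options_count(2)[OF that])
    show "4 \<le> card F + card K" using deg_w card_Un_le[of F K] unfolding deg_def nb_w by linarith
    have "sum s F = sum s (F - F3) + sum s F3"
      using finite_F by (intro sum.subset_diff) auto
    also have "sum s (F - F3) = 2 * card (F - F3)" by (simp add: s_def)
    also have "sum s F3 = card F3" by (simp add: s_def)
    also have "card (F - F3) \<le> card (F0 \<union> F1 \<union> F2)" using finite_F by (intro card_mono) auto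
    also have "\<dots> \<le> card F0 + card F1 + card F2" by (meson add_mono card_Un_le order_refl order_trans)
    finally have "sum s F \<le> 2 * (card F0 + card F1 + card F2) + card F3" by simp
    also note count
    also have "(4 - card K) * (deg V w + 1 - 2 * card K - card F1) \<le> (4 - card K) * card W"
      by (rule mult_le_mono2[OF cardW])
    finally show "sum s F < (4 - card K) * card W" .
  qed
  then obtain c gg where c: "c \<in> W" and gg: "\<And>x. x \<in> F \<Longrightarrow> gg x \<in> options \<phi> cc x c"
    and ggK: "\<And>y. y \<in> K \<Longrightarrow> gg y = \<phi> y" and uniq: "has_unique (F \<union> K) gg" by blast
  show "\<exists>g. completes {} X \<phi> cc g"
  proof (rule extend_choices[of gg \<phi> cc c])
    show "gg x \<in> options \<phi> cc x c" if "x \<in> F" for x by (rule gg[OF that])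
    fix h1 h2
    assume H0: "\<And>x. x \<in> F \<Longrightarrow> gg x \<in> L x \<and> gg x \<noteq> c"
      and H1: "\<And>x. x \<in> F1 \<Longrightarrow> gg x \<noteq> \<phi> (o1 x) \<and> gg x \<noteq> cc (o1 x)"
      and H23: "\<And>x. x \<in> F2 \<union> F3 \<Longrightarrow> h1 x \<in> L (o1 x) \<and> h1 x \<noteq> c \<and> h1 x \<noteq> gg x"
      and H2: "\<And>x. x \<in> F2 \<Longrightarrow> h1 x \<noteq> \<phi> (o2 x) \<and> h1 x \<noteq> cc (o2 x) \<and> gg x \<noteq> \<phi> (o2 x)"
      and H3: "\<And>x. x \<in> F3 \<Longrightarrow> h1 x \<noteq> \<phi> (o3 x) \<and> h2 x \<in> L (o2 x) \<and> h2 x \<noteq> \<phi> (o3 x) \<and> h2 x \<noteq> cc (o3 x) \<and>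
         h2 x \<noteq> gg x \<and> h2 x \<noteq> h1 x"
    have cL: "c \<in> L w" and cK: "\<And>y. y \<in> K \<Longrightarrow> c \<noteq> \<phi> y \<and> c \<noteq> cc y" and c1: "\<And>x. x \<in> F1 \<Longrightarrow> c \<noteq> \<phi> (o1 x)"
      using c unfolding W_def by blast+
    \<comment> \<open>\<open>h1\<close> and \<open>h2\<close> are indexed by the first vertex of a thread.\<close>
    define g where "g = (\<lambda>v. if v = w then c else if v \<in> F then gg v
      else if v \<in> o1 ` (F2 \<union> F3) then h1 (the_inv_into (F2 \<union> F3) o1 v)
      else if v \<in> o2 ` F3 then h2 (the_inv_into F3 o2 v) else \<phi> v)"
    have inj1: "inj_on o1 (F2 \<union> F3)" by (rule inj_onI, rule o1_eqD) blast+
    have inj2: "inj_on o2 F3" by (rule inj_onI, rule o2_eqD) blast+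
    have gw: "g w = c" by (simp add: g_def)
    have gF: "g x = gg x" if "x \<in> F" for x using that w_notin by (auto simp: g_def)
    have go1: "g (o1 x) = h1 x" if x: "x \<in> F2 \<union> F3" for x
    proof -
      have "o1 x \<noteq> w" using T1(2)[of x] x by blast
      moreover have "o1 x \<notin> F" using o1_notin_nb[of x] T2(5)[OF x] x nb_w by blast
      moreover have "the_inv_into (F2 \<union> F3) o1 (o1 x) = x" by (rule the_inv_into_f_f[OF inj1 x])
      moreover have "o1 x \<in> o1 ` (F2 \<union> F3)" using x by blast
      ultimately show ?thesis unfolding g_def by (simp only: if_False if_True)
    qed
    have go2: "g (o2 x) = h2 x" if x: "x \<in> F3" for x
    proof -
      have "o2 x \<noteq> w" using o2_ne_w[of x] x by blast
      moreover have "o2 x \<notin> F" using o2_notin_nb[OF x] nb_w by blast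
      moreover have "o2 x \<notin> o1 ` (F2 \<union> F3)" using o2_ne_o1[OF x] by blast
      moreover have "the_inv_into F3 o2 (o2 x) = x" by (rule the_inv_into_f_f[OF inj2 x])
      moreover have "o2 x \<in> o2 ` F3" using x by blast
      ultimately show ?thesis unfolding g_def by (simp only: if_False if_True)
    qed
    have gout: "g v = \<phi> v" if "v \<notin> X" for v
      using that unfolding X_def g_def by auto
    have gK: "g y = \<phi> y" if "y \<in> K" for y using gout K_notin that by blast
    have ge1: "g (o1 x) = \<phi> (o1 x)" if "x \<in> F1" for x using gout end1_notin that by blast
    have ge2: "g (o2 x) = \<phi> (o2 x)" if "x \<in> F2" for x using gout end2_notin that by blast
    have ge3: "g (o3 x) = \<phi> (o3 x)" if "x \<in> F3" for x using gout end3(2) that by blast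
    have two: "has_unique {p, q} g" if "g p \<noteq> g q" for p q using that by (intro has_unique_pair[of p _ q]) auto
    have inX: "F \<subseteq> X" "o1 ` (F2 \<union> F3) \<subseteq> X" "o2 ` F3 \<subseteq> X" "w \<in> X" by (auto simp: X_def)
    have local: "g v \<in> L v \<and> (\<forall>y\<in>nb V v. g y \<noteq> g v) \<and> (\<forall>y\<in>nb V v. y \<notin> X \<longrightarrow> g v \<noteq> cc y) \<and> has_unique (nb V v) g"
      if v: "v \<in> X" for v
      using v
    proof (cases rule: X_cases)
      case 1
      have "has_unique (nb V w) g"
      proof -
        have "g z = gg z" if "z \<in> F \<union> K" for z using that gF gK ggK by auto
        then show ?thesis using uniq has_unique_cong[of "F \<union> K" g gg] nb_w by simp
      qed
      moreover have "\<forall>y\<in>nb V w. g y \<noteq> g w"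
      proof
        fix y assume "y \<in> nb V w"
        then consider "y \<in> F" | "y \<in> K" using nb_w by blast
        then show "g y \<noteq> g w" using gF[of y] gK[of y] H0[of y] cK[of y] gw by cases auto
      qed
      moreover have "\<forall>y\<in>nb V w. y \<notin> X \<longrightarrow> g w \<noteq> cc y"
        using nb_w inX(1) cK gw by auto
      ultimately show ?thesis using 1 cL gw by simp
    next
      case 2
      then show ?thesis using nb_F0[of v] gF[of v] gw H0[of v] inX(4) has_unique_singleton by fastforce
    next
      case 3
      have vT: "v \<in> T" "v \<in> F" using 3 by blast+
      have e: "nb V v = {w, o1 v}" by (rule T1(1)[OF vT(1)])
      have "g w \<noteq> g (o1 v)" using c1[OF 3] ge1[OF 3] gw by simp
      then show ?thesis
        unfolding e using two[of w "o1 v"] gF[OF vT(2)] gw ge1[OF 3] H0[OF vT(2)] H1[OF 3] inX(4) by auto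
    next
      case 4
      have vT: "v \<in> T" "v \<in> F" using 4 by blast+
      have e: "nb V v = {w, o1 v}" by (rule T1(1)[OF vT(1)])
      have "o1 v \<in> X" using inX(2) 4 by blast
      moreover have "g w \<noteq> g (o1 v)" using go1[OF 4] H23[OF 4] gw by (simp add: not_sym)
      ultimately show ?thesis
        unfolding e using two[of w "o1 v"] gF[OF vT(2)] gw go1[OF 4] H0[OF vT(2)] H23[OF 4] inX(4) by auto
    next
      case (5 x)
      have xT: "x \<in> F2 \<union> F3" "x \<in> F" using 5 by blast+
      have e: "nb V v = {x, o2 x}" using T2(1)[OF xT(1)] 5 by simp
      have "x \<in> X" using inX(1) xT by blast
      moreover have "g x \<noteq> g (o2 x)" using gF[OF xT(2)] ge2[OF 5(1)] H2[OF 5(1)] by simp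
      moreover have "g v = h1 x" using go1[OF xT(1)] 5 by simp
      moreover have "h1 x \<in> L v" using H23[OF xT(1)] 5 by simp
      ultimately show ?thesis
        unfolding e using two[of x "o2 x"] gF[OF xT(2)] ge2[OF 5(1)] H23[OF xT(1)] H2[OF 5(1)] by auto
    next
      case (6 x)
      have xT: "x \<in> F2 \<union> F3" "x \<in> F" using 6 by blast+
      have e: "nb V v = {x, o2 x}" using T2(1)[OF xT(1)] 6 by simp
      have "x \<in> X" "o2 x \<in> X" using inX xT 6 by blast+
      moreover have "g x \<noteq> g (o2 x)" using gF[OF xT(2)] go2[OF 6(1)] H3[OF 6(1)] by (simp add: not_sym)
      moreover have "g v = h1 x" using go1[OF xT(1)] 6 by simp
      moreover have "h1 x \<in> L v" using H23[OF xT(1)] 6 by simp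
      ultimately show ?thesis
        unfolding e using two[of x "o2 x"] gF[OF xT(2)] go2[OF 6(1)] H23[OF xT(1)] H3[OF 6(1)] by auto
    next
      case (7 x)
      have xT: "x \<in> F2 \<union> F3" "x \<in> F" using 7 by blast+
      have e: "nb V v = {o1 x, o3 x}" using T3(1)[OF 7(1)] 7 by simp
      have "o1 x \<in> X" using inX xT 7 by blast
      moreover have "g (o1 x) \<noteq> g (o3 x)" using go1[OF xT(1)] ge3[OF 7(1)] H3[OF 7(1)] by simp
      moreover have "g v = h2 x" using go2[OF 7(1)] 7 by simp
      moreover have "h2 x \<in> L v" using H3[OF 7(1)] 7 by simp
      ultimately show ?thesis
        unfolding e using two[of "o1 x" "o3 x"] go1[OF xT(1)] ge3[OF 7(1)] H3[OF 7(1)] by auto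
    qed
    have "completes {} X \<phi> cc g"
    proof (rule completesI)
      show "g v = \<phi> v" if "v \<in> V - X" for v using gout that by blast
      show "has_unique (nb V y) g" if "y \<in> V - X" "nb V y \<subseteq> X" "nb V y \<noteq> {}" for y
        using outer_isolated[OF that] has_unique_singleton by metis
    qed (use local in blast)+
    then show "\<exists>g. completes {} X \<phi> cc g" by blast
  qed
qed (use X_subset in \<open>auto simp: X_def\<close>)

end

section \<open>Local structure of a minimal counterexample\<close>

context counterexample
begin

definition leaves :: "'a \<Rightarrow> 'a set" where
  "leaves w = {v \<in> nb V w. deg V v = 1}"

definition twos :: "'a \<Rightarrow> 'a set" where
  "twos w = {v \<in> nb V w. deg V v = 2}"

definition bigs :: "'a \<Rightarrow> 'a set" where
  "bigs w = {v \<in> nb V w. 3 \<le> deg V v}"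

definition threads2 :: "'a \<Rightarrow> 'a set" where
  "threads2 w = {x \<in> twos w. deg V (other w x) = 2 \<and> deg V (other x (other w x)) \<noteq> 2}"

definition threads3 :: "'a \<Rightarrow> 'a set" where
  "threads3 w = {x \<in> twos w. deg V (other w x) = 2 \<and> deg V (other x (other w x)) = 2}"

lemma deg_pos: "v \<in> V \<Longrightarrow> deg V v \<noteq> 0"
  using no_isolated[of v] finite_nb[OF finite_V, of v] by (simp add: deg_def)

lemma nb_partition: "nb V w = leaves w \<union> twos w \<union> bigs w"
proof -
  have "deg V v = 1 \<or> deg V v = 2 \<or> 3 \<le> deg V v" if "v \<in> nb V w" for v
    using deg_pos[OF nb_in_V[OF that]] by linarith
  then show ?thesis by (auto simp: leaves_def twos_def bigs_def)
qed

lemma finite_parts: "finite (leaves w)" "finite (twos w)" "finite (bigs w)"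
  using finite_nb[OF finite_V, of w] by (auto simp: leaves_def twos_def bigs_def)

lemma deg_partition: "deg V w = card (leaves w) + card (twos w) + card (bigs w)"
proof -
  have "card (leaves w \<union> twos w \<union> bigs w) = card (leaves w \<union> twos w) + card (bigs w)"
    by (rule card_Un_disjoint) (use finite_parts in \<open>auto simp: leaves_def twos_def bigs_def\<close>)
  moreover have "card (leaves w \<union> twos w) = card (leaves w) + card (twos w)"
    by (rule card_Un_disjoint) (use finite_parts in \<open>auto simp: leaves_def twos_def\<close>)
  ultimately show ?thesis by (simp add: deg_def nb_partition[of w])
qed

lemma deg_ge4_of_leaf: "w \<in> V \<Longrightarrow> card (leaves w) \<noteq> 0 \<Longrightarrow> 4 \<le> deg V w"
proof -
  assume w: "w \<in> V" and "card (leaves w) \<noteq> 0"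
  then obtain v where v: "v \<in> nb V w" "deg V v = 1" unfolding leaves_def by (metis (mono_tags, lifting) card.empty empty_Collect_eq)
  have "w \<in> nb V v" using nb_sym[OF nb_in_V[OF v(1)] w] v(1) by blast
  then have "nb V v = {w}" using v(2) by (auto simp: deg_def card_1_singleton_iff)
  then show "4 \<le> deg V w" using leaf_nb_deg[OF nb_in_V[OF v(1)]] by blast
qed

text \<open>
  The numerical form of \<open>star_impossible\<close>; the threads that are deleted as a whole may be chosen.
\<close>

lemma star_bound:
  assumes w: "w \<in> V" "4 \<le> deg V w" and F: "F2 \<subseteq> threads2 w" "F3 \<subseteq> threads3 w" "card F2 + card F3 \<le> 2"
    and k: "card (bigs w) \<le> card (leaves w) + card F2 + card F3"
  shows "(4 - card (bigs w)) * (card (leaves w) + 1 + card F2 + card F3 - card (bigs w)) + card F3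
    \<le> 2 * (card (leaves w) + card (twos w))"
proof (rule ccontr)
  assume neg: "\<not> ?thesis"
  have sub: "F2 \<subseteq> twos w" "F3 \<subseteq> twos w" using F by (auto simp: threads2_def threads3_def)
  have fin: "finite F2" "finite F3" using sub finite_parts by (auto intro: finite_subset)
  have disj: "F2 \<inter> F3 = {}" using F by (auto simp: threads2_def threads3_def)
  define F1 where "F1 = twos w - F2 - F3"
  have c1: "card (twos w) = card F1 + card F2 + card F3"
  proof -
    have "twos w = F1 \<union> (F2 \<union> F3)" using sub by (auto simp: F1_def)
    then have "card (twos w) = card F1 + card (F2 \<union> F3)"
      using card_Un_disjoint[of F1 "F2 \<union> F3"] finite_parts(2)[of w] fin by (auto simp: F1_def)
    then show ?thesis using card_Un_disjoint[OF fin disj] by simp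
  qed
  interpret star E V L w "leaves w" F1 F2 F3 "bigs w"
  proof
    show "nb V w = leaves w \<union> F1 \<union> F2 \<union> F3 \<union> bigs w"
      using nb_partition[of w] sub by (auto simp: F1_def)
    show "card (F2 \<union> F3) \<le> 2" using F(3) card_Un_le[of F2 F3] by linarith
  qed (use w F sub disj in \<open>auto simp: F1_def leaves_def twos_def bigs_def threads2_def threads3_def\<close>)
  have "deg V w + 1 - 2 * card (bigs w) - card F1 = card (leaves w) + 1 + card F2 + card F3 - card (bigs w)"
    using deg_partition[of w] c1 by simp
  then have "2 * (card (leaves w) + card F1 + card F2) + card F3
      < (4 - card (bigs w)) * (deg V w + 1 - 2 * card (bigs w) - card F1)"
    using neg c1 by simp
  then show False by (rule star_impossible)
qed

lemma leaf_nb: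
  assumes w: "w \<in> V" and v: "v \<in> leaves w"
  shows "nb V v = {w}" "v \<in> V" "v \<noteq> w"
proof -
  have v': "v \<in> nb V w" "deg V v = 1" using v by (auto simp: leaves_def)
  show "v \<in> V" using nb_in_V v' by blast
  have "w \<in> nb V v" using nb_sym[OF \<open>v \<in> V\<close> w] v'(1) by blast
  then show "nb V v = {w}" using v'(2) by (auto simp: deg_def card_1_singleton_iff)
  show "v \<noteq> w" using v'(1) not_in_nb_self by metis
qed

text \<open>
  Here the center \<open>w\<close> is kept and only the leaves are deleted. Then \<open>w\<close> has degree 2, so its two
  other neighbors get different colors, and the fifth color in its list can be given up to avoid the
  bad color of \<open>two_leaf_choice\<close>.
\<close>

lemma not_two_leaves_two_others:
  assumes w: "w \<in> V" and l: "card (leaves w) = 2" and d: "deg V w = 4"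
  shows False
proof -
  obtain v1 v2 where lv: "leaves w = {v1, v2}" "v1 \<noteq> v2" using l by (auto simp: card_2_iff)
  note leaf1 = leaf_nb[OF w, of v1] and leaf2 = leaf_nb[OF w, of v2]
  have n1: "nb V v1 = {w}" "v1 \<in> V" "v1 \<noteq> w" and n2: "nb V v2 = {w}" "v2 \<in> V" "v2 \<noteq> w"
    using leaf1 leaf2 lv by simp_all
  let ?X = "{v1, v2}"
  have Xnb: "?X \<subseteq> nb V w" using lv by (auto simp: leaves_def)
  have "card (nb V w - ?X) = 2"
    using card_Diff_subset[OF _ Xnb] d lv(2) by (simp add: deg_def)
  then obtain p q where pq: "nb V w - ?X = {p, q}" "p \<noteq> q" by (auto simp: card_2_iff)
  have nbw: "nb V w = {p, q, v1, v2}" using pq(1) Xnb by blast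
  have pqX: "p \<notin> ?X" "q \<notin> ?X" using pq by blast+
  have fin: "finite (L v1)" "finite (L v2)" "finite (L w)" using finite_L n1 n2 w by blast+
  have c: "2 \<le> card (L v1)" "2 \<le> card (L v2)"
    using card_L_deg[OF n1(2)] card_L_deg[OF n2(2)] n1(1) n2(1) by (simp_all add: deg_def)
  obtain c0 where c0: "\<And>c b1 b2. c \<noteq> c0 \<Longrightarrow> b1 \<noteq> b2 \<Longrightarrow>
    \<exists>e1\<in>L v1 - {c}. \<exists>e2\<in>L v2 - {c}. b1 \<notin> {e1, e2} \<or> b2 \<notin> {e1, e2}"
    using two_leaf_choice[OF fin(1,2) c] by blast
  define L' where "L' = L(w := L w - set [c0])"
  show False
  proof (rule no_extension[of ?X w L'])
    show "kap (V - ?X) w \<le> card (L' w)"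
    proof -
      have "nb (V - ?X) w = {p, q}" using nbw pqX by (auto simp: nb_Diff)
      then have "kap (V - ?X) w = 4" using pq(2) by (simp add: kap_def deg_def)
      moreover have "4 \<le> card (L w - set [c0])"
        by (rule card_diff_set_ge[OF fin(3)]) (use card_L_deg[OF w] d in simp)
      ultimately show ?thesis by (simp add: L'_def)
    qed
    fix \<phi> cc :: "'a \<Rightarrow> 'c"
    assume prop_on: "proper_on (V - ?X) L' \<phi>"
    assume "w \<in> V - ?X \<Longrightarrow> nb (V - ?X) w \<noteq> {} \<Longrightarrow> has_unique (nb (V - ?X) w) \<phi>"
    moreover have "nb (V - ?X) w = {p, q}" using nbw pqX by (auto simp: nb_Diff)
    ultimately have "has_unique {p, q} \<phi>" using w n1(3) n2(3) by auto
    then have pq\<phi>: "\<phi> p \<noteq> \<phi> q" using has_unique_doubleD[of p q \<phi>] pq(2) by simp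
    have "w \<in> V - ?X" using w n1(3) n2(3) by blast
    then have "\<phi> w \<in> L' w" using prop_on unfolding proper_on_def by blast
    then have "\<phi> w \<noteq> c0" by (simp add: L'_def)
    from c0[OF this pq\<phi>] obtain e1 e2 where e: "e1 \<in> L v1" "e1 \<noteq> \<phi> w" "e2 \<in> L v2" "e2 \<noteq> \<phi> w"
      "\<phi> p \<notin> {e1, e2} \<or> \<phi> q \<notin> {e1, e2}" by blast
    define g where "g = \<phi>(v1 := e1, v2 := e2)"
    have g: "g v1 = e1" "g v2 = e2" "g w = \<phi> w" "\<And>v. v \<notin> ?X \<Longrightarrow> g v = \<phi> v"
      using lv(2) n1(3) n2(3) by (auto simp: g_def)
    have gpq: "g p = \<phi> p" "g q = \<phi> q" using g(4) pqX by blast+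
    have CFw: "has_unique (nb V w) g"
    proof (cases "\<phi> p \<notin> {e1, e2}")
      case True
      then have "\<forall>j\<in>nb V w. g j = g p \<longrightarrow> j = p" using nbw gpq g(1,2) pq\<phi> by auto
      then show ?thesis unfolding has_unique_def nbw by blast
    next
      case False
      then have "\<phi> q \<notin> {e1, e2}" using e(5) by blast
      then have "\<forall>j\<in>nb V w. g j = g q \<longrightarrow> j = q" using nbw gpq g(1,2) pq\<phi> by auto
      then show ?thesis unfolding has_unique_def nbw by blast
    qed
    have "completes {w} ?X \<phi> cc g"
    proof (rule completesI)
      show "has_unique (nb V x) g" if "x \<in> ?X" for x
        using that n1(1) n2(1) has_unique_singleton[of w g] by auto
      show "has_unique (nb V y) g" if y: "y \<in> V - ?X" "nb V y \<subseteq> ?X" "nb V y \<noteq> {}" "y \<notin> {w}" for y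
        using nb_sym[of y v1] nb_sym[of y v2] y n1 n2 by auto
      show "has_unique (nb V y) g" if "y \<in> V - ?X" "y \<in> {w}" for y
        using CFw that by blast
    qed (use g e n1 n2 in auto)
    then show "\<exists>g. completes {w} ?X \<phi> cc g" by blast
  qed (use n1 n2 w in \<open>auto simp: L'_def\<close>)
qed

text \<open>
  Delete \<open>w\<close> with its leaves. If the other two neighbors have the same color, one color less is
  forbidden at \<open>w\<close>, as \<open>many_leaves_choice\<close> requires.
\<close>

lemma not_many_leaves_two_bigs:
  assumes w: "w \<in> V" and l: "3 \<le> card (leaves w)" and k: "card (bigs w) = 2" and t: "card (twos w) = 0"
  shows False
proof -
  obtain p q where pq: "bigs w = {p, q}" "p \<noteq> q" using k by (auto simp: card_2_iff)
  have "twos w = {}" using t finite_parts by auto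
  then have nbw: "nb V w = leaves w \<union> {p, q}" using nb_partition[of w] pq by simp
  let ?X = "insert w (leaves w)"
  have wl: "w \<notin> leaves w" using leaf_nb(3)[OF w] by blast
  have pqX: "p \<notin> ?X" "q \<notin> ?X"
  proof -
    have "p \<in> bigs w" "q \<in> bigs w" using pq by auto
    then show "p \<notin> ?X" "q \<notin> ?X" using not_in_nb_self[of w V] by (auto simp: bigs_def leaves_def)
  qed
  have d: "deg V w = card (leaves w) + 2" using deg_partition[of w] k t by simp
  show False
  proof (rule no_generic_extension[of ?X])
    fix \<phi> cc :: "'a \<Rightarrow> 'c"
    define W where "W = L w - {\<phi> p, \<phi> q, cc p, cc q}"
    have finw: "finite (L w)" by (rule finite_L[OF w])
    have cLw: "card (leaves w) + 3 \<le> card (L w)" using card_L_deg[OF w] d by simp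
    have "card (leaves w) - 1 \<le> card (L w - set [\<phi> p, \<phi> q, cc p, cc q])"
      by (rule card_diff_set_ge[OF finw]) (use cLw l in simp)
    then have W1: "card (leaves w) \<le> card W + 1" by (simp add: W_def)
    have W2: "card (leaves w) \<le> card W" if "\<phi> p = \<phi> q"
    proof -
      have "card (leaves w) \<le> card (L w - set [\<phi> p, cc p, cc q])"
        by (rule card_diff_set_ge[OF finw]) (use cLw in simp)
      moreover have "L w - set [\<phi> p, cc p, cc q] = W" using that by (auto simp: W_def)
      ultimately show ?thesis by simp
    qed
    have "\<exists>c\<in>W. \<exists>g. (\<forall>v\<in>leaves w. g v \<in> L v - {c}) \<and> g p = \<phi> p \<and> g q = \<phi> q \<and> has_unique (leaves w \<union> {p, q}) g"
    proof (rule many_leaves_choice)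
      show "finite (L v) \<and> 2 \<le> card (L v)" if "v \<in> leaves w" for v
        using finite_L card_L_deg[of v] leaf_nb[OF w that] by (simp add: deg_def)
    qed (use finite_parts l pqX pq finw W1 W2 in \<open>auto simp: W_def\<close>)
    then obtain c h where c: "c \<in> W" and h: "\<And>v. v \<in> leaves w \<Longrightarrow> h v \<in> L v \<and> h v \<noteq> c" "h p = \<phi> p" "h q = \<phi> q"
      and uniq: "has_unique (leaves w \<union> {p, q}) h" by blast
    define g where "g = (\<lambda>v. if v = w then c else if v \<in> leaves w then h v else \<phi> v)"
    have g: "g w = c" "\<And>v. v \<in> leaves w \<Longrightarrow> g v = h v" "g p = \<phi> p" "g q = \<phi> q" "\<And>v. v \<notin> ?X \<Longrightarrow> g v = \<phi> v"
      using wl pqX by (auto simp: g_def)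
    have c': "c \<in> L w" "c \<noteq> \<phi> p" "c \<noteq> \<phi> q" "c \<noteq> cc p" "c \<noteq> cc q" using c by (auto simp: W_def)
    have CFw: "has_unique (nb V w) g"
    proof -
      have "g v = h v" if "v \<in> leaves w \<union> {p, q}" for v using that g(2-4) h(2,3) by auto
      then show ?thesis using uniq has_unique_cong[of "leaves w \<union> {p, q}" g h] nbw by simp
    qed
    have "completes {} ?X \<phi> cc g"
    proof (rule completesI)
      show "g x \<in> L x" if "x \<in> ?X" for x using that g(1,2) h(1) c'(1) by auto
      show "g y \<noteq> g x" if "x \<in> ?X" "y \<in> nb V x" for x y
      proof (cases "x = w")
        case True
        then have "y \<in> leaves w \<union> {p, q}" using that nbw by simp
        then show ?thesis using True g h(1) c' by auto
      next
        case False
        then have x: "x \<in> leaves w" using that by blast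
        then have "y = w" using that leaf_nb(1)[OF w x] by blast
        then show ?thesis using g(1) g(2)[OF x] h(1)[OF x] by (simp add: not_sym)
      qed
      show "g x \<noteq> cc y" if "x \<in> ?X" "y \<in> nb V x" "y \<notin> ?X" for x y
      proof (cases "x = w")
        case True
        then have "y \<in> {p, q}" using that nbw by blast
        then show ?thesis using True g(1) c' by auto
      next
        case False
        then have "x \<in> leaves w" using that by blast
        then have "y = w" using that leaf_nb(1)[OF w] by blast
        then show ?thesis using that by blast
      qed
      show "has_unique (nb V x) g" if "x \<in> ?X" for x
      proof (cases "x = w")
        case True
        then show ?thesis using CFw by simp
      next
        case False
        then have "x \<in> leaves w" using that by blast
        then show ?thesis using leaf_nb(1)[OF w] has_unique_singleton by metis
      qed
      show "has_unique (nb V y) g" if y: "y \<in> V - ?X" "nb V y \<subseteq> ?X" "nb V y \<noteq> {}" for y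
      proof -
        have "z \<notin> leaves w" if z: "z \<in> nb V y" for z
        proof
          assume "z \<in> leaves w"
          then have "nb V z = {w}" "z \<in> V" using leaf_nb[OF w] by blast+
          then show False using nb_sym[of z y] z y(1) by auto
        qed
        then have "nb V y = {w}" using y by blast
        then show ?thesis using has_unique_singleton by metis
      qed
    qed (use g in auto)
    then show "\<exists>g. completes {} ?X \<phi> cc g" by blast
  qed (use w leaf_nb(2)[OF w] in auto)
qed

text \<open>
  The sum is the degree after removal of all leaves. A vertex where this drops below 3 has so many
  leaves that \<open>star_bound\<close> or one of the two preceding lemmas applies.
\<close>

lemma core_deg_ge3:
  assumes w: "w \<in> V" "deg V w \<noteq> 1" "deg V w \<noteq> 2"
  shows "3 \<le> card (twos w) + card (bigs w)"
proof (rule ccontr)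
  let ?l = "card (leaves w)" and ?t = "card (twos w)" and ?k = "card (bigs w)"
  assume "\<not> ?thesis"
  then have tk: "?t + ?k \<le> 2" by linarith
  have d: "deg V w = ?l + ?t + ?k" by (rule deg_partition)
  have "?l \<noteq> 0" using d tk w deg_pos[OF w(1)] by linarith
  then have d4: "4 \<le> deg V w" using deg_ge4_of_leaf w(1) by blast
  have bound: "(4 - ?k) * (?l + 1 - ?k) \<le> 2 * (?l + ?t)" if "?k \<le> ?l"
    using star_bound[OF w(1) d4, of "{}" "{}"] that by simp
  consider "?k = 0" | "?k = 1" | "?k = 2" using tk by linarith
  then show False
  proof cases
    case 1
    then show ?thesis using bound tk d d4 by simp
  next
    case 2
    then have "3 * ?l \<le> 2 * (?l + ?t)" using bound \<open>?l \<noteq> 0\<close> by simp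
    moreover have t1: "?t \<le> 1" using 2 tk by simp
    ultimately have "?l \<le> 2" by simp
    then have "?l = 2" "deg V w = 4" using 2 d d4 t1 by simp_all
    then show ?thesis using not_two_leaves_two_others w(1) by blast
  next
    case 3
    then have t: "?t = 0" using tk by simp
    show ?thesis
    proof (cases "?l = 2")
      case True
      then show ?thesis using not_two_leaves_two_others w(1) d t 3 by simp
    next
      case False
      then have "3 \<le> ?l" using d d4 t 3 by linarith
      then show ?thesis using not_many_leaves_two_bigs w(1) t 3 by blast
    qed
  qed
qed

lemma threads_disjoint: "threads2 w \<inter> threads3 w = {}"
  by (auto simp: threads2_def threads3_def)

lemma threads_subset: "threads2 w \<subseteq> twos w" "threads3 w \<subseteq> twos w"
  by (auto simp: threads2_def threads3_def)

lemma finite_threads: "finite (threads2 w)" "finite (threads3 w)"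
  by (rule finite_subset[OF threads_subset(1) finite_parts(2)], rule finite_subset[OF threads_subset(2) finite_parts(2)])

lemma card_threads: "card (threads2 w) + card (threads3 w) \<le> card (twos w)"
proof -
  have "card (threads2 w) + card (threads3 w) = card (threads2 w \<union> threads3 w)"
    by (rule card_Un_disjoint[OF finite_threads threads_disjoint, symmetric])
  also have "\<dots> \<le> card (twos w)" using threads_subset finite_parts(2) by (intro card_mono) auto
  finally show ?thesis .
qed

lemma no_threads_at_deg3:
  assumes w: "w \<in> V" "deg V w = 3"
  shows "threads2 w = {}" "threads3 w = {}"
proof -
  have "deg V (other w x) \<noteq> 2" if x: "x \<in> twos w" for x
  proof
    assume d: "deg V (other w x) = 2"
    have x': "x \<in> V" "deg V x = 2" "w \<in> nb V x"
      using x nb_in_V nb_sym[of x w] w(1) by (auto simp: twos_def)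
    note o = other[OF x']
    have xo: "x \<in> nb V (other w x)" using nb_sym[OF x'(1) o(3)] o(1) by blast
    note o' = other[OF o(3) d xo]
    show False
      using no_thread_at_deg3[of w x "other w x" "other x (other w x)", OF _ w(2) o(1) o'(1)]
        w(1) x'(1) o(2-4) o'(2-4) by (simp add: not_sym)
  qed
  then show "threads2 w = {}" "threads3 w = {}" by (auto simp: threads2_def threads3_def)
qed

text \<open>
  A vertex with \<open>d\<close> neighbors apart from leaves can pay \<open>5 d - 12\<close>, and each thread asks for at most 3.
  This suffices for \<open>d \<ge> 6\<close>. For smaller \<open>d\<close> the critical combinations of threads
  are excluded by \<open>star_bound\<close>, applied to at most two of the longest threads, or by
  \<open>no_thread_at_deg3\<close> for a vertex of degree 3.
\<close>

lemma demand_bound: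
  assumes w: "w \<in> V" "deg V w \<noteq> 1" "deg V w \<noteq> 2"
  shows "card (twos w) + card (threads2 w) + 2 * card (threads3 w) + 12
    \<le> 5 * card (twos w) + 5 * card (bigs w)"
proof -
  let ?l = "card (leaves w)" and ?t = "card (twos w)" and ?k = "card (bigs w)"
  let ?a = "card (threads2 w)" and ?b = "card (threads3 w)"
  have tk: "3 \<le> ?t + ?k" by (rule core_deg_ge3[OF w])
  have d: "deg V w = ?l + ?t + ?k" by (rule deg_partition)
  have ab: "?a + ?b \<le> ?t" by (rule card_threads)
  have pick2: "\<exists>F\<subseteq>threads2 w. card F = n" if "n \<le> ?a" for n
    using obtain_subset_with_card_n[OF that] by metis
  have pick3: "\<exists>F\<subseteq>threads3 w. card F = n" if "n \<le> ?b" for n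
    using obtain_subset_with_card_n[OF that] by metis
  show ?thesis
  proof (cases "deg V w = 3")
    case True
    then have "?a = 0" "?b = 0" using no_threads_at_deg3[OF w(1)] by simp_all
    moreover have "?l = 0" using deg_ge4_of_leaf[OF w(1)] True by linarith
    ultimately show ?thesis using d True by linarith
  next
    case False
    then have d4: "4 \<le> deg V w" using d tk by linarith
    have bound2: "(4 - ?k) * (?l + 1 + n - ?k) \<le> 2 * (?l + ?t)" if n: "n \<le> ?a" "n \<le> 2" "?k \<le> ?l + n" for n
    proof -
      obtain F where "F \<subseteq> threads2 w" "card F = n" using pick2[OF n(1)] by blast
      then show ?thesis using star_bound[OF w(1) d4, of F "{}"] n by simp
    qed
    have bound3: "(4 - ?k) * (?l + 1 + n - ?k) + n \<le> 2 * (?l + ?t)" if n: "n \<le> ?b" "n \<le> 2" "?k \<le> ?l + n" for n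
    proof -
      obtain F where "F \<subseteq> threads3 w" "card F = n" using pick3[OF n(1)] by blast
      then show ?thesis using star_bound[OF w(1) d4, of "{}" F] n by simp
    qed
    have "6 \<le> ?t + ?k \<or> ?t + ?k = 5 \<or> ?t + ?k = 4 \<or> ?t + ?k = 3" using tk by linarith
    moreover have "?k = 0 \<or> ?k = 1 \<or> 2 \<le> ?k" by linarith
    ultimately consider "6 \<le> ?t + ?k" | "?t + ?k = 5" "?k \<noteq> 0" | "?t + ?k = 5" "?k = 0"
      | "?t + ?k = 4" "2 \<le> ?k" | "?t + ?k = 4" "?k = 1" | "?t + ?k = 4" "?k = 0"
      | "?t + ?k = 3" "2 \<le> ?k" | "?t + ?k = 3" "?k = 1" | "?t + ?k = 3" "?k = 0"
      by metis
    then show ?thesis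
    proof cases
      case 3
      then have "\<not> 2 \<le> ?b" using bound3[of 2] by auto
      then show ?thesis using 3 ab by linarith
    next
      case 5
      then have "\<not> 2 \<le> ?b" using bound3[of 2] by auto
      then show ?thesis using 5 ab by linarith
    next
      case 6
      then have "\<not> 1 \<le> ?b" using bound3[of 1] by auto
      then show ?thesis using 6 ab by linarith
    next
      case 8
      then have l: "1 \<le> ?l" using d d4 by linarith
      have "\<not> 1 \<le> ?b" using bound3[of 1] 8 l by auto
      moreover have "\<not> 2 \<le> ?a" using bound2[of 2] 8 l by auto
      ultimately show ?thesis using 8 ab by linarith
    next
      case 9
      then have l: "1 \<le> ?l" using d d4 by linarith
      have "?l = 1" using bound2[of 0] 9 l by auto
      then have "\<not> 1 \<le> ?b" "\<not> 1 \<le> ?a" using bound3[of 1] bound2[of 1] 9 by auto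
      then show ?thesis using 9 ab by linarith
    qed (use ab in linarith)+
  qed
qed

end

section \<open>Discharging\<close>

context counterexample
begin

lemma other_eq: "nb V x = {u, z} \<Longrightarrow> z \<noteq> u \<Longrightarrow> other u x = z"
  unfolding other_def by (rule some_equality) (auto simp: doubleton_eq_iff)

definition core :: "'a set" where
  "core = {v \<in> V. deg V v \<noteq> 1}"

definition two :: "'a set" where
  "two = {v \<in> V. deg V v = 2}"

lemma core_facts: "core \<subseteq> V" "two \<subseteq> core" "finite core" "finite two"
  using finite_V by (auto simp: core_def two_def)

lemma nb_core: "nb core v = twos v \<union> bigs v"
proof -
  have "u \<in> nb core v \<longleftrightarrow> u \<in> nb V v \<and> deg V u \<noteq> 1" for u
    by (auto simp: nb_def core_def)
  then have "nb core v = nb V v - leaves v" by (auto simp: leaves_def)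
  moreover have "leaves v \<inter> (twos v \<union> bigs v) = {}" by (auto simp: leaves_def twos_def bigs_def)
  ultimately show ?thesis using nb_partition[of v] by blast
qed

lemma deg_core: "deg core v = card (twos v) + card (bigs v)"
  unfolding deg_def nb_core
  by (rule card_Un_disjoint) (use finite_parts in \<open>auto simp: twos_def bigs_def\<close>)

lemma two_nb_core:
  assumes z: "z \<in> two" and u: "u \<in> nb V z"
  shows "u \<in> core" "u \<in> two \<or> u \<in> core - two"
proof -
  have z': "z \<in> V" "deg V z = 2" using z by (auto simp: two_def)
  have uV: "u \<in> V" using u nb_in_V by blast
  have "deg V u \<noteq> 1"
  proof
    assume "deg V u = 1"
    moreover have "z \<in> nb V u" using nb_sym[OF uV z'(1)] u by blast
    ultimately have "nb V u = {z}" by (auto simp: deg_def card_1_singleton_iff)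
    then have "4 \<le> deg V z" using leaf_nb_deg[OF uV] by blast
    then show False using z' by simp
  qed
  then show "u \<in> core" "u \<in> two \<or> u \<in> core - two" using uV by (auto simp: core_def)
qed

lemma deg_core_two: "v \<in> two \<Longrightarrow> deg core v = 2"
proof -
  assume v: "v \<in> two"
  have "nb core v = nb V v" using two_nb_core[OF v] by (auto simp: nb_def core_def)
  then show "deg core v = 2" using v by (simp add: deg_def two_def)
qed

text \<open>
  Following a thread from \<open>z\<close> through its neighbor \<open>u\<close> reaches an end \<open>w\<close> after at most two more vertices
  of degree 2, by \<open>no_path4\<close>. The pair \<open>(z, u)\<close> is recovered from \<open>w\<close>, the first
  vertex \<open>x\<close> of the thread as seen from \<open>w\<close>, and the position of \<open>z\<close> on the thread.
\<close>

lemma two_directions: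
  assumes z: "z \<in> two" and u: "u \<in> nb V z"
  shows "(z, u) \<in> (\<lambda>(w, x). (x, w)) ` (SIGMA w : core - two. twos w) \<union>
    (\<lambda>(w, x). (other w x, x)) ` (SIGMA w : core - two. threads2 w \<union> threads3 w) \<union>
    (\<lambda>(w, x). (other x (other w x), other w x)) ` (SIGMA w : core - two. threads3 w)"
proof -
  have z': "z \<in> V" "deg V z = 2" using z by (auto simp: two_def)
  have uV: "u \<in> V" using u nb_in_V by blast
  have zu: "z \<in> nb V u" using nb_sym[OF uV z'(1)] u by blast
  show ?thesis
  proof (cases "u \<in> two")
    case False
    then have "u \<in> core - two" using two_nb_core[OF z u] by blast
    moreover have "z \<in> twos u" using zu z' by (simp add: twos_def)
    ultimately have "(z, u) \<in> (\<lambda>(w, x). (x, w)) ` (SIGMA w : core - two. twos w)"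
      by (intro image_eqI[of _ _ "(u, z)"]) auto
    then show ?thesis by blast
  next
    case u2: True
    then have du: "deg V u = 2" by (simp add: two_def)
    define u' where "u' = other z u"
    note o = other[OF uV du zu, folded u'_def]
    have uu': "u \<in> nb V u'" using nb_sym[OF uV o(3)] o(1) by blast
    have turn: "other u' u = z" by (rule other_eq) (use o in auto)
    show ?thesis
    proof (cases "u' \<in> two")
      case False
      have "u' \<in> nb V u" using o(1) by blast
      then have "u' \<in> core - two" using two_nb_core[OF u2] False by blast
      moreover have "u \<in> threads2 u' \<union> threads3 u'"
        using uu' du turn z' by (auto simp: twos_def threads2_def threads3_def)
      ultimately have "(z, u) \<in> (\<lambda>(w, x). (other w x, x)) ` (SIGMA w : core - two. threads2 w \<union> threads3 w)"
        using turn by (intro image_eqI[of _ _ "(u', u)"]) auto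
      then show ?thesis by blast
    next
      case u'2: True
      then have du': "deg V u' = 2" by (simp add: two_def)
      define u'' where "u'' = other u u'"
      note o' = other[OF o(3) du' uu', folded u''_def]
      have uu'': "u' \<in> nb V u''" using nb_sym[OF o(3) o'(3)] o'(1) by blast
      have turn': "other u'' u' = u" by (rule other_eq) (use o' in auto)
      have "u'' \<notin> two"
      proof
        assume "u'' \<in> two"
        then have du'': "deg V u'' = 2" by (simp add: two_def)
        note o'' = other[OF o'(3) du'' uu'']
        note oz = other[OF z' u]
        have nu': "u \<noteq> z" using not_in_nb_self[of z V] u by metis
        have "u'' \<noteq> z"
        proof
          assume "u'' = z"
          then have "nb V u' = {z, u}" using o'(1) by (metis insert_commute)
          from no_triangle[OF z'(1) uV o(3) o(1) this] show False
            using nu' o(2,4) by metis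
        qed
        moreover have "nb V z = {other u z, u}" using oz(1) by (metis insert_commute)
        ultimately show False
          using no_path4[of z u u' u'' "other u z" "other u' u''", OF _ _ o(1) o'(1) o''(1)]
            z'(1) uV o(2-4) o'(2-4) o''(2-4) oz(2-4) nu' by (simp add: not_sym)
      qed
      moreover have "u'' \<in> nb V u'" using o'(1) by blast
      ultimately have "u'' \<in> core - two" using two_nb_core[OF u'2] by blast
      moreover have "u' \<in> threads3 u''"
        using uu'' du du' turn turn' z' by (auto simp: twos_def threads3_def)
      ultimately have "(z, u) \<in> (\<lambda>(w, x). (other x (other w x), other w x)) ` (SIGMA w : core - two. threads3 w)"
        using turn turn' by (intro image_eqI[of _ _ "(u'', u')"]) auto
      then show ?thesis by blast
    qed
  qed
qed

text \<open>
  Each vertex of degree 2 is paid from both directions of its thread. A thread that starts at \<open>w\<close> is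
  counted once for each of its vertices, which gives the coefficients 1, 1 and 2.
\<close>

lemma demand_total:
  "2 * card two \<le> (\<Sum>w\<in>core - two. card (twos w) + card (threads2 w) + 2 * card (threads3 w))"
proof -
  let ?B = "core - two"
  let ?P1 = "SIGMA w : ?B. twos w" and ?P2 = "SIGMA w : ?B. threads2 w \<union> threads3 w" and ?P3 = "SIGMA w : ?B. threads3 w"
  let ?f1 = "\<lambda>(w, x). (x, w)" and ?f2 = "\<lambda>(w, x). (other w x, x)" and ?f3 = "\<lambda>(w, x). (other x (other w x), other w x)"
  have finB: "finite ?B" using core_facts by blast
  have fin: "finite ?P1" "finite ?P2" "finite ?P3"
    using finB finite_parts finite_threads by blast+
  have "2 * card two = (\<Sum>z\<in>two. card (nb V z))" by (simp add: two_def deg_def)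
  also have "\<dots> = card (SIGMA z : two. nb V z)"
    using core_facts(4) finite_nb[OF finite_V] by simp
  also have "\<dots> \<le> card (?f1 ` ?P1 \<union> ?f2 ` ?P2 \<union> ?f3 ` ?P3)"
  proof (rule card_mono)
    show "finite (?f1 ` ?P1 \<union> ?f2 ` ?P2 \<union> ?f3 ` ?P3)" using fin by blast
    show "(SIGMA z : two. nb V z) \<subseteq> ?f1 ` ?P1 \<union> ?f2 ` ?P2 \<union> ?f3 ` ?P3"
    proof (rule subrelI)
      fix z u assume "(z, u) \<in> (SIGMA z : two. nb V z)"
      then have "z \<in> two" "u \<in> nb V z" by blast+
      then show "(z, u) \<in> ?f1 ` ?P1 \<union> ?f2 ` ?P2 \<union> ?f3 ` ?P3" by (rule two_directions)
    qed
  qed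
  also have "\<dots> \<le> card (?f1 ` ?P1) + card (?f2 ` ?P2) + card (?f3 ` ?P3)"
    by (meson add_mono card_Un_le order_refl order_trans)
  also have "\<dots> \<le> card ?P1 + card ?P2 + card ?P3"
    by (intro add_mono card_image_le fin)
  also have "card ?P1 = (\<Sum>w\<in>?B. card (twos w))" using finB finite_parts by simp
  also have "card ?P2 = (\<Sum>w\<in>?B. card (threads2 w) + card (threads3 w))"
    using finB finite_threads threads_disjoint by (simp add: card_Un_disjoint)
  also have "card ?P3 = (\<Sum>w\<in>?B. card (threads3 w))" using finB finite_threads by simp
  finally show ?thesis by (simp add: sum.distrib mult_2)
qed

lemma core_nonempty: "core \<noteq> {}"
proof -
  have "V \<noteq> {}" using uncolorable by (auto simp: pcf_coloring_def proper_on_def)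
  then obtain v where v: "v \<in> V" by blast
  show ?thesis
  proof (cases "deg V v = 1")
    case True
    then obtain w where w: "nb V v = {w}" by (auto simp: deg_def card_1_singleton_iff)
    then have "w \<in> V" using nb_in_V by blast
    moreover have "4 \<le> deg V w" by (rule leaf_nb_deg[OF v w])
    ultimately show ?thesis by (auto simp: core_def)
  next
    case False
    then show ?thesis using v by (auto simp: core_def)
  qed
qed

lemma no_counterexample: False
proof -
  let ?B = "core - two"
  have "5 * (\<Sum>v\<in>core. deg core v) < 12 * card core"
    using sparse_V core_facts(1) core_nonempty by (simp add: sparse_def)
  also have "(\<Sum>v\<in>core. deg core v) = (\<Sum>v\<in>?B. deg core v) + (\<Sum>v\<in>two. deg core v)"
    by (rule sum.subset_diff) (use core_facts in auto)
  also have "(\<Sum>v\<in>two. deg core v) = 2 * card two" by (simp add: deg_core_two)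
  also have "card core = card ?B + card two"
    using core_facts by (metis card_Diff_subset card_mono le_add_diff_inverse2)
  finally have upper: "5 * (\<Sum>v\<in>?B. deg core v) < 2 * card two + 12 * card ?B" by simp
  have "2 * card two + 12 * card ?B \<le>
      (\<Sum>w\<in>?B. card (twos w) + card (threads2 w) + 2 * card (threads3 w)) + (\<Sum>w\<in>?B. 12)"
    using demand_total by simp
  also have "\<dots> = (\<Sum>w\<in>?B. card (twos w) + card (threads2 w) + 2 * card (threads3 w) + 12)"
    by (rule sum.distrib[symmetric])
  also have "\<dots> \<le> (\<Sum>w\<in>?B. 5 * deg core w)"
  proof (rule sum_mono)
    fix w assume w: "w \<in> ?B"
    then have "w \<in> V" "deg V w \<noteq> 1" "deg V w \<noteq> 2" by (auto simp: core_def two_def)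
    then show "card (twos w) + card (threads2 w) + 2 * card (threads3 w) + 12 \<le> 5 * deg core w"
      using demand_bound[of w] by (simp add: deg_core)
  qed
  also have "\<dots> = 5 * (\<Sum>w\<in>?B. deg core w)" by (rule sum_distrib_left[symmetric])
  finally show False using upper by simp
qed

end

section \<open>Coloring sparse graphs\<close>

context adjacency
begin

text \<open>
  With \<open>R\<close> empty, this is the claim for graphs without tight pentagons.
\<close>

theorem sparse_pcf_colorable:
  fixes L :: "'a \<Rightarrow> 'c set"
  assumes "finite V" "sparse V" "large_lists V L" "anchored V L R"
  shows "\<exists>\<phi>. pcf_coloring V L R \<phi>"
  using assms
proof (induction V arbitrary: L R rule: finite_psubset_induct)
  case (psubset V)
  have IH: "\<exists>\<phi>. pcf_coloring V' L' R' \<phi>"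
    if "V' \<subset> V" "large_lists V' L'" "anchored V' L' R'" for V' and L' :: "'a \<Rightarrow> 'c set" and R'
    using psubset.IH[OF that(1) _ that(2,3)] sparse_mono[OF psubset.prems(1)] that(1) by blast
  show ?case
  proof (cases "\<exists>a b c d e. pentagon V a b c d e")
    case True
    then obtain a b c d e where p: "pentagon V a b c d e" by blast
    have "V - {a, b, c, d, e} \<subset> V" using p by (auto simp: pentagon_def)
    from split_off_pentagon[OF psubset.prems(2,3) p IH[OF this]] show ?thesis .
  next
    case no_pent: False
    show ?thesis
    proof (rule ccontr)
      assume none: "\<not> ?thesis"
      have "counterexample E V L"
      proof unfold_locales
        show "\<not> pcf_coloring V L {} \<phi>" for \<phi>
          using none unfolding pcf_coloring_def by blast
        show "finite V" "sparse V" "large_lists V L" by fact+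
        show "\<not> pentagon V a b c d e" for a b c d e using no_pent by blast
        show "\<exists>\<phi>. pcf_coloring V' L' R \<phi>"
          if "V' \<subset> V" "large_lists V' L'" "anchored V' L' R" for V' and L' :: "'a \<Rightarrow> 'c set" and R
          using IH[OF that] .
      qed
      then show False by (rule counterexample.no_counterexample)
    qed
  qed
qed

end

section \<open>Symmetric digraphs\<close>

definition adj :: "'a pair_pre_digraph \<Rightarrow> 'a \<Rightarrow> 'a \<Rightarrow> bool" where
  "adj G u v \<longleftrightarrow> (u, v) \<in> parcs G"

lemma adjacency_adj:
  assumes "pair_graph G"
  shows "adjacency (adj G)"
proof -
  interpret pair_graph G by fact
  show ?thesis
  proof
    show "adj G v u" if "adj G u v" for u v
      using that pair_sym_arcs by (auto simp: adj_def symmetric_def dest: symD)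
    show "\<not> adj G v v" for v using pair_no_loops[of "(v, v)"] by (auto simp: adj_def)
  qed
qed

context
  fixes G :: "'a pair_pre_digraph"
  assumes G: "pair_graph G"
begin

interpretation pair_graph G by (rule G)

interpretation adjacency "adj G" by (rule adjacency_adj[OF G])

lemma nb_neighborhood: "nb (pverts G) v = neighborhood G v"
  by (auto simp: nb_def neighborhood_def adj_def dest: in_arcsD2)

lemma kap_kappa: "kap (pverts G) v = kappa G v"
  by (simp add: kap_def kappa_def deg_def degree_def nb_neighborhood)

definition induced :: "'a set \<Rightarrow> 'a pair_pre_digraph" where
  "induced S = \<lparr>pverts = S, parcs = {(u, v) \<in> parcs G. u \<in> S \<and> v \<in> S}\<rparr>"

lemma induced_nonempty_subgraph:
  assumes "S \<subseteq> pverts G" "S \<noteq> {}"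
  shows "induced S \<in> nonempty_subgraphs G"
proof -
  have fin: "finite S" using assms pair_finite_verts finite_subset by blast
  have H: "pair_graph (induced S)"
  proof
    show "finite (parcs (induced S))"
      by (rule finite_subset[OF _ pair_finite_arcs]) (auto simp: induced_def)
    have "(v, u) \<in> parcs G" if "(u, v) \<in> parcs G" for u v
      using E_sym[of u v] that by (simp add: adj_def)
    then show "symmetric (with_proj (induced S))"
      by (auto simp: symmetric_def sym_def induced_def)
    show "fst e \<noteq> snd e" if "e \<in> parcs (induced S)" for e
      using that pair_no_loops by (auto simp: induced_def)
  qed (use fin in \<open>auto simp: induced_def\<close>)
  then interpret H: pair_graph "induced S" .
  have "subgraph (with_proj (induced S)) (with_proj G)"
    using assms wf_digraph H.wf_digraph by (auto simp: subgraph_def induced_def compatible_def)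
  then show ?thesis using H assms(2) by (simp add: nonempty_subgraphs_def induced_def)
qed

text \<open>
  The degree sum is the number of arcs, and only the two arcs \<open>(a, b)\<close> and \<open>(b, a)\<close> give the
  edge \<open>{a, b}\<close>.
\<close>

lemma sum_deg_le_edges:
  assumes S: "S \<subseteq> pverts G"
  shows "(\<Sum>v\<in>S. deg S v) \<le> 2 * card (undirected_edges (induced S))"
proof -
  have fin: "finite S" using S pair_finite_verts finite_subset by blast
  let ?A = "parcs (induced S)" and ?U = "undirected_edges (induced S)"
  have finA: "finite ?A" by (rule finite_subset[OF _ pair_finite_arcs]) (auto simp: induced_def)
  have "(\<Sum>v\<in>S. deg S v) = card (SIGMA v : S. nb S v)"
    using fin finite_nb[OF fin] by (simp add: deg_def)
  also have "(SIGMA v : S. nb S v) = ?A" by (auto simp: nb_def adj_def induced_def)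
  also have "card ?A \<le> card (\<Union>e\<in>?U. {(u, v). {u, v} = e})"
  proof (rule card_mono)
    have two: "{(u, v). {u, v} = {a, b}} \<subseteq> {(a, b), (b, a)}" for a b :: 'a
      by (auto simp: doubleton_eq_iff)
    have "finite {(u, v). {u, v} = e}" if "e \<in> ?U" for e
      using that finite_subset[OF two] by (auto simp: undirected_edges_def)
    moreover have "finite ?U" using finA by (simp add: undirected_edges_def)
    ultimately show "finite (\<Union>e\<in>?U. {(u, v). {u, v} = e})" by blast
    show "?A \<subseteq> (\<Union>e\<in>?U. {(u, v). {u, v} = e})" by (auto simp: undirected_edges_def)
  qed
  also have "\<dots> \<le> (\<Sum>e\<in>?U. card {(u, v). {u, v} = e})"
    by (rule card_UN_le) (use finA in \<open>simp add: undirected_edges_def\<close>)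
  also have "\<dots> \<le> (\<Sum>e\<in>?U. 2)"
  proof (rule sum_mono)
    fix e assume "e \<in> ?U"
    then obtain a b where "e = {a, b}" by (auto simp: undirected_edges_def)
    then have "{(u, v). {u, v} = e} \<subseteq> {(a, b), (b, a)}" by (auto simp: doubleton_eq_iff)
    then have "card {(u, v). {u, v} = e} \<le> card {(a, b), (b, a)}" by (rule card_mono[rotated]) simp
    also have "\<dots> \<le> 2" by (cases "a = b") simp_all
    finally show "card {(u, v). {u, v} = e} \<le> 2" .
  qed
  finally show ?thesis by simp
qed

lemma sparse_of_mad:
  assumes "mad G < 12 / 5"
  shows "sparse (pverts G)"
  unfolding sparse_def
proof (intro allI impI)
  fix S assume S: "S \<subseteq> pverts G" "S \<noteq> {}"
  have "finite S" using S pair_finite_verts finite_subset by blast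
  then have pos: "0 < card S" using S(2) by (simp add: card_gt_0_iff)
  let ?m = "\<lambda>H. 2 * real (card (undirected_edges H)) / real (card (pverts H))"
  have "?m (induced S) \<le> mad G"
    unfolding mad_def
    by (rule Max_ge) (use finite_nonempty_subgraphs[OF G] induced_nonempty_subgraph[OF S] in auto)
  then have "2 * real (card (undirected_edges (induced S))) / real (card S) < 12 / 5"
    using assms by (simp add: induced_def)
  then have "5 * (2 * real (card (undirected_edges (induced S)))) < 12 * real (card S)"
    using pos by (simp add: field_simps)
  then have "5 * (2 * card (undirected_edges (induced S))) < 12 * card S" by linarith
  then show "5 * (\<Sum>v\<in>S. deg S v) < 12 * card S"
    using sum_deg_le_edges[OF S(1)] by linarith
qed

text \<open>
  A pentagon is closed under adjacency, hence it is all of a connected graph.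
\<close>

lemma pentagon_whole:
  assumes conn: "Digraph_Component.connected (with_proj G)" and p: "pentagon (pverts G) a b c d e"
  shows "pverts G = {a, b, c, d, e}"
proof -
  let ?P = "{a, b, c, d, e}"
  have closed: "v \<in> ?P" if "u \<in> ?P" "(u, v) \<in> parcs G" for u v
  proof -
    have "v \<in> nb (pverts G) u" using that in_arcsD2 by (auto simp: nb_def adj_def)
    then show ?thesis using that(1) p unfolding pentagon_def by auto
  qed
  have arcs: "parcs (mk_symmetric (with_proj G)) \<subseteq> parcs G"
    using E_sym by (auto simp: mk_symmetric_def adj_def)
  define P where "P = ?P"
  have reach: "u \<in> P \<longrightarrow> v \<in> P" if "u \<rightarrow>\<^sup>*\<^bsub>with_proj (mk_symmetric (with_proj G))\<^esub> v" for u v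
    using that unfolding reachable_def
  proof (induction rule: rtrancl_on.induct)
    case (rtrancl_on_refl x)
    show ?case by simp
  next
    case (rtrancl_on_into_rtrancl_on x u v)
    have "(u, v) \<in> parcs G" using rtrancl_on_into_rtrancl_on.hyps(2) arcs by auto
    then show ?case using closed[of u v] rtrancl_on_into_rtrancl_on.IH unfolding P_def by blast
  qed
  moreover have "a \<in> P" by (simp add: P_def)
  ultimately have reach_a: "v \<in> ?P" if "a \<rightarrow>\<^sup>*\<^bsub>with_proj (mk_symmetric (with_proj G))\<^esub> v" for v
    using that unfolding P_def by blast
  have "\<forall>u\<in>pverts G. \<forall>v\<in>pverts G. u \<rightarrow>\<^sup>*\<^bsub>with_proj (mk_symmetric (with_proj G))\<^esub> v"
    using conn unfolding Digraph_Component.connected_def strongly_connected_def by simp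
  moreover have "a \<in> pverts G" "?P \<subseteq> pverts G" using p by (simp_all add: pentagon_def)
  ultimately show ?thesis using reach_a by blast
qed

lemma cycle_graph_5_arcs:
  "parcs (cycle_graph 5) = {(0, 1), (0, 4), (1, 0), (1, 2), (2, 1), (2, 3), (3, 2), (3, 4), (4, 3), (4, 0)}"
  (is "?C = ?A")
proof
  have lt5: "i = 0 \<or> i = 1 \<or> i = 2 \<or> i = 3 \<or> i = 4" if "i < 5" for i :: nat using that by linarith
  show "?C \<subseteq> ?A"
  proof (rule subrelI)
    fix i j assume ij: "(i, j) \<in> ?C"
    then consider "i < 5" "j = Suc i mod 5" | "j < 5" "i = Suc j mod 5" by (auto simp: cycle_graph_def)
    then show "(i, j) \<in> ?A"
    proof cases
      case 1
      from lt5[OF 1(1)] show ?thesis by (elim disjE) (simp_all add: 1(2))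
    next
      case 2
      from lt5[OF 2(1)] show ?thesis by (elim disjE) (simp_all add: 2(2))
    qed
  qed
  show "?A \<subseteq> ?C" by (auto simp: cycle_graph_def)
qed

lemma pentagon_iso:
  assumes p: "pentagon (pverts G) a b c d e" and V: "pverts G = {a, b, c, d, e}"
  shows "digraph_iso (with_proj G) (with_proj (cycle_graph 5))"
proof -
  have dist: "distinct [a, b, c, d, e]" using p by (simp add: pentagon_def)
  define \<iota> where "\<iota> = (\<lambda>v. if v = a then 0 else if v = b then 1 else if v = c then 2 else if v = d then 3 else 4 :: nat)"
  have \<iota>: "\<iota> a = 0" "\<iota> b = 1" "\<iota> c = 2" "\<iota> d = 3" "\<iota> e = 4" using dist by (auto simp: \<iota>_def)
  have inj: "inj_on \<iota> (pverts G)" using \<iota> unfolding V by (auto simp: inj_on_def)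
  have "parcs G = (SIGMA u : pverts G. nb (pverts G) u)"
    using in_arcsD1 in_arcsD2 by (auto simp: nb_def adj_def)
  also have "\<dots> = {(a, b), (a, e), (b, a), (b, c), (c, b), (c, d), (d, c), (d, e), (e, d), (e, a)}"
  proof -
    have Sigma_split: "Sigma (insert x A) B = Pair x ` B x \<union> Sigma A B" for x A and B :: "'a \<Rightarrow> 'a set" by auto
    have "nb (pverts G) a = {b, e}" "nb (pverts G) b = {a, c}" "nb (pverts G) c = {b, d}"
      "nb (pverts G) d = {c, e}" "nb (pverts G) e = {d, a}" using p by (simp_all add: pentagon_def)
    then show ?thesis by (subst (1) V) (simp only: Sigma_split Sigma_empty1 image_insert image_empty Un_insert_left Un_empty_left)
  qed
  finally have arcs: "parcs G = {(a, b), (a, e), (b, a), (b, c), (c, b), (c, d), (d, c), (d, e), (e, d), (e, a)}" .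
  let ?f = "\<lparr>iso_verts = \<iota>, iso_arcs = map_prod \<iota> \<iota>, iso_head = snd, iso_tail = fst\<rparr>"
  have "inj_on (map_prod \<iota> \<iota>) (parcs G)"
    by (rule inj_on_subset[OF map_prod_inj_on[OF inj inj]]) (use in_arcsD1 in_arcsD2 in auto)
  then have "pre_digraph.digraph_isomorphism (with_proj G) ?f"
    unfolding pre_digraph.digraph_isomorphism_def using inj wf_digraph by auto
  moreover have "with_proj (cycle_graph 5) = app_iso ?f (with_proj G)"
  proof -
    have "{..<5 :: nat} = {0, 1, 2, 3, 4}" by auto
    then have "pverts (cycle_graph 5) = \<iota> ` pverts G" unfolding V by (simp add: cycle_graph_def \<iota>)
    moreover have "parcs (cycle_graph 5) = map_prod \<iota> \<iota> ` parcs G"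
      unfolding cycle_graph_5_arcs arcs by (simp add: \<iota>)
    ultimately show ?thesis by (simp add: app_iso_def with_proj_def)
  qed
  ultimately show ?thesis unfolding digraph_iso_def by blast
qed

lemma pcf_choosable_of_sparse:
  assumes sparse: "sparse (pverts G)" and no_pent: "\<And>a b c d e. \<not> pentagon (pverts G) a b c d e"
  shows "pcf_choosable TYPE('c) G (kappa G)"
  unfolding pcf_choosable_def
proof (intro allI impI)
  fix L :: "'a \<Rightarrow> 'c set"
  assume L: "\<forall>v\<in>pverts G. infinite (L v) \<or> kappa G v \<le> card (L v)"
  \<comment> \<open>Lists may be infinite, so they are first cut down to the required size.\<close>
  have "\<exists>A. A \<subseteq> L v \<and> finite A \<and> card A = kappa G v" if "v \<in> pverts G" for v
  proof (cases "finite (L v)")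
    case True
    then have "kappa G v \<le> card (L v)" using L that by blast
    then show ?thesis using obtain_subset_with_card_n by metis
  next
    case False
    then show ?thesis using infinite_arbitrarily_large by metis
  qed
  then obtain L' where L': "\<And>v. v \<in> pverts G \<Longrightarrow> L' v \<subseteq> L v \<and> finite (L' v) \<and> card (L' v) = kappa G v"
    by metis
  have "large_lists (pverts G) L'" using L' by (simp add: large_lists_def kap_kappa)
  moreover have "anchored (pverts G) L' {}" using no_pent by (simp add: anchored_def)
  ultimately obtain \<phi> where \<phi>: "pcf_coloring (pverts G) L' {} \<phi>"
    using sparse_pcf_colorable[OF pair_finite_verts sparse] by blast
  have "proper_list_coloring G L \<phi>"
    unfolding proper_list_coloring_def
  proof (intro conjI ballI)
    show "\<phi> v \<in> L v" if "v \<in> pverts G" for v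
      using \<phi> L'[OF that] that by (auto simp: pcf_coloring_def proper_on_def)
    show "case z of (u, v) \<Rightarrow> \<phi> u \<noteq> \<phi> v" if "z \<in> parcs G" for z
    proof -
      obtain u v where z: "z = (u, v)" by (cases z)
      then have "u \<in> pverts G" "v \<in> nb (pverts G) u"
        using that in_arcsD1 in_arcsD2 by (auto simp: nb_def adj_def)
      then have "\<phi> v \<noteq> \<phi> u" using \<phi> by (auto simp: pcf_coloring_def proper_on_def)
      then show ?thesis using z by auto
    qed
  qed
  moreover have "conflict_free G \<phi>"
    unfolding conflict_free_def
  proof (intro ballI impI)
    fix v assume v: "v \<in> pverts G" "neighborhood G v \<noteq> {}"
    then have "has_unique (neighborhood G v) \<phi>"
      using \<phi> unfolding pcf_coloring_def nb_neighborhood by blast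
    then show "\<exists>c. \<exists>!u. u \<in> neighborhood G v \<and> \<phi> u = c"
      unfolding has_unique_def by blast
  qed
  ultimately show "\<exists>\<phi>. proper_list_coloring G L \<phi> \<and> conflict_free G \<phi>" by blast
qed

end

theorem theorem1p7:
  fixes G :: "'a pair_pre_digraph"
  assumes "pair_graph G"
    and "Digraph_Component.connected (with_proj G)"
    and "\<not> digraph_iso (with_proj G) (with_proj (cycle_graph 5))"
    and "mad G < 12 / 5"
  shows "pcf_choosable TYPE('c) G (kappa G)"
proof (rule pcf_choosable_of_sparse[OF assms(1)])
  show "adjacency.sparse (adj G) (pverts G)"
    by (rule sparse_of_mad[OF assms(1,4)])
  show "\<not> adjacency.pentagon (adj G) (pverts G) a b c d e" for a b c d e
    using pentagon_iso[OF assms(1)] pentagon_whole[OF assms(1,2)] assms(3) by blast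
qed

end
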